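(* Let $A$ be a unital associative algebra over a commutative ring $k$. Then $HS_0(A)\cong A/([A,A])$, where $([A,A])$ is the two-sided ideal of $A$ generated by the commutator submodule $[A,A]$.
   Context: Category $\Delta S$: objects are the sets $[n]=\{0,1,\dots,n\}$, $n\ge 0$; a morphism $[n]\to[m]$ is a set map $f$ together with a total order on each fibre $f^{-1}(j)$. The composite of $f:[n]\to[m]$ and $g:[m]\to[l]$ has underlying map $g\circ f$, and the fibre over $i$ is ordered by concatenating the ordered fibres $f^{-1}(j)$, with $j$ running over $g^{-1}(i)$ in its given order. The symmetric bar construction is the covariant functor $B_*^{sym}A:\Delta S\to k\text{-Mod}$, $[n]\mapsto A^{\otimes(n+1)}$; a morphism $\alpha:[n]\to[m]$ sends $a_0\otimes\cdots\otimes a_n$ to $b_0\otimes\cdots\otimes b_m$, where $b_j$ is the product of the $a_i$, $i\in\alpha^{-1}(j)$, in the given order of the fibre ($b_j=1$ if the fibre is empty). Symmetric homology is $HS_*(A)=\mathrm{Tor}_*^{\Delta S}(\underline{k},B_*^{sym}A)$, where $\underline{k}$ is the constant contravariant functor with value $k$; equivalently, the left derived functors of $\mathrm{colim}_{\Delta S}$ evaluated at $B_*^{sym}A$. $[A,A]$ is the $k$-submodule spanned by all $ab-ba$. *)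

theory Defs
  imports "HOL-Algebra.Module" "HOL-Algebra.Ideal"
begin

section \<open>Modules over a commutative ring\<close>

text \<open>
  The fields \<^term>\<open>mult\<close> and \<^term>\<open>one\<close> of a record of type \<open>module\<close> carry no meaning for a
  module; in the constructions below they are filled with arbitrary values.
\<close>

definition module_hom ::
  "('k, 'r) ring_scheme \<Rightarrow> ('k, 'm, 's) module_scheme \<Rightarrow> ('k, 'n, 't) module_scheme \<Rightarrow> ('m \<Rightarrow> 'n) set"
  where "module_hom R M N =
    {f. f \<in> carrier M \<rightarrow> carrier N \<and>
        (\<forall>x\<in>carrier M. \<forall>y\<in>carrier M. f (x \<oplus>\<^bsub>M\<^esub> y) = f x \<oplus>\<^bsub>N\<^esub> f y) \<and>
        (\<forall>r\<in>carrier R. \<forall>x\<in>carrier M. f (r \<odot>\<^bsub>M\<^esub> x) = r \<odot>\<^bsub>N\<^esub> f x)}"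

definition module_isomorphic ::
  "('k, 'r) ring_scheme \<Rightarrow> ('k, 'm, 's) module_scheme \<Rightarrow> ('k, 'n, 't) module_scheme \<Rightarrow> bool"
  where "module_isomorphic R M N \<longleftrightarrow>
    (\<exists>f \<in> module_hom R M N. bij_betw f (carrier M) (carrier N))"

definition module_span ::
  "('k, 'r) ring_scheme \<Rightarrow> ('k, 'm, 's) module_scheme \<Rightarrow> 'm set \<Rightarrow> 'm set"
  where "module_span R M S = \<Inter>{N. submodule N R M \<and> S \<subseteq> N}"

definition quot_module ::
  "('k, 'm, 's) module_scheme \<Rightarrow> 'm set \<Rightarrow> ('k, 'm set) module"
  where "quot_module M N =
    \<lparr>carrier = a_rcosets\<^bsub>M\<^esub> N, mult = undefined, one = undefined,
     zero = N, add = set_add M, smult = (\<lambda>r C. \<Union>x\<in>C. N +>\<^bsub>M\<^esub> (r \<odot>\<^bsub>M\<^esub> x))\<rparr>"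

text \<open>The map \<open>M/N \<rightarrow> M'/N'\<close> induced by \<open>f : M \<rightarrow> M'\<close> with \<open>f(N) \<subseteq> N'\<close>; only \<open>M'\<close> and \<open>N'\<close> are needed.\<close>

definition quot_map ::
  "('k, 'n, 't) module_scheme \<Rightarrow> 'n set \<Rightarrow> ('m \<Rightarrow> 'n) \<Rightarrow> 'm set \<Rightarrow> 'n set"
  where "quot_map M' N' f C = (\<Union>x\<in>C. N' +>\<^bsub>M'\<^esub> f x)"

definition regular_module :: "('k, 'r) ring_scheme \<Rightarrow> ('k, 'k) module"
  where "regular_module R =
    \<lparr>carrier = carrier R, mult = mult R, one = one R, zero = zero R, add = add R, smult = mult R\<rparr>"

definition free_module :: "('k, 'r) ring_scheme \<Rightarrow> 'x set \<Rightarrow> ('k, 'x \<Rightarrow> 'k) module"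
  where "free_module R X =
    \<lparr>carrier = {c. range c \<subseteq> carrier R \<and> finite {x. c x \<noteq> \<zero>\<^bsub>R\<^esub>} \<and> {x. c x \<noteq> \<zero>\<^bsub>R\<^esub>} \<subseteq> X},
     mult = undefined, one = undefined,
     zero = (\<lambda>x. \<zero>\<^bsub>R\<^esub>), add = (\<lambda>c d x. c x \<oplus>\<^bsub>R\<^esub> d x), smult = (\<lambda>r c x. r \<otimes>\<^bsub>R\<^esub> c x)\<rparr>"

definition basis_elt :: "('k, 'r) ring_scheme \<Rightarrow> 'x \<Rightarrow> 'x \<Rightarrow> 'k"
  where "basis_elt R x = (\<lambda>y. if y = x then \<one>\<^bsub>R\<^esub> else \<zero>\<^bsub>R\<^esub>)"

definition lin_ext ::
  "('k, 'r) ring_scheme \<Rightarrow> ('k, 'm, 's) module_scheme \<Rightarrow> ('x \<Rightarrow> 'm) \<Rightarrow> ('x \<Rightarrow> 'k) \<Rightarrow> 'm"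
  where "lin_ext R M f c = finsum M (\<lambda>x. c x \<odot>\<^bsub>M\<^esub> f x) {x. c x \<noteq> \<zero>\<^bsub>R\<^esub>}"

text \<open>The module with generators \<open>X\<close> and relators \<open>S\<close>, and the map from such a module to
  \<open>\<langle>Y | T\<rangle>\<close> that is given on generators by \<open>h\<close>.\<close>

definition presented_module ::
  "('k, 'r) ring_scheme \<Rightarrow> 'x set \<Rightarrow> ('x \<Rightarrow> 'k) set \<Rightarrow> ('k, ('x \<Rightarrow> 'k) set) module"
  where "presented_module R X S =
    quot_module (free_module R X) (module_span R (free_module R X) S)"

definition presented_map ::
  "('k, 'r) ring_scheme \<Rightarrow> 'y set \<Rightarrow> ('y \<Rightarrow> 'k) set \<Rightarrow> ('x \<Rightarrow> 'y) \<Rightarrow> ('x \<Rightarrow> 'k) set \<Rightarrow> ('y \<Rightarrow> 'k) set"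
  where "presented_map R Y T h =
    quot_map (free_module R Y) (module_span R (free_module R Y) T)
      (lin_ext R (free_module R Y) (\<lambda>x. basis_elt R (h x)))"

text \<open>Homology of a complex \<open>\<dots> \<rightarrow> C 2 \<rightarrow> C 1 \<rightarrow> C 0 \<rightarrow> 0\<close> with \<open>d q : C (q + 1) \<rightarrow> C q\<close>.\<close>

definition cycles :: "(nat \<Rightarrow> ('k, 'm) module) \<Rightarrow> (nat \<Rightarrow> 'm \<Rightarrow> 'm) \<Rightarrow> nat \<Rightarrow> 'm set"
  where "cycles C d q =
    (case q of 0 \<Rightarrow> carrier (C 0)
     | Suc p \<Rightarrow> {z \<in> carrier (C (Suc p)). d p z = \<zero>\<^bsub>C p\<^esub>})"

definition homology_module ::
  "(nat \<Rightarrow> ('k, 'm) module) \<Rightarrow> (nat \<Rightarrow> 'm \<Rightarrow> 'm) \<Rightarrow> nat \<Rightarrow> ('k, 'm set) module"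
  where "homology_module C d q =
    quot_module ((C q)\<lparr>carrier := cycles C d q\<rparr>) (d q ` carrier (C (Suc q)))"


section \<open>The category \<open>\<Delta>S\<close>\<close>

text \<open>
  A total order on a finite set is recorded as the list of its elements in increasing order.  A
  morphism \<open>[n] \<rightarrow> [m]\<close> is a pair \<open>(f, w)\<close> where \<open>f\<close> is the underlying map and \<open>w j\<close> lists the
  fibre of \<open>f\<close> over \<open>j\<close> in its order.  The object \<open>[n]\<close> is the set \<^term>\<open>{..n::nat}\<close>.
\<close>

type_synonym dS_mor = "(nat \<Rightarrow> nat) \<times> (nat \<Rightarrow> nat list)"

definition dS_hom :: "nat \<Rightarrow> nat \<Rightarrow> dS_mor set"
  where "dS_hom n m =
    {(f, w). f \<in> {..n} \<rightarrow>\<^sub>E {..m} \<and> w \<in> extensional {..m} \<and>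
             (\<forall>j\<in>{..m}. distinct (w j) \<and> set (w j) = {i \<in> {..n}. f i = j})}"

definition dS_id :: "nat \<Rightarrow> dS_mor"
  where "dS_id n = (\<lambda>i\<in>{..n}. i, \<lambda>j\<in>{..n}. [j])"

text \<open>\<open>dS_comp n l \<beta> \<alpha>\<close> is the composite \<open>\<beta> \<circ> \<alpha>\<close> of \<open>\<alpha> : [n] \<rightarrow> [m]\<close> and \<open>\<beta> : [m] \<rightarrow> [l]\<close>.\<close>

definition dS_comp :: "nat \<Rightarrow> nat \<Rightarrow> dS_mor \<Rightarrow> dS_mor \<Rightarrow> dS_mor"
  where "dS_comp n l \<beta> \<alpha> =
    (compose {..n} (fst \<beta>) (fst \<alpha>), \<lambda>i\<in>{..l}. concat (map (snd \<alpha>) (snd \<beta> i)))"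


section \<open>Functors from \<open>\<Delta>S\<close> to modules\<close>

text \<open>\<open>fmap F n m \<alpha>\<close> is the map that \<open>F\<close> assigns to \<open>\<alpha> : [n] \<rightarrow> [m]\<close>.  The same record serves
  for functors of both variances.\<close>

record ('k, 'm) dS_functor =
  fobj :: "nat \<Rightarrow> ('k, 'm) module"
  fmap :: "nat \<Rightarrow> nat \<Rightarrow> dS_mor \<Rightarrow> 'm \<Rightarrow> 'm"

definition covariant_functor :: "('k, 'r) ring_scheme \<Rightarrow> ('k, 'm) dS_functor \<Rightarrow> bool"
  where "covariant_functor R F \<longleftrightarrow>
    (\<forall>n. module R (fobj F n)) \<and>
    (\<forall>n m. \<forall>\<alpha>\<in>dS_hom n m. fmap F n m \<alpha> \<in> module_hom R (fobj F n) (fobj F m)) \<and>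
    (\<forall>n. \<forall>x\<in>carrier (fobj F n). fmap F n n (dS_id n) x = x) \<and>
    (\<forall>n m l. \<forall>\<alpha>\<in>dS_hom n m. \<forall>\<beta>\<in>dS_hom m l. \<forall>x\<in>carrier (fobj F n).
       fmap F n l (dS_comp n l \<beta> \<alpha>) x = fmap F m l \<beta> (fmap F n m \<alpha> x))"

definition contravariant_functor :: "('k, 'r) ring_scheme \<Rightarrow> ('k, 'm) dS_functor \<Rightarrow> bool"
  where "contravariant_functor R G \<longleftrightarrow>
    (\<forall>n. module R (fobj G n)) \<and>
    (\<forall>n m. \<forall>\<alpha>\<in>dS_hom n m. fmap G n m \<alpha> \<in> module_hom R (fobj G m) (fobj G n)) \<and>
    (\<forall>n. \<forall>x\<in>carrier (fobj G n). fmap G n n (dS_id n) x = x) \<and>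
    (\<forall>n m l. \<forall>\<alpha>\<in>dS_hom n m. \<forall>\<beta>\<in>dS_hom m l. \<forall>x\<in>carrier (fobj G l).
       fmap G n l (dS_comp n l \<beta> \<alpha>) x = fmap G n m \<alpha> (fmap G m l \<beta> x))"

text \<open>Natural transformations between contravariant functors.\<close>

definition contra_nat_trans ::
  "('k, 'r) ring_scheme \<Rightarrow> ('k, 'm) dS_functor \<Rightarrow> ('k, 'n) dS_functor \<Rightarrow> (nat \<Rightarrow> 'm \<Rightarrow> 'n) \<Rightarrow> bool"
  where "contra_nat_trans R G H \<eta> \<longleftrightarrow>
    (\<forall>n. \<eta> n \<in> module_hom R (fobj G n) (fobj H n)) \<and>
    (\<forall>n m. \<forall>\<alpha>\<in>dS_hom n m. \<forall>x\<in>carrier (fobj G m).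
       \<eta> n (fmap G n m \<alpha> x) = fmap H n m \<alpha> (\<eta> m x))"

definition const_functor :: "('k, 'r) ring_scheme \<Rightarrow> ('k, 'k) dS_functor"
  where "const_functor R = \<lparr>fobj = (\<lambda>n. regular_module R), fmap = (\<lambda>n m \<alpha> x. x)\<rparr>"

text \<open>
  Projectivity in the abelian category of contravariant functors, whose epimorphisms are the
  objectwise surjections.  A definition cannot quantify over types, so the carrier types of the
  test objects have to be fixed.  The types chosen suffice: among the test epimorphisms \<open>M \<rightarrow> N\<close>
  there is the canonical free cover
  \<open>\<Oplus>\<^bsub>(m, x), x \<in> P[m]\<^esub> k[Hom(-, [m])] \<rightarrow> P\<close>, and a functor through whose free cover the
  identity lifts is a direct summand of a free functor, hence has the lifting property with respect
  to all epimorphisms.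
\<close>

definition projective_functor :: "('k, 'r) ring_scheme \<Rightarrow> ('k, 'm) dS_functor \<Rightarrow> bool"
  where "projective_functor R P \<longleftrightarrow>
    contravariant_functor R P \<and>
    (\<forall>(M :: ('k, nat \<times> dS_mor \<times> 'm \<Rightarrow> 'k) dS_functor) (N :: ('k, 'm) dS_functor) \<epsilon> \<eta>.
       contravariant_functor R M \<longrightarrow> contravariant_functor R N \<longrightarrow>
       contra_nat_trans R M N \<epsilon> \<longrightarrow> (\<forall>n. \<epsilon> n ` carrier (fobj M n) = carrier (fobj N n)) \<longrightarrow>
       contra_nat_trans R P N \<eta> \<longrightarrow>
       (\<exists>\<theta>. contra_nat_trans R P M \<theta> \<and> (\<forall>n. \<forall>x\<in>carrier (fobj P n). \<epsilon> n (\<theta> n x) = \<eta> n x)))"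

text \<open>
  \<open>\<dots> \<rightarrow> P 1 \<rightarrow> P 0 \<rightarrow> G \<rightarrow> 0\<close> is a projective resolution, with differential
  \<open>d q : P (q + 1) \<rightarrow> P q\<close> and augmentation \<open>\<epsilon> : P 0 \<rightarrow> G\<close>.
\<close>

definition projective_resolution ::
  "('k, 'r) ring_scheme \<Rightarrow> ('k, 'g) dS_functor \<Rightarrow> (nat \<Rightarrow> ('k, 'm) dS_functor) \<Rightarrow>
   (nat \<Rightarrow> nat \<Rightarrow> 'm \<Rightarrow> 'm) \<Rightarrow> (nat \<Rightarrow> 'm \<Rightarrow> 'g) \<Rightarrow> bool"
  where "projective_resolution R G P d \<epsilon> \<longleftrightarrow>
    (\<forall>q. projective_functor R (P q)) \<and>
    (\<forall>q. contra_nat_trans R (P (Suc q)) (P q) (d q)) \<and>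
    contra_nat_trans R (P 0) G \<epsilon> \<and>
    (\<forall>n. \<epsilon> n ` carrier (fobj (P 0) n) = carrier (fobj G n)) \<and>
    (\<forall>n. d 0 n ` carrier (fobj (P 1) n) =
         {x \<in> carrier (fobj (P 0) n). \<epsilon> n x = \<zero>\<^bsub>fobj G n\<^esub>}) \<and>
    (\<forall>q n. d (Suc q) n ` carrier (fobj (P (Suc (Suc q))) n) =
         {x \<in> carrier (fobj (P (Suc q)) n). d q n x = \<zero>\<^bsub>fobj (P q) n\<^esub>})"

text \<open>
  The tensor product \<open>G \<otimes>\<^bsub>\<Delta>S\<^esub> F\<close>, that is \<open>\<Oplus>\<^sub>n G[n] \<otimes> F[n]\<close> modulo
  \<open>G(\<alpha>)(x) \<otimes> y - x \<otimes> F(\<alpha>)(y)\<close>; the generator \<open>(n, x, y)\<close> stands for \<open>x \<otimes> y\<close> in the summand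
  \<open>G[n] \<otimes> F[n]\<close>.
\<close>

definition tensor_gens :: "('k, 'm) dS_functor \<Rightarrow> ('k, 'y) dS_functor \<Rightarrow> (nat \<times> 'm \<times> 'y) set"
  where "tensor_gens G F = {(n, x, y). x \<in> carrier (fobj G n) \<and> y \<in> carrier (fobj F n)}"

definition tensor_rels ::
  "('k, 'r) ring_scheme \<Rightarrow> ('k, 'm) dS_functor \<Rightarrow> ('k, 'y) dS_functor \<Rightarrow> (nat \<times> 'm \<times> 'y \<Rightarrow> 'k) set"
  where "tensor_rels R G F =
    (let L = free_module R (tensor_gens G F); e = (\<lambda>n x y. basis_elt R (n, x, y)) in
      {e n (x \<oplus>\<^bsub>fobj G n\<^esub> x') y \<ominus>\<^bsub>L\<^esub> (e n x y \<oplus>\<^bsub>L\<^esub> e n x' y) | n x x' y.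
         x \<in> carrier (fobj G n) \<and> x' \<in> carrier (fobj G n) \<and> y \<in> carrier (fobj F n)} \<union>
      {e n x (y \<oplus>\<^bsub>fobj F n\<^esub> y') \<ominus>\<^bsub>L\<^esub> (e n x y \<oplus>\<^bsub>L\<^esub> e n x y') | n x y y'.
         x \<in> carrier (fobj G n) \<and> y \<in> carrier (fobj F n) \<and> y' \<in> carrier (fobj F n)} \<union>
      {e n (r \<odot>\<^bsub>fobj G n\<^esub> x) y \<ominus>\<^bsub>L\<^esub> r \<odot>\<^bsub>L\<^esub> e n x y | n r x y.
         r \<in> carrier R \<and> x \<in> carrier (fobj G n) \<and> y \<in> carrier (fobj F n)} \<union>
      {e n x (r \<odot>\<^bsub>fobj F n\<^esub> y) \<ominus>\<^bsub>L\<^esub> r \<odot>\<^bsub>L\<^esub> e n x y | n r x y.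
         r \<in> carrier R \<and> x \<in> carrier (fobj G n) \<and> y \<in> carrier (fobj F n)} \<union>
      {e n (fmap G n m \<alpha> x) y \<ominus>\<^bsub>L\<^esub> e m x (fmap F n m \<alpha> y) | n m \<alpha> x y.
         \<alpha> \<in> dS_hom n m \<and> x \<in> carrier (fobj G m) \<and> y \<in> carrier (fobj F n)})"

definition tensor_dS ::
  "('k, 'r) ring_scheme \<Rightarrow> ('k, 'm) dS_functor \<Rightarrow> ('k, 'y) dS_functor \<Rightarrow>
   ('k, (nat \<times> 'm \<times> 'y \<Rightarrow> 'k) set) module"
  where "tensor_dS R G F = presented_module R (tensor_gens G F) (tensor_rels R G F)"

text \<open>The map \<open>\<eta> \<otimes> F : G \<otimes> F \<rightarrow> H \<otimes> F\<close> induced by \<open>\<eta> : G \<rightarrow> H\<close>.\<close>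

definition tensor_dS_map ::
  "('k, 'r) ring_scheme \<Rightarrow> ('k, 'n) dS_functor \<Rightarrow> ('k, 'y) dS_functor \<Rightarrow> (nat \<Rightarrow> 'm \<Rightarrow> 'n) \<Rightarrow>
   (nat \<times> 'm \<times> 'y \<Rightarrow> 'k) set \<Rightarrow> (nat \<times> 'n \<times> 'y \<Rightarrow> 'k) set"
  where "tensor_dS_map R H F \<eta> =
    presented_map R (tensor_gens H F) (tensor_rels R H F) (\<lambda>(n, x, y). (n, \<eta> n x, y))"

text \<open>
  \<open>Tor_q(G, F)\<close>, computed from a projective resolution \<open>(P, d)\<close> of the contravariant functor \<open>G\<close>.
\<close>

definition Tor_dS ::
  "('k, 'r) ring_scheme \<Rightarrow> (nat \<Rightarrow> ('k, 'm) dS_functor) \<Rightarrow> (nat \<Rightarrow> nat \<Rightarrow> 'm \<Rightarrow> 'm) \<Rightarrow>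
   ('k, 'y) dS_functor \<Rightarrow> nat \<Rightarrow> ('k, (nat \<times> 'm \<times> 'y \<Rightarrow> 'k) set set) module"
  where "Tor_dS R P d F q =
    homology_module (\<lambda>p. tensor_dS R (P p) F) (\<lambda>p. tensor_dS_map R (P p) F (d p)) q"


section \<open>Associative algebras and symmetric homology\<close>

text \<open>The locale \<open>algebra\<close> of the library is restricted to commutative algebras.\<close>

locale unital_algebra = module R A + ring A for R (structure) and A (structure) +
  assumes smult_mult_left:
      "\<lbrakk>r \<in> carrier R; x \<in> carrier A; y \<in> carrier A\<rbrakk> \<Longrightarrow>
       (r \<odot>\<^bsub>A\<^esub> x) \<otimes>\<^bsub>A\<^esub> y = r \<odot>\<^bsub>A\<^esub> (x \<otimes>\<^bsub>A\<^esub> y)"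
    and smult_mult_right:
      "\<lbrakk>r \<in> carrier R; x \<in> carrier A; y \<in> carrier A\<rbrakk> \<Longrightarrow>
       x \<otimes>\<^bsub>A\<^esub> (r \<odot>\<^bsub>A\<^esub> y) = r \<odot>\<^bsub>A\<^esub> (x \<otimes>\<^bsub>A\<^esub> y)"

text \<open>The generator \<open>a\<close> of \<open>tensor_power R A n\<close> stands for \<open>a 0 \<otimes> \<dots> \<otimes> a n\<close>, so this module is
  the tensor power of \<open>A\<close> with exponent \<open>n + 1\<close>.\<close>

definition tensor_power_gens :: "('k, 'a, 's) module_scheme \<Rightarrow> nat \<Rightarrow> (nat \<Rightarrow> 'a) set"
  where "tensor_power_gens A n = {..n} \<rightarrow>\<^sub>E carrier A"

definition tensor_power_rels ::
  "('k, 'r) ring_scheme \<Rightarrow> ('k, 'a, 's) module_scheme \<Rightarrow> nat \<Rightarrow> ((nat \<Rightarrow> 'a) \<Rightarrow> 'k) set"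
  where "tensor_power_rels R A n =
    (let L = free_module R (tensor_power_gens A n); e = basis_elt R in
      {e (a(i := x \<oplus>\<^bsub>A\<^esub> y)) \<ominus>\<^bsub>L\<^esub> (e (a(i := x)) \<oplus>\<^bsub>L\<^esub> e (a(i := y))) | a i x y.
         a \<in> tensor_power_gens A n \<and> i \<le> n \<and> x \<in> carrier A \<and> y \<in> carrier A} \<union>
      {e (a(i := r \<odot>\<^bsub>A\<^esub> x)) \<ominus>\<^bsub>L\<^esub> r \<odot>\<^bsub>L\<^esub> e (a(i := x)) | a i r x.
         a \<in> tensor_power_gens A n \<and> i \<le> n \<and> r \<in> carrier R \<and> x \<in> carrier A})"

definition tensor_power ::
  "('k, 'r) ring_scheme \<Rightarrow> ('k, 'a, 's) module_scheme \<Rightarrow> nat \<Rightarrow> ('k, ((nat \<Rightarrow> 'a) \<Rightarrow> 'k) set) module"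
  where "tensor_power R A n = presented_module R (tensor_power_gens A n) (tensor_power_rels R A n)"

text \<open>\<open>fibre_products A m \<alpha>\<close> sends \<open>(a 0, \<dots>, a n)\<close> to \<open>(b 0, \<dots>, b m)\<close>.\<close>

definition fibre_products ::
  "('k, 'a, 's) module_scheme \<Rightarrow> nat \<Rightarrow> dS_mor \<Rightarrow> (nat \<Rightarrow> 'a) \<Rightarrow> nat \<Rightarrow> 'a"
  where "fibre_products A m \<alpha> a =
    (\<lambda>j\<in>{..m}. foldr (\<lambda>i p. a i \<otimes>\<^bsub>A\<^esub> p) (snd \<alpha> j) \<one>\<^bsub>A\<^esub>)"

definition Bsym ::
  "('k, 'r) ring_scheme \<Rightarrow> ('k, 'a, 's) module_scheme \<Rightarrow> ('k, ((nat \<Rightarrow> 'a) \<Rightarrow> 'k) set) dS_functor"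
  where "Bsym R A =
    \<lparr>fobj = tensor_power R A,
     fmap = (\<lambda>n m \<alpha>. presented_map R (tensor_power_gens A m) (tensor_power_rels R A m)
                       (fibre_products A m \<alpha>))\<rparr>"

text \<open>Symmetric homology, computed from a projective resolution \<open>(P, d)\<close> of the constant
  contravariant functor.\<close>

definition HS ::
  "('k, 'r) ring_scheme \<Rightarrow> ('k, 'a, 's) module_scheme \<Rightarrow>
   (nat \<Rightarrow> ('k, 'm) dS_functor) \<Rightarrow> (nat \<Rightarrow> nat \<Rightarrow> 'm \<Rightarrow> 'm) \<Rightarrow> nat \<Rightarrow>
   ('k, (nat \<times> 'm \<times> ((nat \<Rightarrow> 'a) \<Rightarrow> 'k) set \<Rightarrow> 'k) set set) module"
  where "HS R A P d q = Tor_dS R P d (Bsym R A) q"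

definition commutator_submodule ::
  "('k, 'r) ring_scheme \<Rightarrow> ('k, 'a, 's) module_scheme \<Rightarrow> 'a set"
  where "commutator_submodule R A =
    module_span R A {a \<otimes>\<^bsub>A\<^esub> b \<ominus>\<^bsub>A\<^esub> b \<otimes>\<^bsub>A\<^esub> a | a b. a \<in> carrier A \<and> b \<in> carrier A}"

section \<open>Existence of projective resolutions\<close>

text \<open>
  The bar construction is a projective resolution of the constant functor over every commutative
  ring (theorem \<open>bar_resolution\<close> below).
\<close>

lemma free_module_sel:
  "carrier (free_module R X) = {c. range c \<subseteq> carrier R \<and> finite {x. c x \<noteq> \<zero>\<^bsub>R\<^esub>} \<and> {x. c x \<noteq> \<zero>\<^bsub>R\<^esub>} \<subseteq> X}"
  "\<zero>\<^bsub>free_module R X\<^esub> = (\<lambda>x. \<zero>\<^bsub>R\<^esub>)"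
  "c \<oplus>\<^bsub>free_module R X\<^esub> d = (\<lambda>x. c x \<oplus>\<^bsub>R\<^esub> d x)"
  "r \<odot>\<^bsub>free_module R X\<^esub> c = (\<lambda>x. r \<otimes>\<^bsub>R\<^esub> c x)"
  by (simp_all add: free_module_def)

lemma free_module_carrierI:
  assumes "\<And>x. c x \<in> carrier R" "finite S" "S \<subseteq> X" "\<And>x. x \<notin> S \<Longrightarrow> c x = \<zero>\<^bsub>R\<^esub>"
  shows "c \<in> carrier (free_module R X)"
proof -
  have "{x. c x \<noteq> \<zero>\<^bsub>R\<^esub>} \<subseteq> S" using assms(4) by blast
  then show ?thesis
    using assms(1-3) by (auto simp: free_module_sel intro: finite_subset)
qed

lemma free_module_coeff: "c \<in> carrier (free_module R X) \<Longrightarrow> c x \<in> carrier R"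
  by (auto simp: free_module_sel)

lemma free_module_is_module:
  assumes "cring R"
  shows "module R (free_module R X)"
proof -
  interpret R: cring R by fact
  have add: "(\<lambda>x. c x \<oplus>\<^bsub>R\<^esub> d x) \<in> carrier (free_module R X)"
    if "c \<in> carrier (free_module R X)" "d \<in> carrier (free_module R X)" for c d
  proof (rule free_module_carrierI[where S = "{x. c x \<noteq> \<zero>\<^bsub>R\<^esub>} \<union> {x. d x \<noteq> \<zero>\<^bsub>R\<^esub>}"])
    show "c x \<oplus>\<^bsub>R\<^esub> d x \<in> carrier R" for x using that by (simp add: free_module_coeff)
  qed (use that in \<open>auto simp: free_module_sel\<close>)
  have sm: "(\<lambda>x. r \<otimes>\<^bsub>R\<^esub> c x) \<in> carrier (free_module R X)"
    if "r \<in> carrier R" "c \<in> carrier (free_module R X)" for r c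
  proof (rule free_module_carrierI[where S = "{x. c x \<noteq> \<zero>\<^bsub>R\<^esub>}"])
    show "r \<otimes>\<^bsub>R\<^esub> c x \<in> carrier R" for x using that by (simp add: free_module_coeff)
  qed (use that in \<open>auto simp: free_module_sel\<close>)
  have neg: "(\<lambda>x. \<ominus>\<^bsub>R\<^esub> c x) \<in> carrier (free_module R X)"
    if "c \<in> carrier (free_module R X)" for c
  proof (rule free_module_carrierI[where S = "{x. c x \<noteq> \<zero>\<^bsub>R\<^esub>}"])
    show "\<ominus>\<^bsub>R\<^esub> c x \<in> carrier R" for x using that by (simp add: free_module_coeff)
  qed (use that in \<open>auto simp: free_module_sel\<close>)
  have ab: "abelian_group (free_module R X)"
  proof (rule abelian_groupI)
    fix c assume c: "c \<in> carrier (free_module R X)"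
    show "\<exists>d\<in>carrier (free_module R X). d \<oplus>\<^bsub>free_module R X\<^esub> c = \<zero>\<^bsub>free_module R X\<^esub>"
      using neg[OF c] c
      by (intro bexI[where x = "\<lambda>x. \<ominus>\<^bsub>R\<^esub> c x"]) (simp_all add: free_module_sel(2,3) free_module_coeff R.l_neg)
  next
    fix c d e assume c: "c \<in> carrier (free_module R X)" "d \<in> carrier (free_module R X)"
      "e \<in> carrier (free_module R X)"
    show "c \<oplus>\<^bsub>free_module R X\<^esub> d \<oplus>\<^bsub>free_module R X\<^esub> e = c \<oplus>\<^bsub>free_module R X\<^esub> (d \<oplus>\<^bsub>free_module R X\<^esub> e)"
      using c by (simp add: free_module_sel(3) free_module_coeff R.a_assoc)
  next
    fix c d assume c: "c \<in> carrier (free_module R X)" "d \<in> carrier (free_module R X)"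
    show "c \<oplus>\<^bsub>free_module R X\<^esub> d = d \<oplus>\<^bsub>free_module R X\<^esub> c"
      using c by (simp add: free_module_sel(3) free_module_coeff R.a_comm)
    show "c \<oplus>\<^bsub>free_module R X\<^esub> d \<in> carrier (free_module R X)"
      unfolding free_module_sel(3) by (rule add[OF c])
  next
    fix c assume c: "c \<in> carrier (free_module R X)"
    show "\<zero>\<^bsub>free_module R X\<^esub> \<oplus>\<^bsub>free_module R X\<^esub> c = c"
      using c by (simp add: free_module_sel(2,3) free_module_coeff)
  qed (auto simp: free_module_sel)
  show ?thesis
  proof (rule moduleI[OF \<open>cring R\<close> ab])
    fix a x assume "a \<in> carrier R" "x \<in> carrier (free_module R X)"
    then show "a \<odot>\<^bsub>free_module R X\<^esub> x \<in> carrier (free_module R X)"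
      unfolding free_module_sel(4) by (rule sm)
  qed (simp_all add: free_module_sel(3,4) free_module_coeff R.l_distr R.r_distr R.m_assoc)
qed

lemma basis_elt_closed:
  "cring R \<Longrightarrow> x \<in> X \<Longrightarrow> basis_elt R x \<in> carrier (free_module R X)"
  by (rule free_module_carrierI[where S = "{x}"])
    (auto simp: basis_elt_def cring.cring_simprules)

lemma free_module_mono: "X \<subseteq> Y \<Longrightarrow> c \<in> carrier (free_module R X) \<Longrightarrow> c \<in> carrier (free_module R Y)"
  by (auto simp: free_module_sel)

lemma free_module_induct [consumes 2, case_names zero step]:
  fixes R :: "('k, 'r) ring_scheme" and c :: "'x \<Rightarrow> 'k"
  assumes "cring R" and c: "c \<in> carrier (free_module R X)"
    and "Q (\<lambda>x. \<zero>\<^bsub>R\<^esub>)"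
    and step: "\<And>c x r. \<lbrakk>c \<in> carrier (free_module R X); x \<in> X; r \<in> carrier R; Q c\<rbrakk>
      \<Longrightarrow> Q (c \<oplus>\<^bsub>free_module R X\<^esub> r \<odot>\<^bsub>free_module R X\<^esub> basis_elt R x)"
  shows "Q c"
proof -
  interpret R: cring R by fact
  have "\<forall>c :: 'x \<Rightarrow> 'k. c \<in> carrier (free_module R X) \<longrightarrow> {x. c x \<noteq> \<zero>\<^bsub>R\<^esub>} = S \<longrightarrow> Q c" if "finite S" for S
    using that
  proof (induction S)
    case empty
    show ?case
    proof (intro allI impI)
      fix c :: "'x \<Rightarrow> 'k" assume "{x. c x \<noteq> \<zero>\<^bsub>R\<^esub>} = {}"
      then have "c = (\<lambda>x. \<zero>\<^bsub>R\<^esub>)" by auto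
      then show "Q c" using assms(3) by simp
    qed
  next
    case (insert x S)
    show ?case
    proof (intro allI impI)
      fix c :: "'x \<Rightarrow> 'k" assume c: "c \<in> carrier (free_module R X)" and s: "{x. c x \<noteq> \<zero>\<^bsub>R\<^esub>} = insert x S"
      let ?c = "c(x := \<zero>\<^bsub>R\<^esub>)"
      have s': "{y. ?c y \<noteq> \<zero>\<^bsub>R\<^esub>} = S" using s insert.hyps(2) by auto
      have sX: "insert x S \<subseteq> X" using c s by (auto simp: free_module_sel)
      have xX: "x \<in> X" using sX by blast
      have "?c \<in> carrier (free_module R X)"
        using c insert.hyps(1) s' sX by (auto simp: free_module_sel)
      then have "Q (?c \<oplus>\<^bsub>free_module R X\<^esub> c x \<odot>\<^bsub>free_module R X\<^esub> basis_elt R x)"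
        using insert.IH s' xX c by (intro step) (auto simp: free_module_coeff)
      moreover have "?c \<oplus>\<^bsub>free_module R X\<^esub> c x \<odot>\<^bsub>free_module R X\<^esub> basis_elt R x = c"
        using c by (auto simp: free_module_sel(3,4) basis_elt_def free_module_coeff fun_eq_iff)
      ultimately show "Q c" by simp
    qed
  qed
  then show ?thesis using c by (auto simp: free_module_sel)
qed

lemma module_homD:
  assumes "f \<in> module_hom R M N"
  shows "x \<in> carrier M \<Longrightarrow> f x \<in> carrier N"
    and "x \<in> carrier M \<Longrightarrow> y \<in> carrier M \<Longrightarrow> f (x \<oplus>\<^bsub>M\<^esub> y) = f x \<oplus>\<^bsub>N\<^esub> f y"
    and "r \<in> carrier R \<Longrightarrow> x \<in> carrier M \<Longrightarrow> f (r \<odot>\<^bsub>M\<^esub> x) = r \<odot>\<^bsub>N\<^esub> f x"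
  using assms by (auto simp: module_hom_def)

lemma module_hom_zero:
  assumes "module R M" "module R N" "f \<in> module_hom R M N"
  shows "f \<zero>\<^bsub>M\<^esub> = \<zero>\<^bsub>N\<^esub>"
proof -
  interpret M: module R M by fact
  interpret N: module R N by fact
  have "f (\<zero>\<^bsub>R\<^esub> \<odot>\<^bsub>M\<^esub> \<zero>\<^bsub>M\<^esub>) = \<zero>\<^bsub>R\<^esub> \<odot>\<^bsub>N\<^esub> f \<zero>\<^bsub>M\<^esub>"
    by (rule module_homD(3)[OF assms(3)]) auto
  moreover have "f \<zero>\<^bsub>M\<^esub> \<in> carrier N" by (rule module_homD(1)[OF assms(3)]) auto
  ultimately show ?thesis by simp
qed

lemma module_hom_comp:
  "f \<in> module_hom R M N \<Longrightarrow> g \<in> module_hom R N L \<Longrightarrow> (\<lambda>x. g (f x)) \<in> module_hom R M L"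
  by (auto simp: module_hom_def Pi_iff)

lemma free_module_hom_eq:
  assumes "cring R" "module R M" "f \<in> module_hom R (free_module R X) M"
    "g \<in> module_hom R (free_module R X) M" "\<And>x. x \<in> X \<Longrightarrow> f (basis_elt R x) = g (basis_elt R x)"
    "c \<in> carrier (free_module R X)"
  shows "f c = g c"
  using assms(1,6)
proof (induction rule: free_module_induct)
  case zero
  show ?case
    using module_hom_zero[OF free_module_is_module[OF assms(1)] assms(2) assms(3)]
      module_hom_zero[OF free_module_is_module[OF assms(1)] assms(2) assms(4)]
    by (simp add: free_module_sel(2))
next
  case (step c x r)
  interpret F: module R "free_module R X" by (rule free_module_is_module[OF assms(1)])
  have b: "basis_elt R x \<in> carrier (free_module R X)" by (rule basis_elt_closed[OF assms(1)]) fact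
  then show ?case
    using step assms(5)
    by (simp add: module_homD[OF assms(3)] module_homD[OF assms(4)])
qed

lemma lin_ext_superset:
  assumes "module R M" "f \<in> X \<rightarrow> carrier M" "c \<in> carrier (free_module R X)"
    "finite S" "{x. c x \<noteq> \<zero>\<^bsub>R\<^esub>} \<subseteq> S" "S \<subseteq> X"
  shows "lin_ext R M f c = finsum M (\<lambda>x. c x \<odot>\<^bsub>M\<^esub> f x) S"
proof -
  interpret M: module R M by fact
  show ?thesis unfolding lin_ext_def
    by (rule M.add.finprod_mono_neutral_cong_left)
      (use assms free_module_coeff[OF assms(3)] in \<open>auto simp: Pi_iff\<close>)
qed

lemma lin_ext_hom:
  assumes "module R M" "f \<in> X \<rightarrow> carrier M"
  shows "lin_ext R M f \<in> module_hom R (free_module R X) M"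
proof -
  interpret M: module R M by fact
  interpret F: module R "free_module R X" by (rule free_module_is_module) (rule module.axioms(1)[OF assms(1)])
  show ?thesis unfolding module_hom_def
  proof (intro CollectI conjI ballI funcsetI)
    fix c assume c: "c \<in> carrier (free_module R X)"
    then show "lin_ext R M f c \<in> carrier M"
      unfolding lin_ext_def using assms free_module_coeff[OF c]
      by (intro M.finsum_closed) (auto simp: free_module_sel(1) Pi_iff subset_iff)
    fix r assume r: "r \<in> carrier R"
    let ?S = "{x. c x \<noteq> \<zero>\<^bsub>R\<^esub>}"
    have S: "finite ?S" "?S \<subseteq> X" using c by (auto simp: free_module_sel)
    have rc: "(r \<odot>\<^bsub>free_module R X\<^esub> c) \<in> carrier (free_module R X)" using r c by simp
    have "lin_ext R M f (r \<odot>\<^bsub>free_module R X\<^esub> c)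
        = finsum M (\<lambda>x. (r \<odot>\<^bsub>free_module R X\<^esub> c) x \<odot>\<^bsub>M\<^esub> f x) ?S"
      by (rule lin_ext_superset[OF assms rc])
        (use S r in \<open>auto simp: free_module_sel(4)\<close>)
    also have "\<dots> = finsum M (\<lambda>x. r \<odot>\<^bsub>M\<^esub> (c x \<odot>\<^bsub>M\<^esub> f x)) ?S"
      using S r c assms(2)
      by (intro M.finsum_cong' refl) (auto simp: free_module_sel(4) free_module_coeff M.smult_assoc1 Pi_iff)
    also have "\<dots> = r \<odot>\<^bsub>M\<^esub> lin_ext R M f c"
      unfolding lin_ext_def using S r c assms(2)
      by (intro M.finsum_smult_ldistr[symmetric]) (auto simp: free_module_coeff Pi_iff)
    finally show "lin_ext R M f (r \<odot>\<^bsub>free_module R X\<^esub> c) = r \<odot>\<^bsub>M\<^esub> lin_ext R M f c" .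
  next
    fix c d assume c: "c \<in> carrier (free_module R X)" and d: "d \<in> carrier (free_module R X)"
    let ?S = "{x. c x \<noteq> \<zero>\<^bsub>R\<^esub>} \<union> {x. d x \<noteq> \<zero>\<^bsub>R\<^esub>}"
    have S: "finite ?S" "?S \<subseteq> X" using c d by (auto simp: free_module_sel)
    have cd: "(c \<oplus>\<^bsub>free_module R X\<^esub> d) \<in> carrier (free_module R X)" using c d by simp
    have "lin_ext R M f (c \<oplus>\<^bsub>free_module R X\<^esub> d)
        = finsum M (\<lambda>x. (c \<oplus>\<^bsub>free_module R X\<^esub> d) x \<odot>\<^bsub>M\<^esub> f x) ?S"
      by (rule lin_ext_superset[OF assms cd])
        (use S in \<open>auto simp: free_module_sel(3)\<close>)
    also have "\<dots> = finsum M (\<lambda>x. c x \<odot>\<^bsub>M\<^esub> f x \<oplus>\<^bsub>M\<^esub> d x \<odot>\<^bsub>M\<^esub> f x) ?S"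
      using S c d assms(2)
      by (intro M.finsum_cong' refl) (auto simp: free_module_sel(3) free_module_coeff M.smult_l_distr Pi_iff)
    also have "\<dots> = finsum M (\<lambda>x. c x \<odot>\<^bsub>M\<^esub> f x) ?S \<oplus>\<^bsub>M\<^esub> finsum M (\<lambda>x. d x \<odot>\<^bsub>M\<^esub> f x) ?S"
      using S c d assms(2)
      by (intro M.finsum_addf) (auto simp: free_module_coeff Pi_iff)
    also have "\<dots> = lin_ext R M f c \<oplus>\<^bsub>M\<^esub> lin_ext R M f d"
      using S by (simp add: lin_ext_superset[OF assms c, of ?S] lin_ext_superset[OF assms d, of ?S])
    finally show "lin_ext R M f (c \<oplus>\<^bsub>free_module R X\<^esub> d) = lin_ext R M f c \<oplus>\<^bsub>M\<^esub> lin_ext R M f d" .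
  qed
qed

lemma lin_ext_basis:
  assumes "module R M" "f x \<in> carrier M"
  shows "lin_ext R M f (basis_elt R x) = f x"
proof -
  interpret M: module R M by fact
  have "lin_ext R M f (basis_elt R x) = finsum M (\<lambda>y. basis_elt R x y \<odot>\<^bsub>M\<^esub> f y) {x}"
    by (rule lin_ext_superset[where X = "{x}", OF assms(1) _ basis_elt_closed[OF module.axioms(1)[OF assms(1)]]])
      (use assms in \<open>auto simp: basis_elt_def\<close>)
  also have "\<dots> = f x" using assms by (simp add: basis_elt_def)
  finally show ?thesis .
qed

lemma dS_id_hom: "dS_id n \<in> dS_hom n n"
  by (auto simp: dS_hom_def dS_id_def extensional_def)

lemma dS_comp_hom:
  assumes "\<alpha> \<in> dS_hom n m" "\<beta> \<in> dS_hom m l"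
  shows "dS_comp n l \<beta> \<alpha> \<in> dS_hom n l"
proof -
  obtain f v g w where \<alpha>: "\<alpha> = (f, v)" and \<beta>: "\<beta> = (g, w)" by (cases \<alpha>, cases \<beta>)
  have f: "\<And>i. i \<le> n \<Longrightarrow> f i \<le> m" and v: "\<And>j. j \<le> m \<Longrightarrow> distinct (v j) \<and> set (v j) = {i \<in> {..n}. f i = j}"
    using assms(1) by (auto simp: \<alpha> dS_hom_def)
  have g: "\<And>i. i \<le> m \<Longrightarrow> g i \<le> l" and w: "\<And>j. j \<le> l \<Longrightarrow> distinct (w j) \<and> set (w j) = {i \<in> {..m}. g i = j}"
    using assms(2) by (auto simp: \<beta> dS_hom_def)
  have d: "distinct (concat (map v js))" if "distinct js" "\<forall>j\<in>set js. j \<le> m" for js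
    using that
  proof (induction js)
    case (Cons j js)
    have "set (v j) \<inter> set (concat (map v js)) = {}"
      using Cons.prems v by fastforce
    then show ?case using Cons v by auto
  qed simp
  have "distinct (concat (map v (w i))) \<and> set (concat (map v (w i))) = {k \<in> {..n}. g (f k) = i}"
    if "i \<le> l" for i
  proof
    show "distinct (concat (map v (w i)))" using d w[OF that] by auto
    show "set (concat (map v (w i))) = {k \<in> {..n}. g (f k) = i}"
      using w[OF that] v f by auto
  qed
  then show ?thesis using f g
    by (auto simp: dS_hom_def dS_comp_def \<alpha> \<beta> compose_def)
qed

lemma dS_comp_id_right:
  assumes "\<beta> \<in> dS_hom n m"
  shows "dS_comp n m \<beta> (dS_id n) = \<beta>"
proof -
  obtain f v where \<beta>: "\<beta> = (f, v)" by (cases \<beta>)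
  have f: "f \<in> extensional {..n}" and v: "v \<in> extensional {..m}"
    and s: "\<And>j. j \<le> m \<Longrightarrow> set (v j) \<subseteq> {..n}"
    using assms by (auto simp: \<beta> dS_hom_def PiE_def)
  have "concat (map (\<lambda>j\<in>{..n}. [j]) js) = js" if "set js \<subseteq> {..n}" for js
    using that by (induction js) auto
  then show ?thesis using f v s
    by (auto simp: \<beta> dS_comp_def dS_id_def compose_def fun_eq_iff extensional_def)
qed

lemma dS_comp_id_left:
  assumes "\<beta> \<in> dS_hom n m"
  shows "dS_comp n m (dS_id m) \<beta> = \<beta>"
proof -
  obtain f v where \<beta>: "\<beta> = (f, v)" by (cases \<beta>)
  have f: "f \<in> extensional {..n}" "\<And>i. i \<le> n \<Longrightarrow> f i \<le> m" and v: "v \<in> extensional {..m}"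
    using assms by (auto simp: \<beta> dS_hom_def PiE_def)
  then show ?thesis
    by (auto simp: \<beta> dS_comp_def dS_id_def compose_def fun_eq_iff extensional_def)
qed

lemma dS_comp_assoc:
  assumes "\<alpha> \<in> dS_hom n m" "\<beta> \<in> dS_hom m l" "\<gamma> \<in> dS_hom l k"
  shows "dS_comp n k \<gamma> (dS_comp n l \<beta> \<alpha>) = dS_comp n k (dS_comp m k \<gamma> \<beta>) \<alpha>"
proof -
  obtain f u g v h w where e: "\<alpha> = (f, u)" "\<beta> = (g, v)" "\<gamma> = (h, w)" by (cases \<alpha>, cases \<beta>, cases \<gamma>)
  have f: "\<And>i. i \<le> n \<Longrightarrow> f i \<le> m" and w: "\<And>j. j \<le> k \<Longrightarrow> set (w j) \<subseteq> {..l}"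
    using assms by (auto simp: e dS_hom_def PiE_def)
  have "concat (map (\<lambda>i\<in>{..l}. concat (map u (v i))) js) = concat (map u (concat (map v js)))"
    if "set js \<subseteq> {..l}" for js
    using that by (induction js) auto
  then show ?thesis using f w
    by (auto simp: e dS_comp_def compose_def fun_eq_iff)
qed


text \<open>
  Chains of morphisms starting at \<open>[n]\<close>: the list \<open>[(n\<^sub>0, \<alpha>\<^sub>0), (n\<^sub>1, \<alpha>\<^sub>1), \<dots>]\<close> stands for
  \<open>[n] \<rightarrow> [n\<^sub>0] \<rightarrow> [n\<^sub>1] \<rightarrow> \<dots>\<close>.
\<close>

fun is_chain :: "nat \<Rightarrow> (nat \<times> dS_mor) list \<Rightarrow> bool" where
  "is_chain n [] \<longleftrightarrow> True"
| "is_chain n ((m, \<alpha>) # c) \<longleftrightarrow> \<alpha> \<in> dS_hom n m \<and> is_chain m c"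

definition bar_chains :: "nat \<Rightarrow> nat \<Rightarrow> (nat \<times> dS_mor) list set"
  where "bar_chains q n = {c. is_chain n c \<and> length c = q}"

fun precomp :: "nat \<Rightarrow> dS_mor \<Rightarrow> (nat \<times> dS_mor) list \<Rightarrow> (nat \<times> dS_mor) list" where
  "precomp n \<alpha> [] = []"
| "precomp n \<alpha> ((m, \<beta>) # c) = (m, dS_comp n m \<beta> \<alpha>) # c"

lemma precomp_chain: "\<alpha> \<in> dS_hom n l \<Longrightarrow> is_chain l c \<Longrightarrow> is_chain n (precomp n \<alpha> c)"
  by (cases "(n, \<alpha>, c)" rule: precomp.cases) (auto intro: dS_comp_hom)

lemma length_precomp [simp]: "length (precomp n \<alpha> c) = length c"
  by (cases "(n, \<alpha>, c)" rule: precomp.cases) auto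

lemma precomp_id: "is_chain n c \<Longrightarrow> precomp n (dS_id n) c = c"
  by (cases "(n, dS_id n, c)" rule: precomp.cases) (auto simp: dS_comp_id_right)

lemma precomp_comp:
  "\<alpha> \<in> dS_hom n m \<Longrightarrow> \<beta> \<in> dS_hom m l \<Longrightarrow> is_chain l c \<Longrightarrow>
   precomp n (dS_comp n l \<beta> \<alpha>) c = precomp n \<alpha> (precomp m \<beta> c)"
  by (cases "(m, \<beta>, c)" rule: precomp.cases) (auto simp: dS_comp_assoc)

abbreviation "fr R \<equiv> free_module R UNIV"

definition fr_map :: "('k, 'r) ring_scheme \<Rightarrow> ('x \<Rightarrow> 'y) \<Rightarrow> ('x \<Rightarrow> 'k) \<Rightarrow> 'y \<Rightarrow> 'k"
  where "fr_map R h = lin_ext R (fr R) (\<lambda>x. basis_elt R (h x))"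

text \<open>
  The alternating boundary of the bar construction, by recursion on the chain:
  \<open>\<partial>(\<alpha> # c) = c \<circ> \<alpha> - \<alpha> # \<partial>c\<close>.  Chains of length \<open>q + 1\<close> span degree \<open>q\<close>; the empty chain spans
  the augmentation \<open>k\<close>.
\<close>

primrec bar_boundary :: "('k, 'r) ring_scheme \<Rightarrow> (nat \<times> dS_mor) list \<Rightarrow> nat \<Rightarrow> (nat \<times> dS_mor) list \<Rightarrow> 'k" where
  "bar_boundary R [] = (\<lambda>n. \<zero>\<^bsub>fr R\<^esub>)"
| "bar_boundary R (x # c) = (\<lambda>n. basis_elt R (precomp n (snd x) c) \<ominus>\<^bsub>fr R\<^esub> fr_map R (Cons x) (bar_boundary R c (fst x)))"

definition bar_d :: "('k, 'r) ring_scheme \<Rightarrow> nat \<Rightarrow> ((nat \<times> dS_mor) list \<Rightarrow> 'k) \<Rightarrow> (nat \<times> dS_mor) list \<Rightarrow> 'k"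
  where "bar_d R n = lin_ext R (fr R) (\<lambda>c. bar_boundary R c n)"

definition bar_functor :: "('k, 'r) ring_scheme \<Rightarrow> nat \<Rightarrow> ('k, (nat \<times> dS_mor) list \<Rightarrow> 'k) dS_functor"
  where "bar_functor R q =
    \<lparr>fobj = (\<lambda>n. free_module R (bar_chains (Suc q) n)), fmap = (\<lambda>n m \<alpha>. fr_map R (precomp n \<alpha>))\<rparr>"

context
  fixes R :: "('k, 'r) ring_scheme"
  assumes cr: "cring R"
begin

interpretation R: cring R by (rule cr)

lemmas free_is_module [simp] = free_module_is_module[OF cr]

lemma basis_in [simp]: "x \<in> X \<Longrightarrow> basis_elt R x \<in> carrier (free_module R X)"
  by (rule basis_elt_closed[OF cr])

lemma module_hom_restrict:
  assumes "f \<in> module_hom R (fr R) (fr R :: ('k, 'y \<Rightarrow> 'k) module)"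
    and "\<And>x. x \<in> X \<Longrightarrow> f (basis_elt R x) \<in> carrier (free_module R Y)"
  shows "f \<in> module_hom R (free_module R X) (free_module R Y)"
proof -
  interpret Y: module R "free_module R Y" by simp
  note h = module_homD[OF assms(1)]
  have cl: "f c \<in> carrier (free_module R Y)" if "c \<in> carrier (free_module R X)" for c
    using cr that
  proof (induction rule: free_module_induct)
    case zero
    have "f (\<lambda>x. \<zero>\<^bsub>R\<^esub>) = (\<lambda>y. \<zero>\<^bsub>R\<^esub>)"
      using module_hom_zero[OF free_is_module free_is_module assms(1)] by (simp add: free_module_sel(2))
    then show ?case using Y.zero_closed by (simp add: free_module_sel(2))
  next
    case (step c x r)
    interpret F: module R "fr R :: ('k, 'a \<Rightarrow> 'k) module" by simp
    have "f (c \<oplus>\<^bsub>fr R\<^esub> r \<odot>\<^bsub>fr R\<^esub> basis_elt R x) = f c \<oplus>\<^bsub>fr R\<^esub> r \<odot>\<^bsub>fr R\<^esub> f (basis_elt R x)"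
      using step free_module_mono[OF subset_UNIV step(1)] by (simp add: h)
    then have "f (c \<oplus>\<^bsub>free_module R X\<^esub> r \<odot>\<^bsub>free_module R X\<^esub> basis_elt R x)
      = f c \<oplus>\<^bsub>free_module R Y\<^esub> r \<odot>\<^bsub>free_module R Y\<^esub> f (basis_elt R x)"
      by (simp add: free_module_sel)
    then show ?case using step assms(2) by simp
  qed
  show ?thesis unfolding module_hom_def
  proof (intro CollectI conjI ballI funcsetI cl)
    fix c d assume "c \<in> carrier (free_module R X)" "d \<in> carrier (free_module R X)"
    then have "f (c \<oplus>\<^bsub>fr R\<^esub> d) = f c \<oplus>\<^bsub>fr R\<^esub> f d"
      by (intro h(2)) (auto intro: free_module_mono[OF subset_UNIV])
    then show "f (c \<oplus>\<^bsub>free_module R X\<^esub> d) = f c \<oplus>\<^bsub>free_module R Y\<^esub> f d"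
      by (simp add: free_module_sel)
  next
    fix r c assume "r \<in> carrier R" "c \<in> carrier (free_module R X)"
    then have "f (r \<odot>\<^bsub>fr R\<^esub> c) = r \<odot>\<^bsub>fr R\<^esub> f c"
      by (intro h(3)) (auto intro: free_module_mono[OF subset_UNIV])
    then show "f (r \<odot>\<^bsub>free_module R X\<^esub> c) = r \<odot>\<^bsub>free_module R Y\<^esub> f c"
      by (simp add: free_module_sel)
  qed
qed

lemma fr_map_hom [simp]: "fr_map R h \<in> module_hom R (fr R) (fr R)"
  unfolding fr_map_def by (rule lin_ext_hom) auto

lemma fr_map_basis [simp]: "fr_map R h (basis_elt R x) = basis_elt R (h x)"
  unfolding fr_map_def by (rule lin_ext_basis) auto

lemma fr_map_closed [simp]: "z \<in> carrier (fr R) \<Longrightarrow> fr_map R h z \<in> carrier (fr R)"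
  by (rule module_homD(1)[OF fr_map_hom])

lemma fr_map_restrict:
  "h \<in> X \<rightarrow> Y \<Longrightarrow> fr_map R h \<in> module_hom R (free_module R X) (free_module R Y)"
  by (rule module_hom_restrict) (simp_all add: basis_elt_closed[OF cr] Pi_iff)

lemma fr_map_zero [simp]: "fr_map R h \<zero>\<^bsub>fr R\<^esub> = \<zero>\<^bsub>fr R\<^esub>"
  by (rule module_hom_zero[OF free_is_module free_is_module fr_map_hom])

lemma fr_zero_closed [simp]: "\<zero>\<^bsub>fr R\<^esub> \<in> carrier (fr R)"
  by (simp add: free_module_sel image_subset_iff)

lemma module_hom_sub:
  assumes "f \<in> module_hom R (fr R) (fr R :: ('k, 'y \<Rightarrow> 'k) module)"
  shows "f \<in> module_hom R (free_module R X) (fr R)"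
  using module_homD(1)[OF assms] by (intro module_hom_restrict[OF assms]) auto

lemma bar_boundary_closed [simp]: "bar_boundary R c n \<in> carrier (fr R)"
proof (induction c arbitrary: n)
  case Nil
  show ?case by simp
next
  case (Cons x c)
  interpret F: module R "fr R :: ('k, (nat \<times> dS_mor) list \<Rightarrow> 'k) module" by simp
  show ?case by (simp add: Cons)
qed

lemma bar_d_hom [simp]: "bar_d R n \<in> module_hom R (fr R) (fr R)"
  unfolding bar_d_def by (rule lin_ext_hom) auto

lemma bar_d_basis [simp]: "bar_d R n (basis_elt R c) = bar_boundary R c n"
  unfolding bar_d_def by (rule lin_ext_basis) auto

lemma free_minus:
  assumes "c \<in> carrier (free_module R X)" "d \<in> carrier (free_module R X)"
  shows "c \<ominus>\<^bsub>free_module R X\<^esub> d = (\<lambda>x. c x \<ominus>\<^bsub>R\<^esub> d x)"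
proof -
  interpret F: module R "free_module R X" by simp
  have n: "(\<lambda>x. \<ominus>\<^bsub>R\<^esub> \<one>\<^bsub>R\<^esub> \<otimes>\<^bsub>R\<^esub> d x) \<in> carrier (free_module R X)"
    using F.smult_closed[of "\<ominus>\<^bsub>R\<^esub> \<one>\<^bsub>R\<^esub>" d] assms by (simp add: free_module_sel(4))
  have "\<ominus>\<^bsub>free_module R X\<^esub> d = (\<lambda>x. \<ominus>\<^bsub>R\<^esub> \<one>\<^bsub>R\<^esub> \<otimes>\<^bsub>R\<^esub> d x)"
    using F.minus_equality[OF _ assms(2) n] assms(2)
    by (simp add: free_module_sel(2,3) free_module_coeff R.l_minus R.l_neg)
  then show ?thesis using assms
    by (simp add: F.minus_eq free_module_sel(3) free_module_coeff R.l_minus R.minus_eq)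
qed

lemma bd_restrict:
  "c \<in> bar_chains (Suc q) n \<Longrightarrow> bar_boundary R c n \<in> carrier (free_module R (bar_chains q n))"
proof (induction q arbitrary: c n)
  case 0
  then obtain x where c: "c = [x]" by (auto simp: bar_chains_def length_Suc_conv)
  interpret F: module R "fr R :: ('k, (nat \<times> dS_mor) list \<Rightarrow> 'k) module" by simp
  have z: "fr_map R (Cons x) \<zero>\<^bsub>fr R\<^esub> = \<zero>\<^bsub>fr R\<^esub>" by (rule module_hom_zero[OF free_is_module free_is_module fr_map_hom])
  have "bar_boundary R c n = basis_elt R []"
    by (simp add: c z F.minus_eq)
  then show ?case by (simp add: bar_chains_def)
next
  case (Suc q)
  then obtain m \<alpha> c' where c: "c = (m, \<alpha>) # c'" and \<alpha>: "\<alpha> \<in> dS_hom n m" and c': "c' \<in> bar_chains (Suc q) m"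
    by (cases c) (auto simp: bar_chains_def)
  interpret G: module R "free_module R (bar_chains (Suc q) n)" by simp
  have 1: "precomp n \<alpha> c' \<in> bar_chains (Suc q) n"
    using c' \<alpha> precomp_chain by (auto simp: bar_chains_def)
  have "fr_map R (Cons (m, \<alpha>)) \<in> module_hom R (free_module R (bar_chains q m)) (free_module R (bar_chains (Suc q) n))"
    by (rule fr_map_restrict) (use \<alpha> in \<open>auto simp: bar_chains_def\<close>)
  then have 2: "fr_map R (Cons (m, \<alpha>)) (bar_boundary R c' m) \<in> carrier (free_module R (bar_chains (Suc q) n))"
    using Suc.IH[OF c'] by (rule module_homD(1))
  have "bar_boundary R c n = basis_elt R (precomp n \<alpha> c') \<ominus>\<^bsub>free_module R (bar_chains (Suc q) n)\<^esub> fr_map R (Cons (m, \<alpha>)) (bar_boundary R c' m)"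
    by (simp add: c free_minus[where X=UNIV] free_minus[OF basis_in[OF 1] 2])
  then show ?case using 1 2 by simp
qed

lemma bar_d_restrict:
  "bar_d R n \<in> module_hom R (free_module R (bar_chains (Suc q) n)) (free_module R (bar_chains q n))"
  by (rule module_hom_restrict) (auto simp: bd_restrict)

lemma module_hom_minus:
  assumes "f \<in> module_hom R (fr R) (fr R :: ('k, 'y \<Rightarrow> 'k) module)"
    "a \<in> carrier (fr R)" "b \<in> carrier (fr R)"
  shows "f (a \<ominus>\<^bsub>fr R\<^esub> b) = f a \<ominus>\<^bsub>fr R\<^esub> f b"
proof -
  note h = module_homD[OF assms(1)]
  have m: "\<ominus>\<^bsub>fr R\<^esub> b = (\<ominus>\<^bsub>R\<^esub> \<one>\<^bsub>R\<^esub>) \<odot>\<^bsub>fr R\<^esub> b" "\<ominus>\<^bsub>fr R\<^esub> f b = (\<ominus>\<^bsub>R\<^esub> \<one>\<^bsub>R\<^esub>) \<odot>\<^bsub>fr R\<^esub> f b"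
    using assms(2,3) h(1) by (simp_all add: module.smult_l_minus[OF free_is_module] module.smult_one[OF free_is_module])
  show ?thesis
    unfolding a_minus_def m using assms(2,3) h(1)
    by (simp add: h(2,3) module.smult_closed[OF free_is_module])
qed

lemma fr_map_fr_map:
  "z \<in> carrier (fr R) \<Longrightarrow> fr_map R g (fr_map R h z) = fr_map R (\<lambda>x. g (h x)) z"
  by (rule free_module_hom_eq[OF cr free_is_module module_hom_comp[OF fr_map_hom fr_map_hom] fr_map_hom]) auto

lemma bd_natural:
  assumes "\<alpha> \<in> dS_hom n l" "is_chain l c"
  shows "bar_boundary R (precomp n \<alpha> c) n = fr_map R (precomp n \<alpha>) (bar_boundary R c l)"
proof (cases c)
  case Nil
  then show ?thesis by simp
next
  case (Cons x c')
  obtain m \<beta> where x: "x = (m, \<beta>)" by (cases x)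
  have "\<beta> \<in> dS_hom l m" "is_chain m c'" using assms(2) by (auto simp: Cons x)
  then show ?thesis using assms(1)
    by (simp add: Cons x precomp_comp module_hom_minus[OF fr_map_hom] fr_map_fr_map)
qed

lemma bar_d_natural:
  assumes "\<alpha> \<in> dS_hom n l" "z \<in> carrier (free_module R {c. is_chain l c})"
  shows "bar_d R n (fr_map R (precomp n \<alpha>) z) = fr_map R (precomp n \<alpha>) (bar_d R l z)"
  by (rule free_module_hom_eq[OF cr free_is_module
        module_hom_sub[OF module_hom_comp[OF fr_map_hom bar_d_hom]]
        module_hom_sub[OF module_hom_comp[OF bar_d_hom fr_map_hom]] _ assms(2)])
    (use assms(1) in \<open>simp add: bd_natural\<close>)

lemma bar_d_closed [simp]: "z \<in> carrier (fr R) \<Longrightarrow> bar_d R n z \<in> carrier (fr R)"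
  by (rule module_homD(1)[OF bar_d_hom])

lemma fr_minus_self: "c \<in> carrier (fr R) \<Longrightarrow> c \<ominus>\<^bsub>fr R\<^esub> c = \<zero>\<^bsub>fr R\<^esub>"
proof -
  interpret F: module R "fr R :: ('k, 'a \<Rightarrow> 'k) module" by simp
  show "c \<in> carrier (fr R) \<Longrightarrow> c \<ominus>\<^bsub>fr R\<^esub> c = \<zero>\<^bsub>fr R\<^esub>" by (simp add: F.minus_eq F.r_neg)
qed

lemma fr_minus_zero: "c \<in> carrier (fr R) \<Longrightarrow> c \<ominus>\<^bsub>fr R\<^esub> \<zero>\<^bsub>fr R\<^esub> = c"
  by (simp add: free_minus) (simp add: free_module_sel(2) free_module_coeff R.minus_eq)

lemma module_hom_diff:
  assumes "f \<in> module_hom R (free_module R X) (fr R)" "g \<in> module_hom R (free_module R X) (fr R)"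
  shows "(\<lambda>z. f z \<ominus>\<^bsub>fr R\<^esub> g z) \<in> module_hom R (free_module R X) (fr R)"
proof -
  note f = module_homD[OF assms(1)] and g = module_homD[OF assms(2)]
  have c: "f z x \<in> carrier R" "g z x \<in> carrier R" if "z \<in> carrier (free_module R X)" for z x
    using free_module_coeff[OF f(1)[OF that]] free_module_coeff[OF g(1)[OF that]] by auto
  have sub: "f z \<ominus>\<^bsub>fr R\<^esub> g z = (\<lambda>x. f z x \<ominus>\<^bsub>R\<^esub> g z x)" if "z \<in> carrier (free_module R X)" for z
    using f(1)[OF that] g(1)[OF that] by (rule free_minus)
  interpret X: module R "free_module R X" by (rule free_is_module)
  show ?thesis unfolding module_hom_def
  proof (intro CollectI conjI ballI funcsetI)
    fix z assume z: "z \<in> carrier (free_module R X)"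
    show "f z \<ominus>\<^bsub>fr R\<^esub> g z \<in> carrier (fr R)"
      using abelian_group.minus_closed[OF module.axioms(2)[OF free_is_module] f(1)[OF z] g(1)[OF z]] .
  next
    fix z y assume zy: "z \<in> carrier (free_module R X)" "y \<in> carrier (free_module R X)"
    show "f (z \<oplus>\<^bsub>free_module R X\<^esub> y) \<ominus>\<^bsub>fr R\<^esub> g (z \<oplus>\<^bsub>free_module R X\<^esub> y)
      = (f z \<ominus>\<^bsub>fr R\<^esub> g z) \<oplus>\<^bsub>fr R\<^esub> (f y \<ominus>\<^bsub>fr R\<^esub> g y)"
      (is "?L = ?M")
    proof (rule ext)
      fix x
      have "?L x = f (z \<oplus>\<^bsub>free_module R X\<^esub> y) x \<ominus>\<^bsub>R\<^esub> g (z \<oplus>\<^bsub>free_module R X\<^esub> y) x"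
        by (simp only: sub[OF X.a_closed[OF zy]])
      also have "\<dots> = (f z x \<oplus>\<^bsub>R\<^esub> f y x) \<ominus>\<^bsub>R\<^esub> (g z x \<oplus>\<^bsub>R\<^esub> g y x)"
        by (simp only: f(2)[OF zy] g(2)[OF zy]) (simp only: free_module_sel(3))
      also have "\<dots> = ?M x"
        using c[OF zy(1), of x] c[OF zy(2), of x]
        by (simp add: sub zy free_module_sel(3) R.minus_eq R.minus_add R.a_ac)
      finally show "?L x = ?M x" .
    qed
  next
    fix r z assume rz: "r \<in> carrier R" "z \<in> carrier (free_module R X)"
    show "f (r \<odot>\<^bsub>free_module R X\<^esub> z) \<ominus>\<^bsub>fr R\<^esub> g (r \<odot>\<^bsub>free_module R X\<^esub> z) = r \<odot>\<^bsub>fr R\<^esub> (f z \<ominus>\<^bsub>fr R\<^esub> g z)"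
      (is "?L = ?M")
    proof (rule ext)
      fix x
      have "?L x = f (r \<odot>\<^bsub>free_module R X\<^esub> z) x \<ominus>\<^bsub>R\<^esub> g (r \<odot>\<^bsub>free_module R X\<^esub> z) x"
        by (simp only: sub[OF X.smult_closed[OF rz]])
      also have "\<dots> = r \<otimes>\<^bsub>R\<^esub> f z x \<ominus>\<^bsub>R\<^esub> r \<otimes>\<^bsub>R\<^esub> g z x"
        by (simp only: f(3)[OF rz] g(3)[OF rz]) (simp only: free_module_sel(4))
      also have "\<dots> = ?M x"
        using c[OF rz(2), of x] rz(1)
        by (simp add: sub rz(2) free_module_sel(4) R.minus_eq R.r_distr R.r_minus)
      finally show "?L x = ?M x" .
    qed
  qed
qed

lemma bar_d_cons:
  assumes "\<alpha> \<in> dS_hom n m" "z \<in> carrier (fr R)"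
  shows "bar_d R n (fr_map R (Cons (m, \<alpha>)) z)
    = fr_map R (precomp n \<alpha>) z \<ominus>\<^bsub>fr R\<^esub> fr_map R (Cons (m, \<alpha>)) (bar_d R m z)"
  by (rule free_module_hom_eq[OF cr free_is_module module_hom_comp[OF fr_map_hom bar_d_hom]
        module_hom_diff[OF fr_map_hom module_hom_comp[OF bar_d_hom fr_map_hom]] _ assms(2)]) simp

lemma bd_bd: "is_chain n c \<Longrightarrow> bar_d R n (bar_boundary R c n) = \<zero>\<^bsub>fr R\<^esub>"
proof (induction c arbitrary: n)
  case Nil
  show ?case using module_hom_zero[OF free_is_module free_is_module bar_d_hom] by simp
next
  case (Cons x c)
  obtain m \<alpha> where x: "x = (m, \<alpha>)" by (cases x)
  have \<alpha>: "\<alpha> \<in> dS_hom n m" and c: "is_chain m c" using Cons.prems by (auto simp: x)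
  interpret F: module R "fr R :: ('k, (nat \<times> dS_mor) list \<Rightarrow> 'k) module" by simp
  have z: "fr_map R h \<zero>\<^bsub>fr R\<^esub> = \<zero>\<^bsub>fr R\<^esub>"
    for h :: "(nat \<times> dS_mor) list \<Rightarrow> (nat \<times> dS_mor) list"
    by (rule module_hom_zero[OF free_is_module free_is_module fr_map_hom])
  show ?case
    by (simp add: x module_hom_minus[OF bar_d_hom] bar_d_cons[OF \<alpha>] bd_natural[OF \<alpha> c] Cons.IH[OF c] z
        fr_minus_self fr_minus_zero)
qed

lemma bar_d_bar_d:
  assumes "z \<in> carrier (free_module R {c. is_chain n c})"
  shows "bar_d R n (bar_d R n z) = \<zero>\<^bsub>fr R\<^esub>"
proof -
  interpret F: module R "fr R :: ('k, (nat \<times> dS_mor) list \<Rightarrow> 'k) module" by simp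
  have "(\<lambda>z. \<zero>\<^bsub>fr R\<^esub>) \<in> module_hom R (free_module R {c. is_chain n c}) (fr R :: ('k, (nat \<times> dS_mor) list \<Rightarrow> 'k) module)"
    by (simp add: module_hom_def)
  from free_module_hom_eq[OF cr free_is_module module_hom_sub[OF module_hom_comp[OF bar_d_hom bar_d_hom]] this _ assms]
  show ?thesis by (simp add: bd_bd)
qed

lemma fr_map_precomp_id:
  assumes "z \<in> carrier (free_module R {c. is_chain n c})"
  shows "fr_map R (precomp n (dS_id n)) z = z"
proof -
  have "(\<lambda>z. z) \<in> module_hom R (free_module R {c. is_chain n c}) (fr R)"
    by (rule module_hom_sub) (simp add: module_hom_def)
  from free_module_hom_eq[OF cr free_is_module module_hom_sub[OF fr_map_hom] this _ assms]
  show ?thesis by (simp add: precomp_id)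
qed

lemma bar_chains_sub: "z \<in> carrier (free_module R (bar_chains q n)) \<Longrightarrow> z \<in> carrier (free_module R {c. is_chain n c})"
  by (rule free_module_mono) (auto simp: bar_chains_def)

lemma bar_exact:
  "bar_d R n ` carrier (free_module R (bar_chains (Suc (Suc q)) n)) =
   {z \<in> carrier (free_module R (bar_chains (Suc q) n)). bar_d R n z = \<zero>\<^bsub>fr R\<^esub>}"
proof (intro equalityI subsetI)
  fix z assume "z \<in> bar_d R n ` carrier (free_module R (bar_chains (Suc (Suc q)) n))"
  then show "z \<in> {z \<in> carrier (free_module R (bar_chains (Suc q) n)). bar_d R n z = \<zero>\<^bsub>fr R\<^esub>}"
    using module_homD(1)[OF bar_d_restrict] bar_d_bar_d[OF bar_chains_sub] by auto
next
  fix z assume z: "z \<in> {z \<in> carrier (free_module R (bar_chains (Suc q) n)). bar_d R n z = \<zero>\<^bsub>fr R\<^esub>}"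
  let ?h = "fr_map R (Cons (n, dS_id n))"
  interpret F: module R "fr R :: ('k, (nat \<times> dS_mor) list \<Rightarrow> 'k) module" by simp
  have zU: "z \<in> carrier (fr R)" using z by (auto intro: free_module_mono[OF subset_UNIV])
  have "?h \<in> module_hom R (free_module R (bar_chains (Suc q) n)) (free_module R (bar_chains (Suc (Suc q)) n))"
    by (rule fr_map_restrict) (auto simp: bar_chains_def dS_id_hom)
  then have hz: "?h z \<in> carrier (free_module R (bar_chains (Suc (Suc q)) n))"
    using z by (auto dest: module_homD(1))
  have "bar_d R n (?h z) = z"
    using z zU fr_map_precomp_id[OF bar_chains_sub, of z "Suc q" n]
    by (simp add: bar_d_cons[OF dS_id_hom] fr_minus_zero)
  then show "z \<in> bar_d R n ` carrier (free_module R (bar_chains (Suc (Suc q)) n))"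
    using hz by (metis imageI)
qed

lemma precomp_in_chains: "\<alpha> \<in> dS_hom n m \<Longrightarrow> precomp n \<alpha> \<in> bar_chains q m \<rightarrow> bar_chains q n"
  by (auto simp: bar_chains_def precomp_chain)

lemma bar_contravariant: "contravariant_functor R (bar_functor R q)"
proof -
  have "fr_map R (precomp n (dS_comp n l \<beta> \<alpha>)) z = fr_map R (precomp n \<alpha>) (fr_map R (precomp m \<beta>) z)"
    if "\<alpha> \<in> dS_hom n m" "\<beta> \<in> dS_hom m l" "z \<in> carrier (free_module R (bar_chains (Suc q) l))" for n m l \<alpha> \<beta> z
    by (rule free_module_hom_eq[OF cr free_is_module module_hom_sub[OF fr_map_hom]
          module_hom_sub[OF module_hom_comp[OF fr_map_hom fr_map_hom]] _ that(3)])
      (use that in \<open>auto simp: precomp_comp bar_chains_def\<close>)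
  then show ?thesis
    unfolding contravariant_functor_def
    by (auto simp: bar_functor_def fr_map_restrict precomp_in_chains fr_map_precomp_id[OF bar_chains_sub])
qed

lemma bar_projective: "projective_functor R (bar_functor R q)"
  unfolding projective_functor_def
proof (intro conjI allI impI bar_contravariant)
  fix M :: "('k, nat \<times> dS_mor \<times> ((nat \<times> dS_mor) list \<Rightarrow> 'k) \<Rightarrow> 'k) dS_functor"
    and N :: "('k, (nat \<times> dS_mor) list \<Rightarrow> 'k) dS_functor" and \<epsilon> \<eta>
  assume M: "contravariant_functor R M" and N: "contravariant_functor R N"
    and \<epsilon>: "contra_nat_trans R M N \<epsilon>" and sur: "\<forall>n. \<epsilon> n ` carrier (fobj M n) = carrier (fobj N n)"
    and \<eta>: "contra_nat_trans R (bar_functor R q) N \<eta>"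
  let ?L = "\<lambda>n. free_module R (bar_chains (Suc q) n)"
  let ?e = "\<lambda>m c. basis_elt R ((m, dS_id m) # c)"
  define u where "u m c = (SOME u. u \<in> carrier (fobj M m) \<and> \<epsilon> m u = \<eta> m (?e m c))" for m c
  have Mm: "module R (fobj M n)" and Nm: "module R (fobj N n)" for n
    using M N by (auto simp: contravariant_functor_def)
  have Mf: "fmap M n m \<alpha> \<in> module_hom R (fobj M m) (fobj M n)" 
    and Nf: "fmap N n m \<alpha> \<in> module_hom R (fobj N m) (fobj N n)" if "\<alpha> \<in> dS_hom n m" for n m \<alpha>
    using M N that by (auto simp: contravariant_functor_def)
  have \<eta>h: "\<eta> n \<in> module_hom R (?L n) (fobj N n)" for n
    using \<eta> by (auto simp: contra_nat_trans_def bar_functor_def)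
  have \<epsilon>h: "\<epsilon> n \<in> module_hom R (fobj M n) (fobj N n)" for n
    using \<epsilon> by (auto simp: contra_nat_trans_def)
  have u: "u m c \<in> carrier (fobj M m)" "\<epsilon> m (u m c) = \<eta> m (?e m c)" if "c \<in> bar_chains q m" for m c
  proof -
    have "?e m c \<in> carrier (?L m)" using that by (auto simp: bar_chains_def dS_id_hom)
    then have "\<eta> m (?e m c) \<in> \<epsilon> m ` carrier (fobj M m)"
      using module_homD(1)[OF \<eta>h] sur by auto
    then have "\<exists>u. u \<in> carrier (fobj M m) \<and> \<epsilon> m u = \<eta> m (?e m c)" by force
    from someI_ex[OF this] show "u m c \<in> carrier (fobj M m)" "\<epsilon> m (u m c) = \<eta> m (?e m c)"
      by (auto simp: u_def)
  qed
  define t where "t n x = (case x of [] \<Rightarrow> \<zero>\<^bsub>fobj M n\<^esub> | a # c \<Rightarrow> fmap M n (fst a) (snd a) (u (fst a) c))"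
    for n and x :: "(nat \<times> dS_mor) list"
  define \<theta> where "\<theta> n = lin_ext R (fobj M n) (t n)" for n
  have chE: thesis if "x \<in> bar_chains (Suc q) n"
    "\<And>m \<beta> c. x = (m, \<beta>) # c \<Longrightarrow> \<beta> \<in> dS_hom n m \<Longrightarrow> c \<in> bar_chains q m \<Longrightarrow> thesis" for x n thesis
    using that by (cases x) (auto simp: bar_chains_def)
  have tc: "t n \<in> bar_chains (Suc q) n \<rightarrow> carrier (fobj M n)" for n
  proof
    fix x assume "x \<in> bar_chains (Suc q) n"
    then show "t n x \<in> carrier (fobj M n)"
      by (rule chE) (auto simp: t_def intro: module_homD(1)[OF Mf] u)
  qed
  have \<theta>h: "\<theta> n \<in> module_hom R (?L n) (fobj M n)" for n
    unfolding \<theta>_def by (rule lin_ext_hom[OF Mm tc])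
  have \<theta>b: "\<theta> n (basis_elt R x) = t n x" if "x \<in> bar_chains (Suc q) n" for n x
    unfolding \<theta>_def by (rule lin_ext_basis[OF Mm]) (use tc that in auto)
  have nat: "\<theta> n (fr_map R (precomp n \<alpha>) z) = fmap M n l \<alpha> (\<theta> l z)"
    if \<alpha>: "\<alpha> \<in> dS_hom n l" and z: "z \<in> carrier (?L l)" for n l \<alpha> z
  proof (rule free_module_hom_eq[OF cr Mm module_hom_comp[OF fr_map_restrict[OF precomp_in_chains[OF \<alpha>]] \<theta>h]
        module_hom_comp[OF \<theta>h Mf[OF \<alpha>]] _ z])
    fix x assume x: "x \<in> bar_chains (Suc q) l"
    then have px: "precomp n \<alpha> x \<in> bar_chains (Suc q) n" using precomp_in_chains[OF \<alpha>] by auto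
    from x show "\<theta> n (fr_map R (precomp n \<alpha>) (basis_elt R x)) = fmap M n l \<alpha> (\<theta> l (basis_elt R x))"
    proof (rule chE)
      fix m \<beta> c assume c: "x = (m, \<beta>) # c" "\<beta> \<in> dS_hom l m" "c \<in> bar_chains q m"
      have "fmap M n m (dS_comp n m \<beta> \<alpha>) (u m c) = fmap M n l \<alpha> (fmap M l m \<beta> (u m c))"
        using M \<alpha> c(2) u(1)[OF c(3)] unfolding contravariant_functor_def by blast
      then show ?thesis using \<theta>b[OF px] \<theta>b[OF x] by (simp add: c(1) t_def)
    qed
  qed
  have lift: "\<epsilon> n (\<theta> n z) = \<eta> n z" if z: "z \<in> carrier (?L n)" for n z
  proof (rule free_module_hom_eq[OF cr Nm module_hom_comp[OF \<theta>h \<epsilon>h] \<eta>h _ z])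
    fix x assume x: "x \<in> bar_chains (Suc q) n"
    then show "\<epsilon> n (\<theta> n (basis_elt R x)) = \<eta> n (basis_elt R x)"
    proof (rule chE)
      fix m \<beta> c assume c: "x = (m, \<beta>) # c" "\<beta> \<in> dS_hom n m" "c \<in> bar_chains q m"
      have e: "?e m c \<in> carrier (?L m)" using c(3) by (auto simp: bar_chains_def dS_id_hom)
      then have e': "?e m c \<in> carrier (fobj (bar_functor R q) m)" by (simp add: bar_functor_def)
      have "\<epsilon> n (\<theta> n (basis_elt R x)) = \<epsilon> n (fmap M n m \<beta> (u m c))"
        using \<theta>b[OF x] by (simp add: c(1) t_def)
      also have "\<dots> = fmap N n m \<beta> (\<epsilon> m (u m c))"
        using \<epsilon> c(2) u(1)[OF c(3)] unfolding contra_nat_trans_def by blast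
      also have "\<dots> = fmap N n m \<beta> (\<eta> m (?e m c))" using u(2)[OF c(3)] by simp
      also have "\<dots> = \<eta> n (fmap (bar_functor R q) n m \<beta> (?e m c))"
        using \<eta> c(2) e' unfolding contra_nat_trans_def by metis
      also have "\<dots> = \<eta> n (basis_elt R x)"
        by (simp add: bar_functor_def c(1) dS_comp_id_left[OF c(2)])
      finally show ?thesis .
    qed
  qed
  show "\<exists>\<theta>. contra_nat_trans R (bar_functor R q) M \<theta> \<and>
      (\<forall>n. \<forall>x\<in>carrier (fobj (bar_functor R q) n). \<epsilon> n (\<theta> n x) = \<eta> n x)"
    by (rule exI[where x = \<theta>])
      (auto simp: contra_nat_trans_def bar_functor_def \<theta>h nat lift)
qed

theorem bar_resolution:
  "projective_resolution R (const_functor R) (bar_functor R) (\<lambda>q. bar_d R) (\<lambda>n z. bar_d R n z [])"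
proof -
  have ev: "(\<lambda>z. z []) \<in> module_hom R (free_module R (bar_chains 0 n)) (regular_module R)" for n
    by (auto simp: module_hom_def regular_module_def free_module_sel(3,4) free_module_coeff)
  have aug: "(\<lambda>z. bar_d R n z []) \<in> module_hom R (free_module R (bar_chains (Suc 0) n)) (regular_module R)" for n
    by (rule module_hom_comp[OF bar_d_restrict ev])
  have regm: "module R (regular_module R)"
  proof (rule moduleI[OF cr])
    show "abelian_group (regular_module R)"
      by (rule abelian_groupI) (auto simp: regular_module_def R.a_ac intro: R.l_neg R.a_inv_closed)
  qed (auto simp: regular_module_def R.l_distr R.r_distr R.m_assoc)
  have inv: "z' [] = z []" if "z \<in> carrier (free_module R (bar_chains 0 m))" "z' = fr_map R (precomp n \<alpha>) z" for n m \<alpha> z z'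
  proof -
    have h: "fr_map R (precomp n \<alpha>) \<in> module_hom R (free_module R (bar_chains 0 m)) (free_module R (bar_chains 0 n))"
      by (rule fr_map_restrict) (auto simp: bar_chains_def)
    have "fr_map R (precomp n \<alpha>) z [] = z []"
      by (rule free_module_hom_eq[OF cr regm module_hom_comp[OF h ev] ev _ that(1)])
        (auto simp: bar_chains_def)
    then show ?thesis using that(2) by simp
  qed
  have nat0: "bar_d R n (fr_map R (precomp n \<alpha>) z) [] = bar_d R m z []"
    if "\<alpha> \<in> dS_hom n m" "z \<in> carrier (free_module R (bar_chains (Suc 0) m))" for n m \<alpha> z
    using inv[OF module_homD(1)[OF bar_d_restrict that(2)]] bar_d_natural[OF that(1) bar_chains_sub[OF that(2)]]
    by blast
  have ker0: "bar_d R n z [] = \<zero>\<^bsub>R\<^esub> \<longleftrightarrow> bar_d R n z = \<zero>\<^bsub>fr R\<^esub>"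
    if "z \<in> carrier (free_module R (bar_chains (Suc 0) n))" for n z
    using module_homD(1)[OF bar_d_restrict that] by (auto simp: free_module_sel bar_chains_def fun_eq_iff)
  have sur: "(\<lambda>z. bar_d R n z []) ` carrier (free_module R (bar_chains (Suc 0) n)) = carrier R" for n
  proof (intro equalityI subsetI)
    fix r assume "r \<in> (\<lambda>z. bar_d R n z []) ` carrier (free_module R (bar_chains (Suc 0) n))"
    then show "r \<in> carrier R" using module_homD(1)[OF aug] by (auto simp: regular_module_def)
  next
    fix r assume r: "r \<in> carrier R"
    let ?c = "[(n, dS_id n)]"
    interpret L: module R "free_module R (bar_chains (Suc 0) n)" by simp
    interpret F: module R "fr R :: ('k, (nat \<times> dS_mor) list \<Rightarrow> 'k) module" by simp
    have c: "?c \<in> bar_chains (Suc 0) n" by (auto simp: bar_chains_def dS_id_hom)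
    have b: "bar_boundary R ?c n [] = \<one>\<^bsub>R\<^esub>"
      by (simp add: fr_minus_zero) (simp add: basis_elt_def)
    have "bar_d R n (r \<odot>\<^bsub>free_module R (bar_chains (Suc 0) n)\<^esub> basis_elt R ?c) [] = r"
      using module_homD(3)[OF aug r basis_in[OF c]] r b by (simp add: regular_module_def)
    then show "r \<in> (\<lambda>z. bar_d R n z []) ` carrier (free_module R (bar_chains (Suc 0) n))"
      using L.smult_closed[OF r basis_in[OF c]] by (metis (no_types, lifting) imageI)
  qed
  show ?thesis
    unfolding projective_resolution_def
  proof (intro conjI allI bar_projective)
    fix q
    show "contra_nat_trans R (bar_functor R (Suc q)) (bar_functor R q) (bar_d R)"
      by (auto simp: contra_nat_trans_def bar_functor_def bar_d_restrict bar_d_natural bar_chains_sub)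
  next
    show "contra_nat_trans R (bar_functor R 0) (const_functor R) (\<lambda>n z. bar_d R n z [])"
      using aug nat0 by (auto simp: contra_nat_trans_def bar_functor_def const_functor_def)
  next
    fix n
    show "(\<lambda>z. bar_d R n z []) ` carrier (fobj (bar_functor R 0) n) = carrier (fobj (const_functor R) n)"
      using sur by (simp add: bar_functor_def const_functor_def regular_module_def)
  next
    fix n
    show "bar_d R n ` carrier (fobj (bar_functor R 1) n) =
      {x \<in> carrier (fobj (bar_functor R 0) n). bar_d R n x [] = \<zero>\<^bsub>fobj (const_functor R) n\<^esub>}"
      using bar_exact[of n 0] ker0 by (auto simp: bar_functor_def const_functor_def regular_module_def)
  next
    fix q n
    show "bar_d R n ` carrier (fobj (bar_functor R (Suc (Suc q))) n) =
      {x \<in> carrier (fobj (bar_functor R (Suc q)) n). bar_d R n x = \<zero>\<^bsub>fobj (bar_functor R q) n\<^esub>}"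
      using bar_exact[of n "Suc q"] by (simp add: bar_functor_def free_module_sel(2))
  qed
qed

end

end

theory Submission
  imports Defs
begin

text \<open>
  In degree zero, Tor is a tensor product: if \<open>P\<close> resolves the contravariant functor \<open>G\<close>, then right
  exactness gives \<open>Tor\<^sub>0(G, F) \<cong> G \<otimes>\<^bsub>\<Delta>S\<^esub> F\<close> (\<open>Tor_dS_0\<close>).  So \<open>HS\<^sub>0(A)\<close> is the tensor product of the
  constant functor with the symmetric bar construction, that is, the colimit of the modules
  \<open>A\<^bsup>\<otimes>(n+1)\<^esup>\<close> over \<open>\<Delta>S\<close>, whatever the resolution.

  Every object of \<open>\<Delta>S\<close> maps to \<open>[0]\<close>, so in the colimit a tensor \<open>a\<^sub>0 \<otimes> \<dots> \<otimes> a\<^sub>n\<close> is identified with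
  the product of its factors in \<open>A\<close>, and the colimit is a quotient of \<open>A\<close>.  A morphism \<open>[n] \<rightarrow> [0]\<close> is
  an order of the factors, and all orders are available; hence all reorderings of a product are
  identified.  Comparing the orders \<open>u, a, b, v\<close> and \<open>u, b, a, v\<close> of four factors gives
  \<open>u (a b - b a) v = 0\<close>, so the whole two-sided ideal generated by the commutators dies
  (\<open>vanishes_on_commutator_ideal\<close>), and not just the submodule that they span.  Conversely, modulo
  that ideal a product does not depend on the order of its factors (\<open>list_prod_reorder\<close>), so
  multiplying all factors is compatible with every morphism of \<open>\<Delta>S\<close> and defines a map from the
  colimit to the quotient algebra.  The two maps are mutually inverse (\<open>const_tensor_Bsym\<close>).

  All modules are given by generators and relators.  The formal work is to describe which maps on
  generators respect the relators: the multilinear ones for a tensor power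
  (\<open>multilinear_iff_tensor_power_rels\<close>), the balanced ones for a tensor product of functors
  (\<open>dS_balanced_iff_tensor_rels\<close>).
\<close>

section \<open>Quotients of modules\<close>

lemma module_homI:
  assumes "\<And>x. x \<in> carrier M \<Longrightarrow> f x \<in> carrier N"
    and "\<And>x y. x \<in> carrier M \<Longrightarrow> y \<in> carrier M \<Longrightarrow> f (x \<oplus>\<^bsub>M\<^esub> y) = f x \<oplus>\<^bsub>N\<^esub> f y"
    and "\<And>r x. r \<in> carrier R \<Longrightarrow> x \<in> carrier M \<Longrightarrow> f (r \<odot>\<^bsub>M\<^esub> x) = r \<odot>\<^bsub>N\<^esub> f x"
  shows "f \<in> module_hom R M N"
  using assms by (auto simp: module_hom_def)

lemma module_hom_cong:
  assumes "f \<in> module_hom R M N" "module R M" "\<And>x. x \<in> carrier M \<Longrightarrow> g x = f x"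
  shows "g \<in> module_hom R M N"
proof -
  interpret M: module R M by fact
  show ?thesis by (rule module_homI) (auto simp: assms(3) module_homD[OF assms(1)])
qed

lemma module_hom_uminus:
  assumes "module R M" "module R N" "f \<in> module_hom R M N" "x \<in> carrier M"
  shows "f (\<ominus>\<^bsub>M\<^esub> x) = \<ominus>\<^bsub>N\<^esub> f x"
proof -
  interpret M: module R M by fact
  interpret N: module R N by fact
  have "f (\<ominus>\<^bsub>M\<^esub> x) \<oplus>\<^bsub>N\<^esub> f x = \<zero>\<^bsub>N\<^esub>"
    using module_homD(2)[OF assms(3), of "\<ominus>\<^bsub>M\<^esub> x" x] assms(4) module_hom_zero[OF assms(1-3)]
    by (simp add: M.l_neg)
  then show ?thesis
    using module_homD(1)[OF assms(3)] assms(4) by (intro N.minus_equality[symmetric]) auto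
qed

lemma module_hom_diff_eq:
  assumes "module R M" "module R N" "f \<in> module_hom R M N" "x \<in> carrier M" "y \<in> carrier M"
  shows "f (x \<ominus>\<^bsub>M\<^esub> y) = f x \<ominus>\<^bsub>N\<^esub> f y"
proof -
  interpret M: module R M by fact
  interpret N: module R N by fact
  show ?thesis
    using assms by (simp add: a_minus_def module_homD(2)[OF assms(3)] module_hom_uminus[OF assms(1-3)])
qed

text \<open>
  Relators are differences, so this turns "a hom kills the relator" into the equation that the relator
  was written down to enforce.
\<close>

lemma module_hom_diff_zero_iff:
  assumes "module R M" "module R N" "f \<in> module_hom R M N" "x \<in> carrier M" "y \<in> carrier M"
  shows "f (x \<ominus>\<^bsub>M\<^esub> y) = \<zero>\<^bsub>N\<^esub> \<longleftrightarrow> f x = f y"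
proof -
  interpret M: module R M by fact
  interpret N: module R N by fact
  have c: "f x \<in> carrier N" "f y \<in> carrier N" using assms module_homD(1) by metis+
  show ?thesis
    unfolding module_hom_diff_eq[OF assms]
    using c N.add.inv_solve_right[of "\<zero>\<^bsub>N\<^esub>" "f x" "f y"] by (auto simp: a_minus_def N.r_neg)
qed

lemma smult_hom:
  assumes "module R M" "r \<in> carrier R"
  shows "(\<lambda>x. r \<odot>\<^bsub>M\<^esub> x) \<in> module_hom R M M"
proof -
  interpret M: module R M by fact
  show ?thesis
    using assms(2) by (intro module_homI) (auto simp: M.smult_r_distr M.smult_assoc1[symmetric] M.R.m_comm)
qed

lemma submodule_preimage:
  assumes M: "module R M" and M': "module R M'" and f: "f \<in> module_hom R M M'" and N': "submodule N' R M'"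
  shows "submodule {x \<in> carrier M. f x \<in> N'} R M"
proof -
  interpret M: module R M by fact
  interpret M': module R M' by fact
  note N = M'.submoduleE[OF N']
  have z: "\<zero>\<^bsub>M'\<^esub> \<in> N'" using subgroup.one_closed[OF submodule.axioms(1)[OF N']] by simp
  show ?thesis
    by (rule M.submoduleI)
      (auto simp: module_hom_zero[OF M M' f] module_hom_uminus[OF M M' f] module_homD[OF f] z N(3-5))
qed

lemma submodule_image:
  assumes M: "module R M" and M': "module R M'" and f: "f \<in> module_hom R M M'"
  shows "submodule (f ` carrier M) R M'"
proof -
  interpret M: module R M by fact
  interpret M': module R M' by fact
  show ?thesis
  proof (rule M'.submoduleI)
    show "\<zero>\<^bsub>M'\<^esub> \<in> f ` carrier M"
      using module_hom_zero[OF M M' f] by (metis M.zero_closed imageI)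
  qed (auto simp: module_hom_uminus[OF M M' f, symmetric] module_homD(1)[OF f] 
      module_homD(2,3)[OF f, symmetric] intro!: imageI)
qed

lemma module_span_submodule:
  assumes "module R M" "S \<subseteq> carrier M"
  shows "submodule (module_span R M S) R M"
proof -
  interpret M: module R M by fact
  have c: "module_span R M S \<subseteq> carrier M"
    using M.carrier_is_submodule assms(2) by (auto simp: module_span_def)
  show ?thesis
  proof (rule M.submoduleI[OF c])
    show "\<zero>\<^bsub>M\<^esub> \<in> module_span R M S"
      using subgroup.one_closed[OF submodule.axioms(1)] by (fastforce simp: module_span_def)
  qed (auto simp: module_span_def M.submoduleE(3-5))
qed

lemma module_span_superset: "S \<subseteq> module_span R M S"
  by (auto simp: module_span_def)

lemma module_span_minimal: "submodule N R M \<Longrightarrow> S \<subseteq> N \<Longrightarrow> module_span R M S \<subseteq> N"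
  by (auto simp: module_span_def)

lemma hom_maps_module_span:
  assumes M: "module R M" and M': "module R M'" and f: "f \<in> module_hom R M M'"
    and N': "submodule N' R M'" and S: "S \<subseteq> carrier M" "f ` S \<subseteq> N'"
  shows "f ` module_span R M S \<subseteq> N'"
proof -
  have "module_span R M S \<subseteq> {x \<in> carrier M. f x \<in> N'}"
    by (rule module_span_minimal[OF submodule_preimage[OF M M' f N']]) (use S in auto)
  then show ?thesis by auto
qed

lemma quot_module_sel:
  "carrier (quot_module M N) = a_rcosets\<^bsub>M\<^esub> N"
  "\<zero>\<^bsub>quot_module M N\<^esub> = N"
  "C \<oplus>\<^bsub>quot_module M N\<^esub> D = C <+>\<^bsub>M\<^esub> D"
  "r \<odot>\<^bsub>quot_module M N\<^esub> C = quot_map M N (\<lambda>x. r \<odot>\<^bsub>M\<^esub> x) C"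
  by (simp_all add: quot_module_def quot_map_def)

context
  fixes R :: "('k, 'r) ring_scheme" and M :: "('k, 'm, 's) module_scheme" and N :: "'m set"
  assumes M: "module R M" and N: "submodule N R M"
begin

interpretation M: module R M by (rule M)

lemma submodule_abelian_subgroup: "abelian_subgroup N M"
  by (rule abelian_subgroupI3)
    (use N M in \<open>auto simp: additive_subgroup_def submodule_def module_def\<close>)

interpretation N: abelian_subgroup N M by (rule submodule_abelian_subgroup)

lemma coset_eq_iff:
  assumes "x \<in> carrier M" "y \<in> carrier M"
  shows "N +>\<^bsub>M\<^esub> x = N +>\<^bsub>M\<^esub> y \<longleftrightarrow> x \<ominus>\<^bsub>M\<^esub> y \<in> N"
  using N.a_rcos_module[OF assms(2,1)] N.a_repr_independence'[of x y] N.a_rcos_self[of x] assms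
  by (auto simp: a_minus_def)

lemma coset_eq_zero_iff:
  assumes "x \<in> carrier M"
  shows "N +>\<^bsub>M\<^esub> x = N \<longleftrightarrow> x \<in> N"
  using N.a_rcos_const N.a_rcos_self[OF assms] by auto

text \<open>
  The set \<open>quot_map M' N' f C\<close> is a union of cosets over all representatives of \<open>C\<close>.  When
  \<open>f(N) \<subseteq> N'\<close> these cosets all coincide, and the union is a single coset of \<open>N'\<close>.
\<close>

lemma quot_map_coset:
  assumes M': "module R M'" and N': "submodule N' R M'" and f: "f \<in> module_hom R M M'"
    and fN: "f ` N \<subseteq> N'" and x: "x \<in> carrier M"
  shows "quot_map M' N' f (N +>\<^bsub>M\<^esub> x) = N' +>\<^bsub>M'\<^esub> f x"
proof -
  interpret M': module R M' by fact
  interpret N': abelian_subgroup N' M'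
    by (rule abelian_subgroupI3)
      (use N' M' in \<open>auto simp: additive_subgroup_def submodule_def module_def\<close>)
  have "N' +>\<^bsub>M'\<^esub> f y = N' +>\<^bsub>M'\<^esub> f x" if "y \<in> N +>\<^bsub>M\<^esub> x" for y
  proof -
    have y: "y \<in> carrier M" using N.a_elemrcos_carrier[OF x that] .
    have "y \<ominus>\<^bsub>M\<^esub> x \<in> N" using N.a_rcos_module[OF x y] that by (simp add: a_minus_def)
    then have "f y \<oplus>\<^bsub>M'\<^esub> \<ominus>\<^bsub>M'\<^esub> f x \<in> N'"
      using fN module_hom_diff_eq[OF M M' f y x] by (auto simp: a_minus_def)
    then have "f y \<in> N' +>\<^bsub>M'\<^esub> f x"
      by (intro N'.a_rcos_module_rev module_homD(1)[OF f] x y)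
    then show ?thesis by (rule N'.a_repr_independence'[OF _ module_homD(1)[OF f x], symmetric])
  qed
  moreover have "x \<in> N +>\<^bsub>M\<^esub> x" by (rule N.a_rcos_self[OF x])
  ultimately show ?thesis unfolding quot_map_def by blast
qed

lemma quot_carrierE:
  assumes "C \<in> carrier (quot_module M N)"
  obtains x where "x \<in> carrier M" "C = N +>\<^bsub>M\<^esub> x"
  using assms by (auto simp: quot_module_sel A_RCOSETS_def')

lemma coset_in_quot: "x \<in> carrier M \<Longrightarrow> N +>\<^bsub>M\<^esub> x \<in> carrier (quot_module M N)"
  by (auto simp: quot_module_sel A_RCOSETS_def')

lemma quot_add_coset:
  "x \<in> carrier M \<Longrightarrow> y \<in> carrier M \<Longrightarrow>
   (N +>\<^bsub>M\<^esub> x) \<oplus>\<^bsub>quot_module M N\<^esub> (N +>\<^bsub>M\<^esub> y) = N +>\<^bsub>M\<^esub> (x \<oplus>\<^bsub>M\<^esub> y)"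
  by (simp add: quot_module_sel N.a_rcos_sum)

lemma quot_smult_coset:
  assumes "r \<in> carrier R" "x \<in> carrier M"
  shows "r \<odot>\<^bsub>quot_module M N\<^esub> (N +>\<^bsub>M\<^esub> x) = N +>\<^bsub>M\<^esub> (r \<odot>\<^bsub>M\<^esub> x)"
proof -
  have "(\<lambda>x. r \<odot>\<^bsub>M\<^esub> x) \<in> module_hom R M M" by (rule smult_hom[OF M assms(1)])
  moreover have "(\<lambda>x. r \<odot>\<^bsub>M\<^esub> x) ` N \<subseteq> N" using M.submoduleE(4)[OF N] assms(1) by auto
  ultimately show ?thesis
    unfolding quot_module_sel using assms(2) by (intro quot_map_coset M N)
qed

lemma quot_module_is_module: "module R (quot_module M N)"
proof (rule moduleI)
  have z: "\<zero>\<^bsub>quot_module M N\<^esub> = N +>\<^bsub>M\<^esub> \<zero>\<^bsub>M\<^esub>"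
    by (simp add: quot_module_sel N.a_rcos_const)
  show "abelian_group (quot_module M N)"
  proof (rule abelian_groupI)
    fix C assume "C \<in> carrier (quot_module M N)"
    then obtain x where x: "x \<in> carrier M" "C = N +>\<^bsub>M\<^esub> x" by (rule quot_carrierE)
    then show "\<exists>D\<in>carrier (quot_module M N). D \<oplus>\<^bsub>quot_module M N\<^esub> C = \<zero>\<^bsub>quot_module M N\<^esub>"
      by (intro bexI[of _ "N +>\<^bsub>M\<^esub> (\<ominus>\<^bsub>M\<^esub> x)"]) (auto simp: quot_add_coset z coset_in_quot M.l_neg)
  qed (auto elim!: quot_carrierE simp: z quot_add_coset coset_in_quot M.a_ac)
qed (auto elim!: quot_carrierE simp: quot_add_coset quot_smult_coset coset_in_quot M.smult_l_distr
    M.smult_r_distr M.smult_assoc1 intro: M.R.is_cring M.R.cring_axioms)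

lemma coset_hom: "(\<lambda>x. N +>\<^bsub>M\<^esub> x) \<in> module_hom R M (quot_module M N)"
  by (rule module_homI) (auto simp: coset_in_quot quot_add_coset quot_smult_coset)

text \<open>
  The lift is the value at an arbitrarily chosen representative; this makes it additive because any two
  representatives differ by an element on which \<open>f\<close> vanishes.
\<close>

lemma quot_module_lift:
  assumes M': "module R M'" and f: "f \<in> module_hom R M M'" and fN: "\<And>x. x \<in> N \<Longrightarrow> f x = \<zero>\<^bsub>M'\<^esub>"
  obtains g where "g \<in> module_hom R (quot_module M N) M'"
    and "\<And>x. x \<in> carrier M \<Longrightarrow> g (N +>\<^bsub>M\<^esub> x) = f x"
proof
  define g where "g C = f (SOME x. x \<in> carrier M \<and> C = N +>\<^bsub>M\<^esub> x)" for C
  show g: "g (N +>\<^bsub>M\<^esub> x) = f x" if x: "x \<in> carrier M" for x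
  proof -
    let ?y = "SOME y. y \<in> carrier M \<and> N +>\<^bsub>M\<^esub> x = N +>\<^bsub>M\<^esub> y"
    have y: "?y \<in> carrier M" "N +>\<^bsub>M\<^esub> x = N +>\<^bsub>M\<^esub> ?y"
      using someI[of "\<lambda>y. y \<in> carrier M \<and> N +>\<^bsub>M\<^esub> x = N +>\<^bsub>M\<^esub> y", OF conjI[OF x refl]] by auto
    then have "f (x \<ominus>\<^bsub>M\<^esub> ?y) = \<zero>\<^bsub>M'\<^esub>" using coset_eq_iff[OF x y(1)] fN by simp
    then show ?thesis using module_hom_diff_zero_iff[OF M M' f x y(1)] by (simp add: g_def)
  qed
  show "g \<in> module_hom R (quot_module M N) M'"
    by (rule module_homI)
      (auto elim!: quot_carrierE simp: quot_add_coset quot_smult_coset g module_homD[OF f])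
qed

end

lemma module_isomorphicI:
  assumes f: "f \<in> module_hom R M N" and g: "g \<in> module_hom R N M"
    and "\<And>x. x \<in> carrier M \<Longrightarrow> g (f x) = x" "\<And>y. y \<in> carrier N \<Longrightarrow> f (g y) = y"
  shows "module_isomorphic R M N"
proof -
  have "bij_betw f (carrier M) (carrier N)"
    by (rule bij_betw_byWitness[where f' = g])
      (use assms module_homD(1)[OF f] module_homD(1)[OF g] in auto)
  then show ?thesis using f by (auto simp: module_isomorphic_def)
qed

section \<open>Modules given by generators and relations\<close>

definition presented_class ::
  "('k, 'r) ring_scheme \<Rightarrow> 'x set \<Rightarrow> ('x \<Rightarrow> 'k) set \<Rightarrow> 'x \<Rightarrow> ('x \<Rightarrow> 'k) set"
  where "presented_class R X S x =
    module_span R (free_module R X) S +>\<^bsub>free_module R X\<^esub> basis_elt R x"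

context
  fixes R :: "('k, 'r) ring_scheme" and X :: "'x set" and S :: "('x \<Rightarrow> 'k) set"
  assumes R: "cring R" and S: "S \<subseteq> carrier (free_module R X)"
begin

lemmas presenting_free_module = free_module_is_module[OF R]
lemmas relator_span = module_span_submodule[OF presenting_free_module S]

lemma presented_is_module: "module R (presented_module R X S)"
  unfolding presented_module_def by (rule quot_module_is_module[OF presenting_free_module relator_span])

lemma presented_class_closed: "x \<in> X \<Longrightarrow> presented_class R X S x \<in> carrier (presented_module R X S)"
  unfolding presented_module_def presented_class_def
  by (intro coset_in_quot[OF presenting_free_module relator_span] basis_elt_closed[OF R])

text \<open>
  The quotient map is obtained here once, as a hom that is onto and kills the relators, so that
  the later arguments need not mention cosets.
\<close>

lemma free_projection:
  obtains p where "p \<in> module_hom R (free_module R X) (presented_module R X S)"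
    and "\<And>x. p (basis_elt R x) = presented_class R X S x"
    and "\<And>s. s \<in> S \<Longrightarrow> p s = \<zero>\<^bsub>presented_module R X S\<^esub>"
    and "p ` carrier (free_module R X) = carrier (presented_module R X S)"
proof
  let ?p = "\<lambda>x. module_span R (free_module R X) S +>\<^bsub>free_module R X\<^esub> x"
  show "?p \<in> module_hom R (free_module R X) (presented_module R X S)"
    unfolding presented_module_def by (rule coset_hom[OF presenting_free_module relator_span])
  show "?p (basis_elt R x) = presented_class R X S x" for x by (simp add: presented_class_def)
  show "?p s = \<zero>\<^bsub>presented_module R X S\<^esub>" if "s \<in> S" for s
    using that S module_span_superset[of S R "free_module R X"] coset_eq_zero_iff[OF presenting_free_module relator_span, of s]
    by (auto simp: presented_module_def quot_module_sel)
  show "?p ` carrier (free_module R X) = carrier (presented_module R X S)"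
    unfolding presented_module_def
    by (auto elim!: quot_carrierE[OF presenting_free_module relator_span] intro: coset_in_quot[OF presenting_free_module relator_span])
qed

text \<open>
  The tautological assignment satisfies the relations.  Combined with a description of the maps that
  satisfy them, this yields the identities that hold between the generators themselves.
\<close>

lemma lin_ext_presented_class:
  assumes "s \<in> S"
  shows "lin_ext R (presented_module R X S) (presented_class R X S) s = \<zero>\<^bsub>presented_module R X S\<^esub>"
proof -
  obtain p where p: "p \<in> module_hom R (free_module R X) (presented_module R X S)"
    "\<And>x. p (basis_elt R x) = presented_class R X S x"
    "p s = \<zero>\<^bsub>presented_module R X S\<^esub>"
    using free_projection assms by metis
  have l: "lin_ext R (presented_module R X S) (presented_class R X S)
      \<in> module_hom R (free_module R X) (presented_module R X S)"
    by (rule lin_ext_hom[OF presented_is_module]) (use presented_class_closed in blast)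
  have "lin_ext R (presented_module R X S) (presented_class R X S) s = p s"
    by (rule free_module_hom_eq[OF R presented_is_module l p(1)])
      (use assms S in \<open>auto simp: p(2) lin_ext_basis[OF presented_is_module] presented_class_closed\<close>)
  then show ?thesis by (simp add: p(3))
qed

lemma presented_module_lift:
  assumes M: "module R M" and g: "g \<in> X \<rightarrow> carrier M"
    and rel: "\<And>s. s \<in> S \<Longrightarrow> lin_ext R M g s = \<zero>\<^bsub>M\<^esub>"
  obtains h where "h \<in> module_hom R (presented_module R X S) M"
    and "\<And>x. x \<in> X \<Longrightarrow> h (presented_class R X S x) = g x"
proof -
  interpret M: module R M by (rule M)
  have l: "lin_ext R M g \<in> module_hom R (free_module R X) M" by (rule lin_ext_hom[OF M g])
  have "submodule {\<zero>\<^bsub>M\<^esub>} R M" by (rule M.submoduleI) auto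
  then have "lin_ext R M g ` module_span R (free_module R X) S \<subseteq> {\<zero>\<^bsub>M\<^esub>}"
    by (rule hom_maps_module_span[OF presenting_free_module M l _ S]) (use rel in auto)
  then have z: "lin_ext R M g x = \<zero>\<^bsub>M\<^esub>" if "x \<in> module_span R (free_module R X) S" for x
    using that by auto
  obtain h where h: "h \<in> module_hom R (presented_module R X S) M"
    and hx: "\<And>x. x \<in> carrier (free_module R X) \<Longrightarrow>
      h (module_span R (free_module R X) S +>\<^bsub>free_module R X\<^esub> x) = lin_ext R M g x"
    unfolding presented_module_def using quot_module_lift[OF presenting_free_module relator_span M l z] by blast
  show thesis
  proof (rule that[OF h])
    fix x assume x: "x \<in> X"
    then show "h (presented_class R X S x) = g x"
      using hx[OF basis_elt_closed[OF R x]] lin_ext_basis[OF M, of g x] g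
      by (auto simp: presented_class_def)
  qed
qed

text \<open>
  Generators suffice to compare homs, since the classes of generators span.
\<close>

lemma presented_module_hom_eq:
  assumes M: "module R M" and f: "f \<in> module_hom R (presented_module R X S) M"
    and g: "g \<in> module_hom R (presented_module R X S) M"
    and eq: "\<And>x. x \<in> X \<Longrightarrow> f (presented_class R X S x) = g (presented_class R X S x)"
    and c: "c \<in> carrier (presented_module R X S)"
  shows "f c = g c"
proof -
  obtain p where p: "p \<in> module_hom R (free_module R X) (presented_module R X S)"
    "\<And>x. p (basis_elt R x) = presented_class R X S x"
    "p ` carrier (free_module R X) = carrier (presented_module R X S)"
    using free_projection by metis
  obtain z where z: "z \<in> carrier (free_module R X)" "c = p z" using c p(3) by auto
  show ?thesis unfolding z(2)
    by (rule free_module_hom_eq[OF R M module_hom_comp[OF p(1) f] module_hom_comp[OF p(1) g] _ z(1)])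
      (simp add: p(2) eq)
qed

end

text \<open>
  It is enough to check that the relators of the source become trivial in the target: this makes the
  span of the relators go into the span of the relators, and then the union of cosets by which
  \<^const>\<open>quot_map\<close> is defined is a single coset.
\<close>

lemma presented_map_hom:
  fixes R :: "('k, 'r) ring_scheme"
  assumes R: "cring R" and S: "S \<subseteq> carrier (free_module R X)" and T: "T \<subseteq> carrier (free_module R Y)"
    and h: "h \<in> X \<rightarrow> Y"
    and rel: "\<And>s. s \<in> S \<Longrightarrow>
      lin_ext R (presented_module R Y T) (\<lambda>x. presented_class R Y T (h x)) s = \<zero>\<^bsub>presented_module R Y T\<^esub>"
  shows "presented_map R Y T h \<in> module_hom R (presented_module R X S) (presented_module R Y T)"
    and "x \<in> X \<Longrightarrow> presented_map R Y T h (presented_class R X S x) = presented_class R Y T (h x)"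
proof -
  note fX = free_module_is_module[OF R, of X] and fY = free_module_is_module[OF R, of Y]
  note sX = module_span_submodule[OF fX S] and sY = module_span_submodule[OF fY T]
  note pY = presented_is_module[OF R T]
  let ?f = "lin_ext R (free_module R Y) (\<lambda>x. basis_elt R (h x))"
  let ?l = "lin_ext R (presented_module R Y T) (\<lambda>x. presented_class R Y T (h x))"
  let ?q = "\<lambda>y. module_span R (free_module R Y) T +>\<^bsub>free_module R Y\<^esub> y"
  have f: "?f \<in> module_hom R (free_module R X) (free_module R Y)"
    by (rule lin_ext_hom[OF fY]) (use h in \<open>auto intro!: basis_elt_closed[OF R]\<close>)
  have l: "?l \<in> module_hom R (free_module R X) (presented_module R Y T)"
    by (rule lin_ext_hom[OF pY]) (use h in \<open>auto intro!: presented_class_closed[OF R T]\<close>)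
  have q: "?q \<in> module_hom R (free_module R Y) (presented_module R Y T)"
    unfolding presented_module_def by (rule coset_hom[OF fY sY])
  have fb: "?f (basis_elt R x) = basis_elt R (h x)" if "x \<in> X" for x
    by (rule lin_ext_basis[OF fY]) (use h that in \<open>auto intro!: basis_elt_closed[OF R]\<close>)
  have lb: "?l (basis_elt R x) = presented_class R Y T (h x)" if "x \<in> X" for x
    by (rule lin_ext_basis[OF pY]) (use h that in \<open>auto intro!: presented_class_closed[OF R T]\<close>)
  have ql: "?q (?f c) = ?l c" if "c \<in> carrier (free_module R X)" for c
    by (rule free_module_hom_eq[OF R pY module_hom_comp[OF f q] l _ that])
      (simp add: fb lb, simp add: presented_class_def)
  have sub: "?f ` module_span R (free_module R X) S \<subseteq> module_span R (free_module R Y) T"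
  proof (rule hom_maps_module_span[OF fX fY f sY S], intro image_subsetI)
    fix s assume s: "s \<in> S"
    then have "?f s \<in> carrier (free_module R Y)" using S module_homD(1)[OF f] by auto
    moreover have "?q (?f s) = module_span R (free_module R Y) T"
      using ql s S rel[OF s] by (auto simp: presented_module_def quot_module_sel)
    ultimately show "?f s \<in> module_span R (free_module R Y) T"
      using coset_eq_zero_iff[OF fY sY] by blast
  qed
  have m: "presented_map R Y T h (module_span R (free_module R X) S +>\<^bsub>free_module R X\<^esub> c) = ?q (?f c)"
    if "c \<in> carrier (free_module R X)" for c
    unfolding presented_map_def by (rule quot_map_coset[OF fX sX fY sY f sub that])
  show "presented_map R Y T h (presented_class R X S x) = presented_class R Y T (h x)" if "x \<in> X"
    using m[OF basis_elt_closed[OF R that]] fb[OF that] by (simp add: presented_class_def)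
  show "presented_map R Y T h \<in> module_hom R (presented_module R X S) (presented_module R Y T)"
    unfolding presented_module_def[of R X S]
  proof (rule module_homI)
    fix C assume "C \<in> carrier (quot_module (free_module R X) (module_span R (free_module R X) S))"
    then obtain c where c: "c \<in> carrier (free_module R X)" "C = module_span R (free_module R X) S +>\<^bsub>free_module R X\<^esub> c"
      by (rule quot_carrierE[OF fX sX])
    then show "presented_map R Y T h C \<in> carrier (presented_module R Y T)"
      by (simp add: m module_homD(1)[OF q] module_homD(1)[OF f])
    fix r assume r: "r \<in> carrier R"
    then show "presented_map R Y T h (r \<odot>\<^bsub>quot_module (free_module R X) (module_span R (free_module R X) S)\<^esub> C)
      = r \<odot>\<^bsub>presented_module R Y T\<^esub> presented_map R Y T h C"
      using c by (simp add: quot_smult_coset[OF fX sX] m module.smult_closed[OF fX] module_homD[OF q] module_homD[OF f])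
  next
    fix C D assume "C \<in> carrier (quot_module (free_module R X) (module_span R (free_module R X) S))"
      "D \<in> carrier (quot_module (free_module R X) (module_span R (free_module R X) S))"
    then obtain c d where c: "c \<in> carrier (free_module R X)" "C = module_span R (free_module R X) S +>\<^bsub>free_module R X\<^esub> c"
      and d: "d \<in> carrier (free_module R X)" "D = module_span R (free_module R X) S +>\<^bsub>free_module R X\<^esub> d"
      by (metis quot_carrierE[OF fX sX])
    then show "presented_map R Y T h (C \<oplus>\<^bsub>quot_module (free_module R X) (module_span R (free_module R X) S)\<^esub> D)
      = presented_map R Y T h C \<oplus>\<^bsub>presented_module R Y T\<^esub> presented_map R Y T h D"
      using abelian_monoid.a_closed[OF abelian_group.axioms(1)[OF module.axioms(2)[OF fX]] c(1) d(1)]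
      by (simp add: quot_add_coset[OF fX sX] m module_homD[OF q] module_homD[OF f])
  qed
qed

section \<open>Products of lists of algebra elements\<close>

text \<open>
  The products of fibres in the symmetric bar construction, with the list of indices as a variable: a
  fibre is recorded as the list of its elements in order.
\<close>

definition list_prod :: "('k, 'a, 's) module_scheme \<Rightarrow> ('i \<Rightarrow> 'a) \<Rightarrow> 'i list \<Rightarrow> 'a"
  where "list_prod A a l = foldr (\<lambda>i p. a i \<otimes>\<^bsub>A\<^esub> p) l \<one>\<^bsub>A\<^esub>"

lemma list_prod_simps [simp]:
  "list_prod A a [] = \<one>\<^bsub>A\<^esub>"
  "list_prod A a (i # l) = a i \<otimes>\<^bsub>A\<^esub> list_prod A a l"
  by (simp_all add: list_prod_def)

lemma list_prod_cong: "(\<And>i. i \<in> set l \<Longrightarrow> a i = b i) \<Longrightarrow> list_prod A a l = list_prod A b l"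
  by (induction l) auto

context unital_algebra
begin

lemma list_prod_closed [intro]:
  "(\<And>i. i \<in> set l \<Longrightarrow> a i \<in> carrier A) \<Longrightarrow> list_prod A a l \<in> carrier A"
  by (induction l) auto

lemma list_prod_append:
  "(\<And>i. i \<in> set l \<union> set l' \<Longrightarrow> a i \<in> carrier A) \<Longrightarrow>
   list_prod A a (l @ l') = list_prod A a l \<otimes>\<^bsub>A\<^esub> list_prod A a l'"
  by (induction l) (auto simp: list_prod_closed m_assoc)

lemma list_prod_concat:
  "(\<And>j i. j \<in> set js \<Longrightarrow> i \<in> set (w j) \<Longrightarrow> a i \<in> carrier A) \<Longrightarrow>
   list_prod A a (concat (map w js)) = list_prod A (\<lambda>j. list_prod A a (w j)) js"
proof (induction js)
  case (Cons j js)
  have "list_prod A a (w j @ concat (map w js)) = list_prod A a (w j) \<otimes>\<^bsub>A\<^esub> list_prod A a (concat (map w js))"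
    by (rule list_prod_append) (use Cons.prems in auto)
  moreover have "list_prod A a (concat (map w js)) = list_prod A (\<lambda>j. list_prod A a (w j)) js"
    by (rule Cons.IH) (use Cons.prems in auto)
  ultimately show ?case by simp
qed simp

text \<open>
  Multilinearity of products in a noncommutative algebra: if no index repeats, the product depends on
  one factor through a two-sided multiplication, and two-sided multiplications are linear.
\<close>

lemma list_prod_update:
  assumes "distinct l" "i \<in> set l" "\<And>i. i \<in> set l \<Longrightarrow> a i \<in> carrier A"
  obtains p q where "p \<in> carrier A" "q \<in> carrier A"
    "\<And>x. x \<in> carrier A \<Longrightarrow> list_prod A (a(i := x)) l = p \<otimes>\<^bsub>A\<^esub> x \<otimes>\<^bsub>A\<^esub> q"
proof -
  obtain l1 l2 where l: "l = l1 @ i # l2" using assms(2) split_list by fast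
  have c: "list_prod A a l1 \<in> carrier A" "list_prod A a l2 \<in> carrier A"
    using assms(3) by (auto simp: l)
  have "list_prod A (a(i := x)) l = list_prod A a l1 \<otimes>\<^bsub>A\<^esub> x \<otimes>\<^bsub>A\<^esub> list_prod A a l2"
    if x: "x \<in> carrier A" for x
  proof -
    have "list_prod A (a(i := x)) l1 = list_prod A a l1" "list_prod A (a(i := x)) l2 = list_prod A a l2"
      using assms(1) by (auto simp: l intro!: list_prod_cong)
    moreover have "list_prod A (a(i := x)) l
        = list_prod A (a(i := x)) l1 \<otimes>\<^bsub>A\<^esub> list_prod A (a(i := x)) (i # l2)"
      unfolding l by (rule list_prod_append) (use assms(3) x in \<open>auto simp: l\<close>)
    ultimately show ?thesis using c x by (simp add: m_assoc)
  qed
  then show thesis using that c by blast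
qed

lemma two_sided_mult_add:
  "\<lbrakk>p \<in> carrier A; q \<in> carrier A; x \<in> carrier A; y \<in> carrier A\<rbrakk> \<Longrightarrow>
   p \<otimes>\<^bsub>A\<^esub> (x \<oplus>\<^bsub>A\<^esub> y) \<otimes>\<^bsub>A\<^esub> q = p \<otimes>\<^bsub>A\<^esub> x \<otimes>\<^bsub>A\<^esub> q \<oplus>\<^bsub>A\<^esub> p \<otimes>\<^bsub>A\<^esub> y \<otimes>\<^bsub>A\<^esub> q"
  by (simp add: l_distr r_distr)

lemma two_sided_mult_smult:
  "\<lbrakk>p \<in> carrier A; q \<in> carrier A; x \<in> carrier A; r \<in> carrier R\<rbrakk> \<Longrightarrow>
   p \<otimes>\<^bsub>A\<^esub> (r \<odot>\<^bsub>A\<^esub> x) \<otimes>\<^bsub>A\<^esub> q = r \<odot>\<^bsub>A\<^esub> (p \<otimes>\<^bsub>A\<^esub> x \<otimes>\<^bsub>A\<^esub> q)"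
  by (simp add: smult_mult_left smult_mult_right)

lemma two_sided_mult_hom:
  "p \<in> carrier A \<Longrightarrow> q \<in> carrier A \<Longrightarrow> (\<lambda>x. p \<otimes>\<^bsub>A\<^esub> x \<otimes>\<^bsub>A\<^esub> q) \<in> module_hom R A A"
  by (rule module_homI) (auto simp: two_sided_mult_add two_sided_mult_smult)

section \<open>The commutator ideal\<close>

lemma module_A: "module R A" by (rule module_axioms)

lemma R_cring: "cring R" by (rule module.axioms(1)[OF module_A])

text \<open>
  Since \<open>r x = (r 1) x\<close>, scalars act through multiplication by algebra elements.
\<close>

lemma ideal_submodule:
  assumes "ideal I A"
  shows "submodule I R A"
proof -
  interpret I: ideal I A by fact
  have "r \<odot>\<^bsub>A\<^esub> x \<in> I" if "r \<in> carrier R" "x \<in> I" for r x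
  proof -
    have "(r \<odot>\<^bsub>A\<^esub> \<one>\<^bsub>A\<^esub>) \<otimes>\<^bsub>A\<^esub> x = r \<odot>\<^bsub>A\<^esub> x"
      using that I.Icarr by (simp add: smult_mult_left)
    then show ?thesis using I.I_l_closed[OF that(2), of "r \<odot>\<^bsub>A\<^esub> \<one>\<^bsub>A\<^esub>"] that by simp
  qed
  then show ?thesis
    using I.additive_subgroup_axioms
    by (auto simp: submodule_def submodule_axioms_def additive_subgroup_def)
qed

lemma commutators_closed:
  "{a \<otimes>\<^bsub>A\<^esub> b \<ominus>\<^bsub>A\<^esub> b \<otimes>\<^bsub>A\<^esub> a | a b. a \<in> carrier A \<and> b \<in> carrier A} \<subseteq> carrier A"
  by auto

lemma commutator_submodule_submodule: "submodule (commutator_submodule R A) R A"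
  unfolding commutator_submodule_def by (rule module_span_submodule[OF module_A commutators_closed])

lemma commutator_in: 
  "a \<in> carrier A \<Longrightarrow> b \<in> carrier A \<Longrightarrow> a \<otimes>\<^bsub>A\<^esub> b \<ominus>\<^bsub>A\<^esub> b \<otimes>\<^bsub>A\<^esub> a \<in> commutator_submodule R A"
  unfolding commutator_submodule_def by (rule subsetD[OF module_span_superset]) auto

lemma commutator_ideal: "ideal (genideal A (commutator_submodule R A)) A"
  by (rule genideal_ideal) (rule submoduleE(1)[OF commutator_submodule_submodule])

lemma commutator_in_ideal:
  "a \<in> carrier A \<Longrightarrow> b \<in> carrier A \<Longrightarrow>
   a \<otimes>\<^bsub>A\<^esub> b \<ominus>\<^bsub>A\<^esub> b \<otimes>\<^bsub>A\<^esub> a \<in> genideal A (commutator_submodule R A)"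
  using genideal_self[OF submoduleE(1)[OF commutator_submodule_submodule]] commutator_in by blast

text \<open>
  The quotient by the commutator ideal is commutative.  In the induction the first factor \<open>x\<close> of one
  product is located in the other, \<open>u x v\<close>, and moved to the front by means of
  \<open>x p - u x v = x (p - u v) + (x u - u x) v\<close>.
\<close>

lemma list_prod_reorder:
  assumes "distinct l" "distinct l'" "set l = set l'" "\<And>i. i \<in> set l \<Longrightarrow> a i \<in> carrier A"
  shows "genideal A (commutator_submodule R A) +>\<^bsub>A\<^esub> list_prod A a l =
         genideal A (commutator_submodule R A) +>\<^bsub>A\<^esub> list_prod A a l'"
  using assms
proof (induction l arbitrary: l')
  case (Cons i l)
  let ?I = "genideal A (commutator_submodule R A)"
  interpret I: ideal ?I A by (rule commutator_ideal)
  note cos = coset_eq_iff[OF module_A ideal_submodule[OF commutator_ideal]]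
  obtain l1 l2 where l': "l' = l1 @ i # l2" using Cons.prems(3) split_list[of i l'] by auto
  have "set l = set l' - {i}" using Cons.prems by auto
  then have s: "set l = set (l1 @ l2)" "distinct (l1 @ l2)" using Cons.prems(2) by (auto simp: l')
  have ac: "a j \<in> carrier A" if "j \<in> set (l1 @ i # l2)" for j
    using Cons.prems(3,4) that by (auto simp: l')
  let ?x = "a i" and ?p = "list_prod A a l" and ?u = "list_prod A a l1" and ?v = "list_prod A a l2"
  have x: "?x \<in> carrier A" and p: "?p \<in> carrier A" and u: "?u \<in> carrier A" and v: "?v \<in> carrier A"
    using ac by (auto simp: s(1) intro!: list_prod_closed)
  have "?I +>\<^bsub>A\<^esub> ?p = ?I +>\<^bsub>A\<^esub> list_prod A a (l1 @ l2)"
    by (rule Cons.IH) (use Cons.prems s in auto)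
  also have "list_prod A a (l1 @ l2) = ?u \<otimes>\<^bsub>A\<^esub> ?v"
    by (rule list_prod_append) (use ac in auto)
  finally have "?p \<ominus>\<^bsub>A\<^esub> ?u \<otimes>\<^bsub>A\<^esub> ?v \<in> ?I" using cos p u v by simp
  then have "?x \<otimes>\<^bsub>A\<^esub> (?p \<ominus>\<^bsub>A\<^esub> ?u \<otimes>\<^bsub>A\<^esub> ?v) \<in> ?I" using x by (rule I.I_l_closed)
  moreover have "(?x \<otimes>\<^bsub>A\<^esub> ?u \<ominus>\<^bsub>A\<^esub> ?u \<otimes>\<^bsub>A\<^esub> ?x) \<otimes>\<^bsub>A\<^esub> ?v \<in> ?I"
    by (rule I.I_r_closed[OF commutator_in_ideal]) (fact x u v)+
  ultimately have "?x \<otimes>\<^bsub>A\<^esub> (?p \<ominus>\<^bsub>A\<^esub> ?u \<otimes>\<^bsub>A\<^esub> ?v) \<oplus>\<^bsub>A\<^esub> (?x \<otimes>\<^bsub>A\<^esub> ?u \<ominus>\<^bsub>A\<^esub> ?u \<otimes>\<^bsub>A\<^esub> ?x) \<otimes>\<^bsub>A\<^esub> ?v \<in> ?I"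
    by (rule I.a_closed)
  also have "?x \<otimes>\<^bsub>A\<^esub> (?p \<ominus>\<^bsub>A\<^esub> ?u \<otimes>\<^bsub>A\<^esub> ?v) \<oplus>\<^bsub>A\<^esub> (?x \<otimes>\<^bsub>A\<^esub> ?u \<ominus>\<^bsub>A\<^esub> ?u \<otimes>\<^bsub>A\<^esub> ?x) \<otimes>\<^bsub>A\<^esub> ?v
    = ?x \<otimes>\<^bsub>A\<^esub> ?p \<ominus>\<^bsub>A\<^esub> ?u \<otimes>\<^bsub>A\<^esub> (?x \<otimes>\<^bsub>A\<^esub> ?v)"
    using x p u v by algebra
  finally have "?I +>\<^bsub>A\<^esub> (?x \<otimes>\<^bsub>A\<^esub> ?p) = ?I +>\<^bsub>A\<^esub> (?u \<otimes>\<^bsub>A\<^esub> (?x \<otimes>\<^bsub>A\<^esub> ?v))"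
    using cos x p u v by simp
  moreover have "list_prod A a (l1 @ i # l2) = ?u \<otimes>\<^bsub>A\<^esub> (?x \<otimes>\<^bsub>A\<^esub> ?v)"
    using list_prod_append[of l1 "i # l2" a] ac by auto
  ultimately show ?case by (simp add: l')
qed simp

text \<open>
  The elements all of whose two-sided multiples \<open>u x v\<close> are killed by \<open>f\<close> form a two-sided ideal, even
  when the kernel of \<open>f\<close> itself does not.  By hypothesis it contains the commutators.
\<close>

lemma vanishes_on_commutator_ideal:
  assumes M: "module R M" and f: "f \<in> module_hom R A M"
    and swap: "\<And>u a b v. \<lbrakk>u \<in> carrier A; a \<in> carrier A; b \<in> carrier A; v \<in> carrier A\<rbrakk> \<Longrightarrow>
      f (u \<otimes>\<^bsub>A\<^esub> (a \<otimes>\<^bsub>A\<^esub> b) \<otimes>\<^bsub>A\<^esub> v) = f (u \<otimes>\<^bsub>A\<^esub> (b \<otimes>\<^bsub>A\<^esub> a) \<otimes>\<^bsub>A\<^esub> v)"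
    and x: "x \<in> genideal A (commutator_submodule R A)"
  shows "f x = \<zero>\<^bsub>M\<^esub>"
proof -
  define J where "J = {x \<in> carrier A. \<forall>u\<in>carrier A. \<forall>v\<in>carrier A. f (u \<otimes>\<^bsub>A\<^esub> x \<otimes>\<^bsub>A\<^esub> v) = \<zero>\<^bsub>M\<^esub>}"
  interpret N: module R M by (rule M)
  have h: "(\<lambda>x. f (u \<otimes>\<^bsub>A\<^esub> x \<otimes>\<^bsub>A\<^esub> v)) \<in> module_hom R A M"
    if "u \<in> carrier A" "v \<in> carrier A" for u v
    by (rule module_hom_comp[OF two_sided_mult_hom[OF that] f])
  have J: "submodule J R A"
  proof (rule submoduleI)
    show "\<zero>\<^bsub>A\<^esub> \<in> J" using module_hom_zero[OF module_A M f] by (simp add: J_def)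
    show "\<ominus>\<^bsub>A\<^esub> x \<in> J" if "x \<in> J" for x
      using that module_hom_uminus[OF module_A M h] by (auto simp: J_def)
    show "x \<oplus>\<^bsub>A\<^esub> y \<in> J" if "x \<in> J" "y \<in> J" for x y
      using that module_homD(2)[OF h] by (auto simp: J_def)
    show "r \<odot>\<^bsub>A\<^esub> x \<in> J" if "r \<in> carrier R" "x \<in> J" for r x
      using that module_homD(3)[OF h] by (auto simp: J_def)
  qed (auto simp: J_def)
  have "ideal J A"
  proof (rule idealI)
    show "subgroup J (add_monoid A)" by (rule submodule.axioms(1)[OF J])
    fix x y assume x: "x \<in> J" and y: "y \<in> carrier A"
    show "y \<otimes>\<^bsub>A\<^esub> x \<in> J"
      using x y by (auto simp: J_def) (metis m_assoc m_closed)
    show "x \<otimes>\<^bsub>A\<^esub> y \<in> J"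
      using x y by (auto simp: J_def) (metis m_assoc m_closed)
  qed (rule ring_axioms)
  moreover have "commutator_submodule R A \<subseteq> J"
    unfolding commutator_submodule_def
  proof (rule module_span_minimal[OF J], clarify)
    fix a b assume a: "a \<in> carrier A" and b: "b \<in> carrier A"
    then show "a \<otimes>\<^bsub>A\<^esub> b \<ominus>\<^bsub>A\<^esub> b \<otimes>\<^bsub>A\<^esub> a \<in> J"
      using swap[OF _ a b] module_hom_diff_zero_iff[OF module_A M h, of _ _ "a \<otimes>\<^bsub>A\<^esub> b" "b \<otimes>\<^bsub>A\<^esub> a"]
      by (auto simp: J_def)
  qed
  ultimately have "x \<in> J" using genideal_minimal x by blast
  then have "x \<in> carrier A" "f (\<one>\<^bsub>A\<^esub> \<otimes>\<^bsub>A\<^esub> x \<otimes>\<^bsub>A\<^esub> \<one>\<^bsub>A\<^esub>) = \<zero>\<^bsub>M\<^esub>"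
    unfolding J_def by blast+
  then show ?thesis by simp
qed

section \<open>Tensor powers\<close>

lemma tensor_power_gens_update:
  "a \<in> tensor_power_gens A n \<Longrightarrow> i \<le> n \<Longrightarrow> x \<in> carrier A \<Longrightarrow> a(i := x) \<in> tensor_power_gens A n"
  by (auto simp: tensor_power_gens_def PiE_def extensional_def)

lemma tensor_power_rels_closed:
  "tensor_power_rels R A n \<subseteq> carrier (free_module R (tensor_power_gens A n))"
proof -
  interpret L: module R "free_module R (tensor_power_gens A n)"
    by (rule free_module_is_module[OF R_cring])
  show ?thesis
    unfolding tensor_power_rels_def Let_def
    by (auto intro!: L.minus_closed L.a_closed L.smult_closed basis_elt_closed[OF R_cring]
        tensor_power_gens_update)
qed

text \<open>
  Both directions are used: from right to left to define maps out of a tensor power, from left to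
  right, with \<open>g\<close> the tautological map, for the multilinearity of \<open>a\<^sub>0 \<otimes> \<dots> \<otimes> a\<^sub>n\<close>.
\<close>

lemma multilinear_iff_tensor_power_rels:
  assumes M: "module R M" and g: "g \<in> tensor_power_gens A n \<rightarrow> carrier M"
  shows "(\<forall>s\<in>tensor_power_rels R A n. lin_ext R M g s = \<zero>\<^bsub>M\<^esub>) \<longleftrightarrow>
    (\<forall>a\<in>tensor_power_gens A n. \<forall>i\<le>n. (\<lambda>x. g (a(i := x))) \<in> module_hom R A M)"
proof -
  let ?L = "free_module R (tensor_power_gens A n)"
  let ?e = "basis_elt R :: (nat \<Rightarrow> 'c) \<Rightarrow> _"
  interpret L: module R ?L by (rule free_module_is_module[OF R_cring])
  note l = lin_ext_hom[OF M g]
  note u = tensor_power_gens_update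
  have e: "?e a \<in> carrier ?L" if "a \<in> tensor_power_gens A n" for a
    by (rule basis_elt_closed[OF R_cring that])
  have b: "lin_ext R M g (?e a) = g a" if "a \<in> tensor_power_gens A n" for a
    by (rule lin_ext_basis[OF M]) (use g that in auto)
  have 1: "lin_ext R M g (?e (a(i := x \<oplus>\<^bsub>A\<^esub> y)) \<ominus>\<^bsub>?L\<^esub> (?e (a(i := x)) \<oplus>\<^bsub>?L\<^esub> ?e (a(i := y)))) = \<zero>\<^bsub>M\<^esub>
      \<longleftrightarrow> g (a(i := x \<oplus>\<^bsub>A\<^esub> y)) = g (a(i := x)) \<oplus>\<^bsub>M\<^esub> g (a(i := y))"
    if "a \<in> tensor_power_gens A n" "i \<le> n" "x \<in> carrier A" "y \<in> carrier A" for a i x y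
    using that by (simp add: module_hom_diff_zero_iff[OF L.module_axioms M l] u e b module_homD(2)[OF l])
  have 2: "lin_ext R M g (?e (a(i := r \<odot>\<^bsub>A\<^esub> x)) \<ominus>\<^bsub>?L\<^esub> r \<odot>\<^bsub>?L\<^esub> ?e (a(i := x))) = \<zero>\<^bsub>M\<^esub>
      \<longleftrightarrow> g (a(i := r \<odot>\<^bsub>A\<^esub> x)) = r \<odot>\<^bsub>M\<^esub> g (a(i := x))"
    if "a \<in> tensor_power_gens A n" "i \<le> n" "r \<in> carrier R" "x \<in> carrier A" for a i r x
    using that by (simp add: module_hom_diff_zero_iff[OF L.module_axioms M l] u e b module_homD(3)[OF l])
  have c: "g (a(i := x)) \<in> carrier M" if "a \<in> tensor_power_gens A n" "i \<le> n" "x \<in> carrier A" for a i x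
    using u[OF that] g by blast
  show ?thesis (is "?l = ?r")
  proof
    assume ?l
    then have rel: "lin_ext R M g s = \<zero>\<^bsub>M\<^esub>" if "s \<in> tensor_power_rels R A n" for s
      using that by blast
    show ?r
    proof (intro ballI allI impI module_homI)
      fix a i x y assume h: "a \<in> tensor_power_gens A n" "i \<le> n" "x \<in> carrier A" "y \<in> carrier A"
      show "g (a(i := x \<oplus>\<^bsub>A\<^esub> y)) = g (a(i := x)) \<oplus>\<^bsub>M\<^esub> g (a(i := y))"
        unfolding 1[OF h, symmetric]
        by (rule rel, unfold tensor_power_rels_def Let_def) (use h in blast)
    next
      fix a i r x assume h: "a \<in> tensor_power_gens A n" "i \<le> n" "r \<in> carrier R" "x \<in> carrier A"
      show "g (a(i := r \<odot>\<^bsub>A\<^esub> x)) = r \<odot>\<^bsub>M\<^esub> g (a(i := x))"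
        unfolding 2[OF h, symmetric]
        by (rule rel, unfold tensor_power_rels_def Let_def) (use h in blast)
    qed (rule c)
  next
    assume ?r
    then have m: "(\<lambda>x. g (a(i := x))) \<in> module_hom R A M" if "a \<in> tensor_power_gens A n" "i \<le> n" for a i
      using that by blast
    show ?l
    proof
      fix s assume "s \<in> tensor_power_rels R A n"
      then consider
        (add) a i x y where "a \<in> tensor_power_gens A n" "i \<le> n" "x \<in> carrier A" "y \<in> carrier A"
          "s = ?e (a(i := x \<oplus>\<^bsub>A\<^esub> y)) \<ominus>\<^bsub>?L\<^esub> (?e (a(i := x)) \<oplus>\<^bsub>?L\<^esub> ?e (a(i := y)))"
      | (smult) a i r x where "a \<in> tensor_power_gens A n" "i \<le> n" "r \<in> carrier R" "x \<in> carrier A"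
          "s = ?e (a(i := r \<odot>\<^bsub>A\<^esub> x)) \<ominus>\<^bsub>?L\<^esub> r \<odot>\<^bsub>?L\<^esub> ?e (a(i := x))"
        unfolding tensor_power_rels_def Let_def by blast
      then show "lin_ext R M g s = \<zero>\<^bsub>M\<^esub>"
      proof cases
        case add
        then show ?thesis using 1 module_homD(2)[OF m] by simp
      next
        case smult
        then show ?thesis using 2 module_homD(3)[OF m] by simp
      qed
    qed
  qed
qed


abbreviation tensor_class :: "nat \<Rightarrow> (nat \<Rightarrow> 'c) \<Rightarrow> ((nat \<Rightarrow> 'c) \<Rightarrow> 'a) set"
  where "tensor_class n \<equiv> presented_class R (tensor_power_gens A n) (tensor_power_rels R A n)"

lemma tensor_power_is_module: "module R (tensor_power R A n)"
  unfolding tensor_power_def by (rule presented_is_module[OF R_cring tensor_power_rels_closed])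

lemma tensor_class_closed:
  "a \<in> tensor_power_gens A n \<Longrightarrow> tensor_class n a \<in> carrier (tensor_power R A n)"
  unfolding tensor_power_def by (rule presented_class_closed[OF R_cring tensor_power_rels_closed])

lemma tensor_class_multilinear:
  assumes "a \<in> tensor_power_gens A n" "i \<le> n"
  shows "(\<lambda>x. tensor_class n (a(i := x))) \<in> module_hom R A (tensor_power R A n)"
proof -
  have "tensor_class n \<in> tensor_power_gens A n \<rightarrow> carrier (tensor_power R A n)"
    using tensor_class_closed by blast
  from multilinear_iff_tensor_power_rels[OF tensor_power_is_module this] show ?thesis
    using lin_ext_presented_class[OF R_cring tensor_power_rels_closed] assms
    unfolding tensor_power_def by blast
qed

lemma tensor_power_lift:
  assumes "module R M" "g \<in> tensor_power_gens A n \<rightarrow> carrier M"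
    and "\<And>a i. a \<in> tensor_power_gens A n \<Longrightarrow> i \<le> n \<Longrightarrow> (\<lambda>x. g (a(i := x))) \<in> module_hom R A M"
  obtains h where "h \<in> module_hom R (tensor_power R A n) M"
    and "\<And>a. a \<in> tensor_power_gens A n \<Longrightarrow> h (tensor_class n a) = g a"
proof -
  have "lin_ext R M g s = \<zero>\<^bsub>M\<^esub>" if "s \<in> tensor_power_rels R A n" for s
    using multilinear_iff_tensor_power_rels[OF assms(1,2)] assms(3) that by blast
  from presented_module_lift[OF R_cring tensor_power_rels_closed assms(1,2) this]
  show thesis using that unfolding tensor_power_def by blast
qed

lemma tensor_power_hom_eq:
  assumes "module R M" "f \<in> module_hom R (tensor_power R A n) M" "g \<in> module_hom R (tensor_power R A n) M"
    and "\<And>a. a \<in> tensor_power_gens A n \<Longrightarrow> f (tensor_class n a) = g (tensor_class n a)"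
    and "y \<in> carrier (tensor_power R A n)"
  shows "f y = g y"
  using presented_module_hom_eq[OF R_cring tensor_power_rels_closed assms(1)] assms(2-5)
  unfolding tensor_power_def by blast

section \<open>The symmetric bar construction\<close>

lemma fibre_products_eq: "fibre_products A m \<alpha> a = (\<lambda>j\<in>{..m}. list_prod A a (snd \<alpha> j))"
  by (simp add: fibre_products_def list_prod_def)

lemma dS_homD:
  assumes "\<alpha> \<in> dS_hom n m"
  shows "i \<le> n \<Longrightarrow> fst \<alpha> i \<le> m"
    and "j \<le> m \<Longrightarrow> distinct (snd \<alpha> j)"
    and "j \<le> m \<Longrightarrow> set (snd \<alpha> j) = {i \<in> {..n}. fst \<alpha> i = j}"
  using assms by (auto simp: dS_hom_def)

lemma tensor_power_gens_nth: "a \<in> tensor_power_gens A n \<Longrightarrow> i \<le> n \<Longrightarrow> a i \<in> carrier A"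
  by (auto simp: tensor_power_gens_def)

lemma fibre_products_closed:
  assumes "\<alpha> \<in> dS_hom n m" "a \<in> tensor_power_gens A n"
  shows "fibre_products A m \<alpha> a \<in> tensor_power_gens A m"
proof -
  have "list_prod A a (snd \<alpha> j) \<in> carrier A" if "j \<le> m" for j
    using dS_homD(3)[OF assms(1) that] tensor_power_gens_nth[OF assms(2)] by auto
  then show ?thesis by (auto simp: fibre_products_eq tensor_power_gens_def)
qed

text \<open>
  Why the fibre products are multilinear: each index lies in exactly one fibre, and there exactly
  once, so that a change of one factor affects a single fibre product, by a two-sided multiplication.
\<close>

lemma fibre_products_update:
  assumes \<alpha>: "\<alpha> \<in> dS_hom n m" and a: "a \<in> tensor_power_gens A n" and i: "i \<le> n"
  obtains p q where "p \<in> carrier A" "q \<in> carrier A"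
    "\<And>x. x \<in> carrier A \<Longrightarrow> fibre_products A m \<alpha> (a(i := x)) =
      (fibre_products A m \<alpha> a)(fst \<alpha> i := p \<otimes>\<^bsub>A\<^esub> x \<otimes>\<^bsub>A\<^esub> q)"
proof -
  have j: "fst \<alpha> i \<le> m" by (rule dS_homD(1)[OF \<alpha> i])
  note f = dS_homD(2,3)[OF \<alpha> j]
  have "i \<in> set (snd \<alpha> (fst \<alpha> i))" using i by (simp add: f)
  moreover have "a k \<in> carrier A" if "k \<in> set (snd \<alpha> (fst \<alpha> i))" for k
    using that tensor_power_gens_nth[OF a] by (auto simp: f)
  ultimately obtain p q where pq: "p \<in> carrier A" "q \<in> carrier A"
    "\<And>x. x \<in> carrier A \<Longrightarrow> list_prod A (a(i := x)) (snd \<alpha> (fst \<alpha> i)) = p \<otimes>\<^bsub>A\<^esub> x \<otimes>\<^bsub>A\<^esub> q"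
    using list_prod_update[OF f(1)] by blast
  have "list_prod A (a(i := x)) (snd \<alpha> k) = list_prod A a (snd \<alpha> k)" if "k \<le> m" "k \<noteq> fst \<alpha> i" for k x
    using that dS_homD(3)[OF \<alpha>] by (intro list_prod_cong) auto
  then have "fibre_products A m \<alpha> (a(i := x)) =
      (fibre_products A m \<alpha> a)(fst \<alpha> i := p \<otimes>\<^bsub>A\<^esub> x \<otimes>\<^bsub>A\<^esub> q)" if "x \<in> carrier A" for x
    using j pq(3)[OF that] by (auto simp: fibre_products_eq fun_eq_iff)
  then show thesis using that pq(1,2) by blast
qed

lemma Bsym_fobj: "fobj (Bsym R A) n = tensor_power R A n"
  by (simp add: Bsym_def)

lemma Bsym_fmap:
  assumes \<alpha>: "\<alpha> \<in> dS_hom n m"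
  shows "fmap (Bsym R A) n m \<alpha> \<in> module_hom R (tensor_power R A n) (tensor_power R A m)" (is ?hom)
    and "a \<in> tensor_power_gens A n \<Longrightarrow>
      fmap (Bsym R A) n m \<alpha> (tensor_class n a) = tensor_class m (fibre_products A m \<alpha> a)"
proof -
  let ?g = "\<lambda>a. tensor_class m (fibre_products A m \<alpha> a)"
  have fp: "fibre_products A m \<alpha> \<in> tensor_power_gens A n \<rightarrow> tensor_power_gens A m"
    using fibre_products_closed[OF \<alpha>] by blast
  have g: "?g \<in> tensor_power_gens A n \<rightarrow> carrier (tensor_power R A m)"
    using fp tensor_class_closed by blast
  have ml: "(\<lambda>x. ?g (a(i := x))) \<in> module_hom R A (tensor_power R A m)"
    if a: "a \<in> tensor_power_gens A n" and i: "i \<le> n" for a i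
  proof -
    obtain p q where pq: "p \<in> carrier A" "q \<in> carrier A"
      "\<And>x. x \<in> carrier A \<Longrightarrow> fibre_products A m \<alpha> (a(i := x)) =
        (fibre_products A m \<alpha> a)(fst \<alpha> i := p \<otimes>\<^bsub>A\<^esub> x \<otimes>\<^bsub>A\<^esub> q)"
      using fibre_products_update[OF \<alpha> a i] by blast
    have "(\<lambda>x. tensor_class m ((fibre_products A m \<alpha> a)(fst \<alpha> i := p \<otimes>\<^bsub>A\<^esub> x \<otimes>\<^bsub>A\<^esub> q)))
        \<in> module_hom R A (tensor_power R A m)"
      by (rule module_hom_comp[OF two_sided_mult_hom[OF pq(1,2)]
            tensor_class_multilinear[OF fibre_products_closed[OF \<alpha> a] dS_homD(1)[OF \<alpha> i]]])
    then show ?thesis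
      by (rule module_hom_cong) (simp_all add: pq(3) module_A)
  qed
  have rel: "lin_ext R (tensor_power R A m) ?g s = \<zero>\<^bsub>tensor_power R A m\<^esub>"
    if "s \<in> tensor_power_rels R A n" for s
    using multilinear_iff_tensor_power_rels[OF tensor_power_is_module g] ml that by blast
  note pm = presented_map_hom[where S = "tensor_power_rels R A n" and T = "tensor_power_rels R A m",
      OF R_cring tensor_power_rels_closed tensor_power_rels_closed fp rel[unfolded tensor_power_def],
      simplified]
  show ?hom using pm(1) by (simp add: Bsym_def tensor_power_def)
  show "fmap (Bsym R A) n m \<alpha> (tensor_class n a) = tensor_class m (fibre_products A m \<alpha> a)"
    if "a \<in> tensor_power_gens A n"
    using pm(2)[OF that] by (simp add: Bsym_def)
qed


lemma fibre_products_id: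
  assumes "a \<in> tensor_power_gens A n"
  shows "fibre_products A n (dS_id n) a = a"
  using assms tensor_power_gens_nth[OF assms]
  by (auto simp: fibre_products_eq dS_id_def fun_eq_iff tensor_power_gens_def PiE_def extensional_def)

text \<open>
  Composition in \<open>\<Delta>S\<close> concatenates fibres, and multiplying along a concatenation is the same as
  multiplying the partial products, by associativity.
\<close>

lemma fibre_products_comp:
  assumes \<alpha>: "\<alpha> \<in> dS_hom n m" and \<beta>: "\<beta> \<in> dS_hom m l" and a: "a \<in> tensor_power_gens A n"
  shows "fibre_products A l (dS_comp n l \<beta> \<alpha>) a = fibre_products A l \<beta> (fibre_products A m \<alpha> a)"
proof (rule ext)
  fix i
  have "list_prod A a (concat (map (snd \<alpha>) (snd \<beta> i))) = list_prod A (fibre_products A m \<alpha> a) (snd \<beta> i)"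
    if i: "i \<le> l"
  proof -
    have m: "j \<le> m" if "j \<in> set (snd \<beta> i)" for j using that dS_homD(3)[OF \<beta> i] by simp
    have "list_prod A a (concat (map (snd \<alpha>) (snd \<beta> i)))
        = list_prod A (\<lambda>j. list_prod A a (snd \<alpha> j)) (snd \<beta> i)"
      by (rule list_prod_concat) (use m dS_homD(3)[OF \<alpha>] tensor_power_gens_nth[OF a] in auto)
    also have "\<dots> = list_prod A (fibre_products A m \<alpha> a) (snd \<beta> i)"
      by (rule list_prod_cong) (use m in \<open>simp add: fibre_products_eq\<close>)
    finally show ?thesis .
  qed
  then show "fibre_products A l (dS_comp n l \<beta> \<alpha>) a i = fibre_products A l \<beta> (fibre_products A m \<alpha> a) i"
    by (simp add: fibre_products_eq[of l] dS_comp_def)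
qed

lemma Bsym_covariant: "covariant_functor R (Bsym R A)"
  unfolding covariant_functor_def Bsym_fobj
proof (intro conjI allI ballI)
  show "module R (tensor_power R A n)" for n by (rule tensor_power_is_module)
  show "fmap (Bsym R A) n m \<alpha> \<in> module_hom R (tensor_power R A n) (tensor_power R A m)"
    if "\<alpha> \<in> dS_hom n m" for n m \<alpha> by (rule Bsym_fmap(1)[OF that])
next
  fix n y assume y: "y \<in> carrier (tensor_power R A n)"
  have i: "(\<lambda>y. y) \<in> module_hom R (tensor_power R A n) (tensor_power R A n)"
    by (rule module_homI) auto
  show "fmap (Bsym R A) n n (dS_id n) y = y"
    by (rule tensor_power_hom_eq[OF tensor_power_is_module Bsym_fmap(1)[OF dS_id_hom] i _ y])
      (simp add: Bsym_fmap(2)[OF dS_id_hom] fibre_products_id)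
next
  fix n m l \<alpha> \<beta> y
  assume \<alpha>: "\<alpha> \<in> dS_hom n m" and \<beta>: "\<beta> \<in> dS_hom m l" and y: "y \<in> carrier (tensor_power R A n)"
  note c = dS_comp_hom[OF \<alpha> \<beta>]
  show "fmap (Bsym R A) n l (dS_comp n l \<beta> \<alpha>) y = fmap (Bsym R A) m l \<beta> (fmap (Bsym R A) n m \<alpha> y)"
    by (rule tensor_power_hom_eq[OF tensor_power_is_module Bsym_fmap(1)[OF c]
          module_hom_comp[OF Bsym_fmap(1)[OF \<alpha>] Bsym_fmap(1)[OF \<beta>]] _ y])
      (simp add: Bsym_fmap(2)[OF c] Bsym_fmap(2)[OF \<alpha>] Bsym_fmap(2)[OF \<beta>]
        fibre_products_closed[OF \<alpha>] fibre_products_comp[OF \<alpha> \<beta>])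
qed

end

section \<open>Tensor products of functors\<close>

lemma contravariant_functorD:
  assumes "contravariant_functor R G"
  shows "module R (fobj G n)"
    and "\<alpha> \<in> dS_hom n m \<Longrightarrow> fmap G n m \<alpha> \<in> module_hom R (fobj G m) (fobj G n)"
  using assms by (auto simp: contravariant_functor_def)

lemma covariant_functorD:
  assumes "covariant_functor R F"
  shows "module R (fobj F n)"
    and "\<alpha> \<in> dS_hom n m \<Longrightarrow> fmap F n m \<alpha> \<in> module_hom R (fobj F n) (fobj F m)"
  using assms by (auto simp: covariant_functor_def)

text \<open>
  Bilinearity, together with compatibility with the morphisms of \<open>\<Delta>S\<close>: the maps on generators that
  factor through \<open>G \<otimes>\<^bsub>\<Delta>S\<^esub> F\<close>.
\<close>

definition dS_balanced ::
  "('k, 'r) ring_scheme \<Rightarrow> ('k, 'm) dS_functor \<Rightarrow> ('k, 'y) dS_functor \<Rightarrow> ('k, 'n, 't) module_scheme \<Rightarrow>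
   (nat \<times> 'm \<times> 'y \<Rightarrow> 'n) \<Rightarrow> bool"
  where "dS_balanced R G F M g \<longleftrightarrow>
    (\<forall>n. \<forall>y\<in>carrier (fobj F n). (\<lambda>x. g (n, x, y)) \<in> module_hom R (fobj G n) M) \<and>
    (\<forall>n. \<forall>x\<in>carrier (fobj G n). (\<lambda>y. g (n, x, y)) \<in> module_hom R (fobj F n) M) \<and>
    (\<forall>n m. \<forall>\<alpha>\<in>dS_hom n m. \<forall>x\<in>carrier (fobj G m). \<forall>y\<in>carrier (fobj F n).
       g (n, fmap G n m \<alpha> x, y) = g (m, x, fmap F n m \<alpha> y))"

lemma dS_balancedI:
  assumes "\<And>n y. y \<in> carrier (fobj F n) \<Longrightarrow> (\<lambda>x. g (n, x, y)) \<in> module_hom R (fobj G n) M"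
    and "\<And>n x. x \<in> carrier (fobj G n) \<Longrightarrow> (\<lambda>y. g (n, x, y)) \<in> module_hom R (fobj F n) M"
    and "\<And>n m \<alpha> x y. \<lbrakk>\<alpha> \<in> dS_hom n m; x \<in> carrier (fobj G m); y \<in> carrier (fobj F n)\<rbrakk> \<Longrightarrow>
       g (n, fmap G n m \<alpha> x, y) = g (m, x, fmap F n m \<alpha> y)"
  shows "dS_balanced R G F M g"
  unfolding dS_balanced_def using assms by blast

lemma dS_balancedD:
  assumes "dS_balanced R G F M g"
  shows "y \<in> carrier (fobj F n) \<Longrightarrow> (\<lambda>x. g (n, x, y)) \<in> module_hom R (fobj G n) M"
    and "x \<in> carrier (fobj G n) \<Longrightarrow> (\<lambda>y. g (n, x, y)) \<in> module_hom R (fobj F n) M"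
    and "\<lbrakk>\<alpha> \<in> dS_hom n m; x \<in> carrier (fobj G m); y \<in> carrier (fobj F n)\<rbrakk> \<Longrightarrow>
       g (n, fmap G n m \<alpha> x, y) = g (m, x, fmap F n m \<alpha> y)"
  using assms unfolding dS_balanced_def by blast+

lemma dS_balanced_closed:
  "dS_balanced R G F M g \<Longrightarrow> g \<in> tensor_gens G F \<rightarrow> carrier M"
  by (auto simp: tensor_gens_def dest: dS_balancedD(1) intro: module_homD(1))

lemma dS_balanced_comp:
  assumes "dS_balanced R G F M g" "h \<in> module_hom R M M'"
  shows "dS_balanced R G F M' (\<lambda>t. h (g t))"
  by (rule dS_balancedI)
    (simp_all only: dS_balancedD(3)[OF assms(1)] module_hom_comp[OF dS_balancedD(1)[OF assms(1)] assms(2)]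
      module_hom_comp[OF dS_balancedD(2)[OF assms(1)] assms(2)])

lemma dS_balanced_nat_trans:
  assumes g: "dS_balanced R H F M g" and \<eta>: "contra_nat_trans R G H \<eta>"
    and G: "contravariant_functor R G" and F: "covariant_functor R F"
  shows "dS_balanced R G F M (\<lambda>(n, x, y). g (n, \<eta> n x, y))"
proof -
  have h: "\<eta> n \<in> module_hom R (fobj G n) (fobj H n)" for n
    using \<eta> by (auto simp: contra_nat_trans_def)
  have nat: "\<eta> n (fmap G n m \<alpha> x) = fmap H n m \<alpha> (\<eta> m x)"
    if "\<alpha> \<in> dS_hom n m" "x \<in> carrier (fobj G m)" for n m \<alpha> x
    using \<eta> that by (auto simp: contra_nat_trans_def)
  show ?thesis
    by (rule dS_balancedI)
      (simp_all add: nat dS_balancedD(2,3)[OF g] module_homD(1)[OF h] module_hom_comp[OF h dS_balancedD(1)[OF g]])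
qed

context
  fixes R :: "('k, 'r) ring_scheme" and G :: "('k, 'm) dS_functor" and F :: "('k, 'y) dS_functor"
  assumes R: "cring R" and G: "contravariant_functor R G" and F: "covariant_functor R F"
begin

lemma tensor_rels_closed: "tensor_rels R G F \<subseteq> carrier (free_module R (tensor_gens G F))"
proof -
  interpret L: module R "free_module R (tensor_gens G F)"
    by (rule free_module_is_module[OF R])
  have am: "abelian_monoid (fobj G n)" "abelian_monoid (fobj F n)" for n
    using contravariant_functorD(1)[OF G, of n] covariant_functorD(1)[OF F, of n]
    by (auto simp: module_def abelian_group_def)
  have t: "(n, x, y) \<in> tensor_gens G F \<longleftrightarrow> x \<in> carrier (fobj G n) \<and> y \<in> carrier (fobj F n)" for n x y
    by (simp add: tensor_gens_def)
  show ?thesis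
    unfolding tensor_rels_def Let_def
    by (auto intro!: L.minus_closed L.a_closed L.smult_closed basis_elt_closed[OF R]
        simp: t abelian_monoid.a_closed[OF am(1)] abelian_monoid.a_closed[OF am(2)]
        module.smult_closed[OF contravariant_functorD(1)[OF G]]
        module.smult_closed[OF covariant_functorD(1)[OF F]]
        module_homD(1)[OF contravariant_functorD(2)[OF G]]
        module_homD(1)[OF covariant_functorD(2)[OF F]])
qed

text \<open>
  The five families of relators are, in order, additivity and homogeneity in each argument and
  compatibility with morphisms.  As for tensor powers, one direction defines maps out of the tensor
  product and the other gives the identities between pure tensors.
\<close>

lemma dS_balanced_iff_tensor_rels:
  assumes M: "module R M" and g: "g \<in> tensor_gens G F \<rightarrow> carrier M"
  shows "(\<forall>s\<in>tensor_rels R G F. lin_ext R M g s = \<zero>\<^bsub>M\<^esub>) \<longleftrightarrow> dS_balanced R G F M g"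
proof -
  let ?L = "free_module R (tensor_gens G F)"
  let ?e = "basis_elt R :: nat \<times> 'm \<times> 'y \<Rightarrow> _"
  interpret L: module R ?L by (rule free_module_is_module[OF R])
  note l = lin_ext_hom[OF M g]
  note GM = contravariant_functorD(1)[OF G] and FM = covariant_functorD(1)[OF F]
  note Gh = module_homD(1)[OF contravariant_functorD(2)[OF G]]
    and Fh = module_homD(1)[OF covariant_functorD(2)[OF F]]
  have am: "abelian_monoid (fobj G n)" "abelian_monoid (fobj F n)" for n
    using GM[of n] FM[of n] by (auto simp: module_def abelian_group_def)
  have t: "(n, x, y) \<in> tensor_gens G F \<longleftrightarrow> x \<in> carrier (fobj G n) \<and> y \<in> carrier (fobj F n)" for n x y
    by (simp add: tensor_gens_def)
  have e: "?e a \<in> carrier ?L" if "a \<in> tensor_gens G F" for a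
    by (rule basis_elt_closed[OF R that])
  have b: "lin_ext R M g (?e a) = g a" if "a \<in> tensor_gens G F" for a
    by (rule lin_ext_basis[OF M]) (use g that in auto)
  note simps = module_hom_diff_zero_iff[OF L.module_axioms M l] e b t module_homD(2,3)[OF l]
    abelian_monoid.a_closed[OF am(1)] abelian_monoid.a_closed[OF am(2)]
    module.smult_closed[OF GM] module.smult_closed[OF FM] Gh Fh
  have 1: "lin_ext R M g (?e (n, x \<oplus>\<^bsub>fobj G n\<^esub> x', y) \<ominus>\<^bsub>?L\<^esub> (?e (n, x, y) \<oplus>\<^bsub>?L\<^esub> ?e (n, x', y))) = \<zero>\<^bsub>M\<^esub>
      \<longleftrightarrow> g (n, x \<oplus>\<^bsub>fobj G n\<^esub> x', y) = g (n, x, y) \<oplus>\<^bsub>M\<^esub> g (n, x', y)"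
    if "x \<in> carrier (fobj G n)" "x' \<in> carrier (fobj G n)" "y \<in> carrier (fobj F n)" for n x x' y
    using that by (simp add: simps)
  have 2: "lin_ext R M g (?e (n, x, y \<oplus>\<^bsub>fobj F n\<^esub> y') \<ominus>\<^bsub>?L\<^esub> (?e (n, x, y) \<oplus>\<^bsub>?L\<^esub> ?e (n, x, y'))) = \<zero>\<^bsub>M\<^esub>
      \<longleftrightarrow> g (n, x, y \<oplus>\<^bsub>fobj F n\<^esub> y') = g (n, x, y) \<oplus>\<^bsub>M\<^esub> g (n, x, y')"
    if "x \<in> carrier (fobj G n)" "y \<in> carrier (fobj F n)" "y' \<in> carrier (fobj F n)" for n x y y'
    using that by (simp add: simps)
  have 3: "lin_ext R M g (?e (n, r \<odot>\<^bsub>fobj G n\<^esub> x, y) \<ominus>\<^bsub>?L\<^esub> r \<odot>\<^bsub>?L\<^esub> ?e (n, x, y)) = \<zero>\<^bsub>M\<^esub>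
      \<longleftrightarrow> g (n, r \<odot>\<^bsub>fobj G n\<^esub> x, y) = r \<odot>\<^bsub>M\<^esub> g (n, x, y)"
    if "r \<in> carrier R" "x \<in> carrier (fobj G n)" "y \<in> carrier (fobj F n)" for n r x y
    using that by (simp add: simps)
  have 4: "lin_ext R M g (?e (n, x, r \<odot>\<^bsub>fobj F n\<^esub> y) \<ominus>\<^bsub>?L\<^esub> r \<odot>\<^bsub>?L\<^esub> ?e (n, x, y)) = \<zero>\<^bsub>M\<^esub>
      \<longleftrightarrow> g (n, x, r \<odot>\<^bsub>fobj F n\<^esub> y) = r \<odot>\<^bsub>M\<^esub> g (n, x, y)"
    if "r \<in> carrier R" "x \<in> carrier (fobj G n)" "y \<in> carrier (fobj F n)" for n r x y
    using that by (simp add: simps)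
  have 5: "lin_ext R M g (?e (n, fmap G n m \<alpha> x, y) \<ominus>\<^bsub>?L\<^esub> ?e (m, x, fmap F n m \<alpha> y)) = \<zero>\<^bsub>M\<^esub>
      \<longleftrightarrow> g (n, fmap G n m \<alpha> x, y) = g (m, x, fmap F n m \<alpha> y)"
    if "\<alpha> \<in> dS_hom n m" "x \<in> carrier (fobj G m)" "y \<in> carrier (fobj F n)" for n m \<alpha> x y
    using that by (simp add: simps)
  have c: "g (n, x, y) \<in> carrier M" if "x \<in> carrier (fobj G n)" "y \<in> carrier (fobj F n)" for n x y
    using g that by (auto simp: t)
  show ?thesis
  proof
    assume "\<forall>s\<in>tensor_rels R G F. lin_ext R M g s = \<zero>\<^bsub>M\<^esub>"
    then have rel: "lin_ext R M g s = \<zero>\<^bsub>M\<^esub>" if "s \<in> tensor_rels R G F" for s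
      using that by blast
    show "dS_balanced R G F M g"
    proof (rule dS_balancedI)
      fix n y assume y: "y \<in> carrier (fobj F n)"
      show "(\<lambda>x. g (n, x, y)) \<in> module_hom R (fobj G n) M"
      proof (rule module_homI)
        fix x x' assume h: "x \<in> carrier (fobj G n)" "x' \<in> carrier (fobj G n)"
        show "g (n, x \<oplus>\<^bsub>fobj G n\<^esub> x', y) = g (n, x, y) \<oplus>\<^bsub>M\<^esub> g (n, x', y)"
          unfolding 1[OF h y, symmetric]
          by (rule rel, unfold tensor_rels_def Let_def, rule UnI1, rule UnI1, rule UnI1, rule UnI1) (use h y in blast)
      next
        fix r x assume h: "r \<in> carrier R" "x \<in> carrier (fobj G n)"
        show "g (n, r \<odot>\<^bsub>fobj G n\<^esub> x, y) = r \<odot>\<^bsub>M\<^esub> g (n, x, y)"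
          unfolding 3[OF h y, symmetric]
          by (rule rel, unfold tensor_rels_def Let_def, rule UnI1, rule UnI1, rule UnI2) (use h y in blast)
      qed (rule c[OF _ y])
    next
      fix n x assume x: "x \<in> carrier (fobj G n)"
      show "(\<lambda>y. g (n, x, y)) \<in> module_hom R (fobj F n) M"
      proof (rule module_homI)
        fix y y' assume h: "y \<in> carrier (fobj F n)" "y' \<in> carrier (fobj F n)"
        show "g (n, x, y \<oplus>\<^bsub>fobj F n\<^esub> y') = g (n, x, y) \<oplus>\<^bsub>M\<^esub> g (n, x, y')"
          unfolding 2[OF x h, symmetric]
          by (rule rel, unfold tensor_rels_def Let_def, rule UnI1, rule UnI1, rule UnI1, rule UnI2) (use h x in blast)
      next
        fix r y assume h: "r \<in> carrier R" "y \<in> carrier (fobj F n)"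
        show "g (n, x, r \<odot>\<^bsub>fobj F n\<^esub> y) = r \<odot>\<^bsub>M\<^esub> g (n, x, y)"
          unfolding 4[OF h(1) x h(2), symmetric]
          by (rule rel, unfold tensor_rels_def Let_def, rule UnI1, rule UnI2) (use h x in blast)
      qed (rule c[OF x])
    next
      fix n m \<alpha> x y assume h: "\<alpha> \<in> dS_hom n m" "x \<in> carrier (fobj G m)" "y \<in> carrier (fobj F n)"
      show "g (n, fmap G n m \<alpha> x, y) = g (m, x, fmap F n m \<alpha> y)"
        unfolding 5[OF h, symmetric]
        by (rule rel, unfold tensor_rels_def Let_def, rule UnI2) (use h in blast)
    qed
  next
    assume bal: "dS_balanced R G F M g"
    show "\<forall>s\<in>tensor_rels R G F. lin_ext R M g s = \<zero>\<^bsub>M\<^esub>"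
    proof
      fix s assume "s \<in> tensor_rels R G F"
      then show "lin_ext R M g s = \<zero>\<^bsub>M\<^esub>"
        unfolding tensor_rels_def Let_def
      proof (elim UnE CollectE exE conjE)
        fix n x x' y assume "x \<in> carrier (fobj G n)" "x' \<in> carrier (fobj G n)" "y \<in> carrier (fobj F n)"
          "s = ?e (n, x \<oplus>\<^bsub>fobj G n\<^esub> x', y) \<ominus>\<^bsub>?L\<^esub> (?e (n, x, y) \<oplus>\<^bsub>?L\<^esub> ?e (n, x', y))"
        then show "lin_ext R M g s = \<zero>\<^bsub>M\<^esub>" using 1 module_homD(2)[OF dS_balancedD(1)[OF bal]] by simp
      next
        fix n x y y' assume "x \<in> carrier (fobj G n)" "y \<in> carrier (fobj F n)" "y' \<in> carrier (fobj F n)"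
          "s = ?e (n, x, y \<oplus>\<^bsub>fobj F n\<^esub> y') \<ominus>\<^bsub>?L\<^esub> (?e (n, x, y) \<oplus>\<^bsub>?L\<^esub> ?e (n, x, y'))"
        then show "lin_ext R M g s = \<zero>\<^bsub>M\<^esub>" using 2 module_homD(2)[OF dS_balancedD(2)[OF bal]] by simp
      next
        fix n r x y assume "r \<in> carrier R" "x \<in> carrier (fobj G n)" "y \<in> carrier (fobj F n)"
          "s = ?e (n, r \<odot>\<^bsub>fobj G n\<^esub> x, y) \<ominus>\<^bsub>?L\<^esub> r \<odot>\<^bsub>?L\<^esub> ?e (n, x, y)"
        then show "lin_ext R M g s = \<zero>\<^bsub>M\<^esub>" using 3 module_homD(3)[OF dS_balancedD(1)[OF bal]] by simp
      next
        fix n r x y assume "r \<in> carrier R" "x \<in> carrier (fobj G n)" "y \<in> carrier (fobj F n)"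
          "s = ?e (n, x, r \<odot>\<^bsub>fobj F n\<^esub> y) \<ominus>\<^bsub>?L\<^esub> r \<odot>\<^bsub>?L\<^esub> ?e (n, x, y)"
        then show "lin_ext R M g s = \<zero>\<^bsub>M\<^esub>" using 4 module_homD(3)[OF dS_balancedD(2)[OF bal]] by simp
      next
        fix n m \<alpha> x y assume "\<alpha> \<in> dS_hom n m" "x \<in> carrier (fobj G m)" "y \<in> carrier (fobj F n)"
          "s = ?e (n, fmap G n m \<alpha> x, y) \<ominus>\<^bsub>?L\<^esub> ?e (m, x, fmap F n m \<alpha> y)"
        then show "lin_ext R M g s = \<zero>\<^bsub>M\<^esub>" using 5 dS_balancedD(3)[OF bal] by simp
      qed
    qed
  qed
qed

abbreviation pure_tensor :: "nat \<times> 'm \<times> 'y \<Rightarrow> (nat \<times> 'm \<times> 'y \<Rightarrow> 'k) set"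
  where "pure_tensor \<equiv> presented_class R (tensor_gens G F) (tensor_rels R G F)"

lemma tensor_dS_is_module: "module R (tensor_dS R G F)"
  unfolding tensor_dS_def by (rule presented_is_module[OF R tensor_rels_closed])

lemma pure_tensor_balanced: "dS_balanced R G F (tensor_dS R G F) pure_tensor"
proof -
  have "pure_tensor \<in> tensor_gens G F \<rightarrow> carrier (tensor_dS R G F)"
    unfolding tensor_dS_def using presented_class_closed[OF R tensor_rels_closed] by blast
  from dS_balanced_iff_tensor_rels[OF tensor_dS_is_module this] show ?thesis
    using lin_ext_presented_class[OF R tensor_rels_closed] unfolding tensor_dS_def by blast
qed

lemma tensor_dS_lift:
  assumes M: "module R M" and g: "dS_balanced R G F M g"
  obtains h where "h \<in> module_hom R (tensor_dS R G F) M"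
    and "\<And>t. t \<in> tensor_gens G F \<Longrightarrow> h (pure_tensor t) = g t"
proof -
  note gc = dS_balanced_closed[OF g]
  have "lin_ext R M g s = \<zero>\<^bsub>M\<^esub>" if "s \<in> tensor_rels R G F" for s
    using dS_balanced_iff_tensor_rels[OF M gc] g that by blast
  from presented_module_lift[OF R tensor_rels_closed M gc this]
  show thesis using that unfolding tensor_dS_def by blast
qed

lemma tensor_dS_hom_eq:
  assumes "module R M" "f \<in> module_hom R (tensor_dS R G F) M" "g \<in> module_hom R (tensor_dS R G F) M"
    and "\<And>t. t \<in> tensor_gens G F \<Longrightarrow> f (pure_tensor t) = g (pure_tensor t)"
    and "c \<in> carrier (tensor_dS R G F)"
  shows "f c = g c"
  using presented_module_hom_eq[OF R tensor_rels_closed assms(1)] assms(2-5)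
  unfolding tensor_dS_def by blast

end

lemma tensor_dS_map_hom:
  fixes R :: "('k, 'r) ring_scheme" and G :: "('k, 'm) dS_functor" and H :: "('k, 'n) dS_functor"
    and F :: "('k, 'y) dS_functor"
  assumes R: "cring R" and G: "contravariant_functor R G" and H: "contravariant_functor R H"
    and F: "covariant_functor R F" and \<eta>: "contra_nat_trans R G H \<eta>"
  shows "tensor_dS_map R H F \<eta> \<in> module_hom R (tensor_dS R G F) (tensor_dS R H F)"
    and "\<lbrakk>x \<in> carrier (fobj G n); y \<in> carrier (fobj F n)\<rbrakk> \<Longrightarrow>
      tensor_dS_map R H F \<eta> (presented_class R (tensor_gens G F) (tensor_rels R G F) (n, x, y)) =
      presented_class R (tensor_gens H F) (tensor_rels R H F) (n, \<eta> n x, y)"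
proof -
  let ?h = "\<lambda>(n, x, y). (n, \<eta> n x, y)"
  let ?g = "\<lambda>t. presented_class R (tensor_gens H F) (tensor_rels R H F) (?h t)"
  have "dS_balanced R G F (tensor_dS R H F) ?g"
    using dS_balanced_nat_trans[OF pure_tensor_balanced[OF R H F] \<eta> G F]
    by (simp add: case_prod_unfold)
  then have rel: "lin_ext R (tensor_dS R H F) ?g s = \<zero>\<^bsub>tensor_dS R H F\<^esub>" if "s \<in> tensor_rels R G F" for s
    using dS_balanced_iff_tensor_rels[OF R G F tensor_dS_is_module[OF R H F] dS_balanced_closed] that by blast
  have h: "?h \<in> tensor_gens G F \<rightarrow> tensor_gens H F"
    using \<eta> by (auto simp: tensor_gens_def contra_nat_trans_def module_hom_def)
  note pm = presented_map_hom[where S = "tensor_rels R G F" and T = "tensor_rels R H F",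
      OF R tensor_rels_closed[OF R G F] tensor_rels_closed[OF R H F] h rel[unfolded tensor_dS_def]]
  show "tensor_dS_map R H F \<eta> \<in> module_hom R (tensor_dS R G F) (tensor_dS R H F)"
    using pm(1) unfolding tensor_dS_map_def tensor_dS_def by blast
  show "tensor_dS_map R H F \<eta> (presented_class R (tensor_gens G F) (tensor_rels R G F) (n, x, y)) =
      presented_class R (tensor_gens H F) (tensor_rels R H F) (n, \<eta> n x, y)"
    if "x \<in> carrier (fobj G n)" "y \<in> carrier (fobj F n)"
    using pm(2)[of "(n, x, y)"] that unfolding tensor_dS_map_def by (simp add: tensor_gens_def)
qed

section \<open>Tor in degree zero\<close>

text \<open>
  Right exactness of the tensor product.  Write \<open>\<tau>(n, x, y)\<close> for the class of \<open>x \<otimes> y\<close> in the cokernel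
  of \<open>P 1 \<otimes> F \<rightarrow> P 0 \<otimes> F\<close>.  An \<open>x\<close> with \<open>\<epsilon> x = 0\<close> is a boundary, so \<open>\<tau>\<close> depends on \<open>x\<close> only through
  \<open>\<epsilon> x\<close>.  Hence \<open>z \<otimes> y \<mapsto> \<tau>(n, x, y)\<close>, with any \<open>x\<close> such that \<open>\<epsilon> x = z\<close>, is balanced, and it is
  inverse to the map induced by \<open>\<epsilon>\<close>.
\<close>

theorem Tor_dS_0:
  fixes R :: "('k, 'r) ring_scheme" and G :: "('k, 'g) dS_functor" and F :: "('k, 'y) dS_functor"
    and P :: "nat \<Rightarrow> ('k, 'm) dS_functor"
  assumes R: "cring R" and G: "contravariant_functor R G" and F: "covariant_functor R F"
    and res: "projective_resolution R G P d \<epsilon>"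
  shows "module_isomorphic R (Tor_dS R P d F 0) (tensor_dS R G F)"
proof -
  have P: "contravariant_functor R (P q)" for q
    using res by (simp add: projective_resolution_def projective_functor_def)
  have d: "contra_nat_trans R (P 1) (P 0) (d 0)"
    using res by (simp add: projective_resolution_def)
  have \<epsilon>: "contra_nat_trans R (P 0) G \<epsilon>"
    using res by (simp add: projective_resolution_def)
  have sur: "\<epsilon> n ` carrier (fobj (P 0) n) = carrier (fobj G n)" for n
    using res by (simp add: projective_resolution_def)
  have ex: "d 0 n ` carrier (fobj (P 1) n) = {x \<in> carrier (fobj (P 0) n). \<epsilon> n x = \<zero>\<^bsub>fobj G n\<^esub>}" for n
    using res by (simp add: projective_resolution_def)
  have \<epsilon>h: "\<epsilon> n \<in> module_hom R (fobj (P 0) n) (fobj G n)" for n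
    using \<epsilon> by (auto simp: contra_nat_trans_def)
  note Pm = contravariant_functorD(1)[OF P] and Gm = contravariant_functorD(1)[OF G]
    and Fm = covariant_functorD(1)[OF F]
  let ?C = "tensor_dS R (P 0) F" and ?C1 = "tensor_dS R (P 1) F" and ?T = "tensor_dS R G F"
  let ?D = "tensor_dS_map R (P 0) F (d 0)"
  let ?B = "?D ` carrier ?C1"
  let ?p = "presented_class R (tensor_gens (P 0) F) (tensor_rels R (P 0) F)"
  let ?p1 = "presented_class R (tensor_gens (P 1) F) (tensor_rels R (P 1) F)"
  let ?t = "presented_class R (tensor_gens G F) (tensor_rels R G F)"
  have Tor: "Tor_dS R P d F 0 = quot_module ?C ?B"
    by (simp add: Tor_dS_def homology_module_def cycles_def)
  note Cm = tensor_dS_is_module[OF R P F, of 0] and C1m = tensor_dS_is_module[OF R P F, of 1]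
    and Tm = tensor_dS_is_module[OF R G F]
  note D = tensor_dS_map_hom[OF R P P F d]
  have B: "submodule ?B R ?C" by (rule submodule_image[OF C1m Cm D(1)])
  note Qm = quot_module_is_module[OF Cm B]
  define \<tau> where "\<tau> t = ?B +>\<^bsub>?C\<^esub> ?p t" for t
  have \<tau>: "dS_balanced R (P 0) F (quot_module ?C ?B) \<tau>"
    unfolding \<tau>_def by (rule dS_balanced_comp[OF pure_tensor_balanced[OF R P F] coset_hom[OF Cm B]])
  have pc: "?p (n, x, y) \<in> carrier ?C" if "x \<in> carrier (fobj (P 0) n)" "y \<in> carrier (fobj F n)" for n x y
    using dS_balanced_closed[OF pure_tensor_balanced[OF R P F]] that by (auto simp: tensor_gens_def)
  have \<tau>_ker: "\<tau> (n, x, y) = \<zero>\<^bsub>quot_module ?C ?B\<^esub>"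
    if x: "x \<in> carrier (fobj (P 0) n)" "\<epsilon> n x = \<zero>\<^bsub>fobj G n\<^esub>" and y: "y \<in> carrier (fobj F n)" for n x y
  proof -
    obtain z where z: "z \<in> carrier (fobj (P 1) n)" "x = d 0 n z" using ex[of n] x by blast
    have "?p (n, x, y) = ?D (?p1 (n, z, y))" using D(2)[OF z(1) y] z(2) by simp
    moreover have "?p1 (n, z, y) \<in> carrier ?C1"
      using dS_balanced_closed[OF pure_tensor_balanced[OF R P F]] z(1) y by (auto simp: tensor_gens_def)
    ultimately have "?p (n, x, y) \<in> ?B" by blast
    then show ?thesis
      using coset_eq_zero_iff[OF Cm B pc[OF x(1) y]] by (simp add: \<tau>_def quot_module_sel)
  qed
  have \<tau>_eq: "\<tau> (n, x, y) = \<tau> (n, x', y)"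
    if x: "x \<in> carrier (fobj (P 0) n)" "x' \<in> carrier (fobj (P 0) n)" "\<epsilon> n x = \<epsilon> n x'"
      and y: "y \<in> carrier (fobj F n)" for n x x' y
  proof -
    interpret Pn: module R "fobj (P 0) n" by (rule Pm)
    have "\<epsilon> n (x \<ominus>\<^bsub>fobj (P 0) n\<^esub> x') = \<zero>\<^bsub>fobj G n\<^esub>"
      using module_hom_diff_zero_iff[OF Pm Gm \<epsilon>h x(1,2)] x(3) by simp
    then have "\<tau> (n, x \<ominus>\<^bsub>fobj (P 0) n\<^esub> x', y) = \<zero>\<^bsub>quot_module ?C ?B\<^esub>"
      using x y by (intro \<tau>_ker) auto
    then show ?thesis using module_hom_diff_zero_iff[OF Pm Qm dS_balancedD(1)[OF \<tau> y] x(1,2)] by simp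
  qed
  \<comment> \<open>A section of the augmentation.  It need be neither linear nor natural: \<open>\<tau>\<close> does not see the
    difference.\<close>
  define s where "s n z = (SOME x. x \<in> carrier (fobj (P 0) n) \<and> \<epsilon> n x = z)" for n z
  have s: "s n z \<in> carrier (fobj (P 0) n)" "\<epsilon> n (s n z) = z" if "z \<in> carrier (fobj G n)" for n z
  proof -
    have "z \<in> \<epsilon> n ` carrier (fobj (P 0) n)" using that by (simp only: sur)
    then have "\<exists>x. x \<in> carrier (fobj (P 0) n) \<and> \<epsilon> n x = z" by force
    from someI_ex[OF this] show "s n z \<in> carrier (fobj (P 0) n)" "\<epsilon> n (s n z) = z" by (auto simp: s_def)
  qed
  have \<tau>_s: "\<tau> (n, s n (\<epsilon> n x), y) = \<tau> (n, x, y)"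
    if "x \<in> carrier (fobj (P 0) n)" "y \<in> carrier (fobj F n)" for n x y
    using that s[OF module_homD(1)[OF \<epsilon>h that(1)]] by (intro \<tau>_eq) auto
  have bal: "dS_balanced R G F (quot_module ?C ?B) (\<lambda>(n, z, y). \<tau> (n, s n z, y))"
  proof (rule dS_balancedI)
    fix n y assume y: "y \<in> carrier (fobj F n)"
    interpret Gn: module R "fobj G n" by (rule Gm)
    interpret Pn: module R "fobj (P 0) n" by (rule Pm)
    note h = module_homD[OF dS_balancedD(1)[OF \<tau> y]]
    show "(\<lambda>z. case (n, z, y) of (n, z, y) \<Rightarrow> \<tau> (n, s n z, y)) \<in> module_hom R (fobj G n) (quot_module ?C ?B)"
    proof (rule module_homI, unfold prod.case)
      show "\<tau> (n, s n z, y) \<in> carrier (quot_module ?C ?B)" if "z \<in> carrier (fobj G n)" for z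
        by (rule h(1)[OF s(1)[OF that]])
      show "\<tau> (n, s n (z \<oplus>\<^bsub>fobj G n\<^esub> z'), y) = \<tau> (n, s n z, y) \<oplus>\<^bsub>quot_module ?C ?B\<^esub> \<tau> (n, s n z', y)"
        if "z \<in> carrier (fobj G n)" "z' \<in> carrier (fobj G n)" for z z'
        unfolding h(2)[OF s(1)[OF that(1)] s(1)[OF that(2)], symmetric]
        using that y by (intro \<tau>_eq) (auto simp: s module_homD(2)[OF \<epsilon>h])
      show "\<tau> (n, s n (r \<odot>\<^bsub>fobj G n\<^esub> z), y) = r \<odot>\<^bsub>quot_module ?C ?B\<^esub> \<tau> (n, s n z, y)"
        if "r \<in> carrier R" "z \<in> carrier (fobj G n)" for r z
        unfolding h(3)[OF that(1) s(1)[OF that(2)], symmetric]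
        using that y by (intro \<tau>_eq) (auto simp: s module_homD(3)[OF \<epsilon>h])
    qed
  next
    fix n z assume "z \<in> carrier (fobj G n)"
    then show "(\<lambda>y. case (n, z, y) of (n, z, y) \<Rightarrow> \<tau> (n, s n z, y)) \<in> module_hom R (fobj F n) (quot_module ?C ?B)"
      using dS_balancedD(2)[OF \<tau> s(1)] by simp
  next
    fix n m \<alpha> z y assume \<alpha>: "\<alpha> \<in> dS_hom n m" and z: "z \<in> carrier (fobj G m)" and y: "y \<in> carrier (fobj F n)"
    note Ph = module_homD(1)[OF contravariant_functorD(2)[OF P \<alpha>]]
    have "\<epsilon> n (fmap (P 0) n m \<alpha> (s m z)) = fmap G n m \<alpha> (\<epsilon> m (s m z))"
      using \<epsilon> \<alpha> s(1)[OF z] by (auto simp: contra_nat_trans_def)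
    then have "\<tau> (n, s n (fmap G n m \<alpha> z), y) = \<tau> (n, fmap (P 0) n m \<alpha> (s m z), y)"
      using \<tau>_s[OF Ph[OF s(1)[OF z]] y] by (simp add: s(2)[OF z])
    also have "\<dots> = \<tau> (m, s m z, fmap F n m \<alpha> y)"
      by (rule dS_balancedD(3)[OF \<tau> \<alpha> s(1)[OF z] y])
    finally show "(case (n, fmap G n m \<alpha> z, y) of (n, z, y) \<Rightarrow> \<tau> (n, s n z, y)) =
        (case (m, z, fmap F n m \<alpha> y) of (n, z, y) \<Rightarrow> \<tau> (n, s n z, y))" by simp
  qed
  obtain \<Psi> where \<Psi>: "\<Psi> \<in> module_hom R ?T (quot_module ?C ?B)"
    and \<Psi>t: "\<And>u. u \<in> tensor_gens G F \<Longrightarrow> \<Psi> (?t u) = (case u of (n, z, y) \<Rightarrow> \<tau> (n, s n z, y))"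
    using tensor_dS_lift[OF R G F Qm bal] by blast
  note E = tensor_dS_map_hom[OF R P G F \<epsilon>]
  let ?E = "tensor_dS_map R G F \<epsilon>"
  \<comment> \<open>In the other direction the augmentation kills boundaries, because \<open>\<epsilon> d = 0\<close>.\<close>
  have ED: "?E (?D c) = \<zero>\<^bsub>?T\<^esub>" if c: "c \<in> carrier ?C1" for c
  proof -
    interpret T: module R ?T by (rule Tm)
    have z: "(\<lambda>c. \<zero>\<^bsub>?T\<^esub>) \<in> module_hom R ?C1 ?T" by (rule module_homI) auto
    show ?thesis
    proof (rule tensor_dS_hom_eq[OF R P F Tm module_hom_comp[OF D(1) E(1)] z _ c])
      fix u assume "u \<in> tensor_gens (P 1) F"
      then obtain n x y where u: "u = (n, x, y)" "x \<in> carrier (fobj (P 1) n)" "y \<in> carrier (fobj F n)"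
        by (auto simp: tensor_gens_def)
      have dx: "d 0 n x \<in> carrier (fobj (P 0) n)" "\<epsilon> n (d 0 n x) = \<zero>\<^bsub>fobj G n\<^esub>"
        using ex[of n] u(2) by blast+
      have "?E (?D (?p1 u)) = ?t (n, \<zero>\<^bsub>fobj G n\<^esub>, y)"
        using D(2)[OF u(2,3)] E(2)[OF dx(1) u(3)] dx(2) by (simp add: u(1))
      also have "\<dots> = \<zero>\<^bsub>?T\<^esub>"
        by (rule module_hom_zero[OF Gm Tm dS_balancedD(1)[OF pure_tensor_balanced[OF R G F] u(3)]])
      finally show "?E (?D (?p1 u)) = \<zero>\<^bsub>?T\<^esub>" .
    qed
  qed
  obtain \<Phi> where \<Phi>: "\<Phi> \<in> module_hom R (quot_module ?C ?B) ?T"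
    and \<Phi>c: "\<And>c. c \<in> carrier ?C \<Longrightarrow> \<Phi> (?B +>\<^bsub>?C\<^esub> c) = ?E c"
    using quot_module_lift[OF Cm B Tm E(1)] ED by blast
  have \<Phi>\<tau>: "\<Phi> (\<tau> (n, x, y)) = ?t (n, \<epsilon> n x, y)"
    if "x \<in> carrier (fobj (P 0) n)" "y \<in> carrier (fobj F n)" for n x y
    using \<Phi>c[OF pc[OF that]] E(2)[OF that] by (simp add: \<tau>_def)
  have \<Psi>\<Phi>: "\<Psi> (\<Phi> w) = w" if w: "w \<in> carrier (quot_module ?C ?B)" for w
  proof -
    obtain c where c: "c \<in> carrier ?C" "w = ?B +>\<^bsub>?C\<^esub> c" by (rule quot_carrierE[OF Cm B w])
    note q = coset_hom[OF Cm B]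
    show ?thesis unfolding c(2)
    proof (rule tensor_dS_hom_eq[OF R P F Qm module_hom_comp[OF q module_hom_comp[OF \<Phi> \<Psi>]] q _ c(1)])
      fix u assume "u \<in> tensor_gens (P 0) F"
      then obtain n x y where u: "u = (n, x, y)" "x \<in> carrier (fobj (P 0) n)" "y \<in> carrier (fobj F n)"
        by (auto simp: tensor_gens_def)
      have "\<Psi> (\<Phi> (\<tau> u)) = \<tau> u"
        using \<Phi>\<tau>[OF u(2,3)] \<Psi>t[of "(n, \<epsilon> n x, y)"] \<tau>_s[OF u(2,3)] u module_homD(1)[OF \<epsilon>h]
        by (simp add: tensor_gens_def)
      then show "\<Psi> (\<Phi> (?B +>\<^bsub>?C\<^esub> ?p u)) = ?B +>\<^bsub>?C\<^esub> ?p u" by (simp add: \<tau>_def)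
    qed
  qed
  have \<Phi>\<Psi>: "\<Phi> (\<Psi> v) = v" if v: "v \<in> carrier ?T" for v
  proof -
    have i: "(\<lambda>v. v) \<in> module_hom R ?T ?T" by (rule module_homI) auto
    show ?thesis
    proof (rule tensor_dS_hom_eq[OF R G F Tm module_hom_comp[OF \<Psi> \<Phi>] i _ v])
      fix u assume u: "u \<in> tensor_gens G F"
      then show "\<Phi> (\<Psi> (?t u)) = ?t u"
        using \<Psi>t[OF u] \<Phi>\<tau>[OF s(1)] s(2) by (auto simp: tensor_gens_def)
    qed
  qed
  show ?thesis unfolding Tor by (rule module_isomorphicI[OF \<Phi> \<Psi> \<Psi>\<Phi> \<Phi>\<Psi>])
qed

section \<open>The constant functor tensored with the symmetric bar construction\<close>

lemma module_isomorphic_trans: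
  assumes "module_isomorphic R L M" "module_isomorphic R M N"
  shows "module_isomorphic R L N"
proof -
  obtain f g where "f \<in> module_hom R L M" "bij_betw f (carrier L) (carrier M)"
    "g \<in> module_hom R M N" "bij_betw g (carrier M) (carrier N)"
    using assms by (auto simp: module_isomorphic_def)
  then have "(\<lambda>x. g (f x)) \<in> module_hom R L N" "bij_betw (\<lambda>x. g (f x)) (carrier L) (carrier N)"
    using module_hom_comp bij_betw_trans[of f _ _ g] by (auto simp: comp_def)
  then show ?thesis by (auto simp: module_isomorphic_def)
qed

lemma regular_module_is_module:
  assumes "cring R"
  shows "module R (regular_module R)"
proof -
  interpret R: cring R by fact
  show ?thesis
  proof (rule moduleI[OF assms])
    show "abelian_group (regular_module R)"
      by (rule abelian_groupI) (auto simp: regular_module_def R.a_ac intro: R.l_neg R.a_inv_closed)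
  qed (auto simp: regular_module_def R.l_distr R.r_distr R.m_assoc)
qed

lemma const_contravariant: "cring R \<Longrightarrow> contravariant_functor R (const_functor R)"
  unfolding contravariant_functor_def const_functor_def
  by (auto simp: regular_module_is_module intro: module_homI)

text \<open>
  The map \<open>[n] \<rightarrow> [0]\<close> with its only fibre ordered as \<open>l\<close>.  Applied to \<open>a\<^sub>0 \<otimes> \<dots> \<otimes> a\<^sub>n\<close> it multiplies
  the factors in the order \<open>l\<close>.
\<close>

definition dS_collapse :: "nat \<Rightarrow> nat list \<Rightarrow> dS_mor"
  where "dS_collapse n l = (\<lambda>i\<in>{..n}. 0, \<lambda>j\<in>{..0}. l)"

lemma dS_collapse_hom: "distinct l \<Longrightarrow> set l = {..n} \<Longrightarrow> dS_collapse n l \<in> dS_hom n 0"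
  by (auto simp: dS_hom_def dS_collapse_def)

context unital_algebra
begin

text \<open>
  Tensoring with the constant functor computes the colimit.  A generator \<open>1 \<otimes> (a\<^sub>0 \<otimes> \<dots> \<otimes> a\<^sub>n)\<close> can be
  moved along any morphism \<open>[n] \<rightarrow> [0]\<close>, so it equals \<open>\<psi>\<close> of the product of the \<open>a\<^sub>i\<close> taken in any
  order (\<open>\<psi>_prod\<close>).  This shows that the colimit is generated by \<open>\<psi>(A)\<close> and, with two orders
  of four factors, that \<open>\<psi>\<close> kills the commutator ideal.  Nothing more is killed, since multiplying all
  the factors modulo the commutator ideal gives a map back.
\<close>

lemma const_tensor_Bsym:
  "module_isomorphic R (tensor_dS R (const_functor R) (Bsym R A))
     (quot_module A (genideal A (commutator_submodule R A)))"
proof -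
  let ?I = "genideal A (commutator_submodule R A)"
  let ?Q = "quot_module A ?I"
  let ?T = "tensor_dS R (const_functor R) (Bsym R A)"
  let ?t = "presented_class R (tensor_gens (const_functor R) (Bsym R A)) (tensor_rels R (const_functor R) (Bsym R A))"
  note I = ideal_submodule[OF commutator_ideal]
  note Qm = quot_module_is_module[OF module_A I]
  note q = coset_hom[OF module_A I]
  note cf = const_contravariant[OF R_cring]
  note Tm = tensor_dS_is_module[OF R_cring cf Bsym_covariant]
  note tb = pure_tensor_balanced[OF R_cring cf Bsym_covariant]
  interpret Q: module R ?Q by (rule Qm)
  have cfo: "fobj (const_functor R) n = regular_module R" "fmap (const_functor R) n m \<alpha> x = x" for n m \<alpha> x
    by (simp_all add: const_functor_def)
  have rm: "carrier (regular_module R) = carrier R" "x \<oplus>\<^bsub>regular_module R\<^esub> y = x \<oplus>\<^bsub>R\<^esub> y"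
    "x \<odot>\<^bsub>regular_module R\<^esub> y = x \<otimes>\<^bsub>R\<^esub> y" for x y
    by (simp_all add: regular_module_def)
  have pc: "list_prod A a l \<in> carrier A" if "a \<in> tensor_power_gens A n" "set l = {..n}" for a n l
    using that tensor_power_gens_nth by auto

  \<comment> \<open>The map back: \<open>\<pi> n\<close> multiplies all factors modulo the ideal.  It is compatible with morphisms
    because a morphism only regroups and permutes the factors.\<close>
  have ex: "\<exists>h. h \<in> module_hom R (tensor_power R A n) ?Q \<and>
      (\<forall>a\<in>tensor_power_gens A n. h (tensor_class n a) = ?I +>\<^bsub>A\<^esub> list_prod A a [0..<Suc n])" for n
  proof -
    let ?g = "\<lambda>a. ?I +>\<^bsub>A\<^esub> list_prod A a [0..<Suc n]"
    have s: "set [0..<Suc n] = {..n}" by auto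
    have g: "?g \<in> tensor_power_gens A n \<rightarrow> carrier ?Q"
      using pc[OF _ s] coset_in_quot[OF module_A I] by blast
    have "(\<lambda>x. ?g (a(i := x))) \<in> module_hom R A ?Q" if a: "a \<in> tensor_power_gens A n" and i: "i \<le> n" for a i
    proof -
      have "i \<in> set [0..<Suc n]" "\<And>j. j \<in> set [0..<Suc n] \<Longrightarrow> a j \<in> carrier A"
        using i tensor_power_gens_nth[OF a] by auto
      then obtain p r where pr: "p \<in> carrier A" "r \<in> carrier A"
        "\<And>x. x \<in> carrier A \<Longrightarrow> list_prod A (a(i := x)) [0..<Suc n] = p \<otimes>\<^bsub>A\<^esub> x \<otimes>\<^bsub>A\<^esub> r"
        using list_prod_update[OF distinct_upt] by blast
      show ?thesis
        by (rule module_hom_cong[OF module_hom_comp[OF two_sided_mult_hom[OF pr(1,2)] q] module_A])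
          (simp only: pr(3))
    qed
    from tensor_power_lift[OF Qm g this] show ?thesis by metis
  qed
  obtain \<pi> where \<pi>: "\<And>n. \<pi> n \<in> module_hom R (tensor_power R A n) ?Q"
    and \<pi>c: "\<And>n a. a \<in> tensor_power_gens A n \<Longrightarrow> \<pi> n (tensor_class n a) = ?I +>\<^bsub>A\<^esub> list_prod A a [0..<Suc n]"
    using ex by metis
  have \<pi>nat: "\<pi> m (fmap (Bsym R A) n m \<alpha> y) = \<pi> n y"
    if \<alpha>: "\<alpha> \<in> dS_hom n m" and y: "y \<in> carrier (tensor_power R A n)" for n m \<alpha> y
  proof (rule tensor_power_hom_eq[OF Qm module_hom_comp[OF Bsym_fmap(1)[OF \<alpha>] \<pi>] \<pi> _ y])
    fix a assume a: "a \<in> tensor_power_gens A n"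
    \<comment> \<open>Multiplying the fibre products of \<open>\<alpha>\<close> is collapsing \<open>[n]\<close> along the composite \<open>[n] \<rightarrow> [m] \<rightarrow> [0]\<close>,
      whose fibre lists \<open>0, \<dots>, n\<close> in some other order.\<close>
    have c: "dS_collapse m [0..<Suc m] \<in> dS_hom m 0" by (rule dS_collapse_hom) auto
    let ?c = "dS_comp n 0 (dS_collapse m [0..<Suc m]) \<alpha>"
    have cc: "?c \<in> dS_hom n 0" by (rule dS_comp_hom[OF \<alpha> c])
    have s: "set (snd ?c 0) = {..n}" using dS_homD(3)[OF cc, of 0] dS_homD(1)[OF cc] by auto
    have "list_prod A (fibre_products A m \<alpha> a) [0..<Suc m] = fibre_products A 0 (dS_collapse m [0..<Suc m]) (fibre_products A m \<alpha> a) 0"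
      by (simp add: fibre_products_eq[of 0] dS_collapse_def)
    also have "\<dots> = list_prod A a (snd ?c 0)"
      unfolding fibre_products_comp[OF \<alpha> c a, symmetric] by (simp add: fibre_products_eq[of 0])
    finally have "?I +>\<^bsub>A\<^esub> list_prod A (fibre_products A m \<alpha> a) [0..<Suc m] = ?I +>\<^bsub>A\<^esub> list_prod A a (snd ?c 0)"
      by simp
    also have "\<dots> = ?I +>\<^bsub>A\<^esub> list_prod A a [0..<Suc n]"
      by (rule list_prod_reorder) (use dS_homD(2)[OF cc, of 0] s tensor_power_gens_nth[OF a] in auto)
    finally show "\<pi> m (fmap (Bsym R A) n m \<alpha> (tensor_class n a)) = \<pi> n (tensor_class n a)"
      using \<pi>c[OF a] \<pi>c[OF fibre_products_closed[OF \<alpha> a]] Bsym_fmap(2)[OF \<alpha> a] by simp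
  qed
  have orbit_hom: "(\<lambda>r. r \<odot>\<^bsub>?Q\<^esub> X) \<in> module_hom R (regular_module R) ?Q" if "X \<in> carrier ?Q" for X
    using that by (intro module_homI) (auto simp: rm Q.smult_l_distr Q.smult_assoc1)
  have "dS_balanced R (const_functor R) (Bsym R A) ?Q (\<lambda>(n, r, y). r \<odot>\<^bsub>?Q\<^esub> \<pi> n y)"
    by (rule dS_balancedI)
      (simp_all add: cfo rm Bsym_fobj \<pi>nat orbit_hom module_homD(1)[OF \<pi>] module_hom_comp[OF \<pi> smult_hom[OF Qm]])
  then obtain \<Phi> where \<Phi>: "\<Phi> \<in> module_hom R ?T ?Q"
    and \<Phi>t: "\<And>u. u \<in> tensor_gens (const_functor R) (Bsym R A) \<Longrightarrow>
      \<Phi> (?t u) = (case u of (n, r, y) \<Rightarrow> r \<odot>\<^bsub>?Q\<^esub> \<pi> n y)"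
    using tensor_dS_lift[OF R_cring cf Bsym_covariant Qm] by blast
  have gens: "(n, r, y) \<in> tensor_gens (const_functor R) (Bsym R A) \<longleftrightarrow>
      r \<in> carrier R \<and> y \<in> carrier (tensor_power R A n)" for n r y
    by (simp add: tensor_gens_def cfo rm Bsym_fobj)

  define \<psi> where "\<psi> a = ?t (0, \<one>\<^bsub>R\<^esub>, tensor_class 0 (\<lambda>i\<in>{..0}. a))" for a
  have \<psi>: "\<psi> \<in> module_hom R A ?T"
  proof -
    \<comment> \<open>The zero tuple serves only to exhibit the tuple \<open>(x)\<close> as an update, the form in which
      multilinearity is stated.\<close>
    let ?z = "\<lambda>i\<in>{..0::nat}. \<zero>\<^bsub>A\<^esub>"
    have "?z \<in> tensor_power_gens A 0" by (auto simp: tensor_power_gens_def)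
    then have "(\<lambda>x. tensor_class 0 (?z(0 := x))) \<in> module_hom R A (tensor_power R A 0)"
      by (rule tensor_class_multilinear) simp
    moreover have "(\<lambda>y. ?t (0, \<one>\<^bsub>R\<^esub>, y)) \<in> module_hom R (tensor_power R A 0) ?T"
      using dS_balancedD(2)[OF tb, of "\<one>\<^bsub>R\<^esub>" 0] by (simp add: cfo rm Bsym_fobj)
    ultimately have "(\<lambda>x. ?t (0, \<one>\<^bsub>R\<^esub>, tensor_class 0 (?z(0 := x)))) \<in> module_hom R A ?T"
      by (rule module_hom_comp)
    moreover have "?z(0 := x) = (\<lambda>i\<in>{..0}. x)" for x by (auto simp: fun_eq_iff)
    ultimately show ?thesis unfolding \<psi>_def by (simp only:)
  qed
  have \<psi>_prod: "\<psi> (list_prod A a l) = ?t (n, \<one>\<^bsub>R\<^esub>, tensor_class n a)"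
    if a: "a \<in> tensor_power_gens A n" and l: "distinct l" "set l = {..n}" for a n l
  proof -
    note c = dS_collapse_hom[OF l]
    have "fibre_products A 0 (dS_collapse n l) a = (\<lambda>i\<in>{..0}. list_prod A a l)"
      by (auto simp: fibre_products_eq dS_collapse_def fun_eq_iff)
    then have "\<psi> (list_prod A a l) = ?t (0, \<one>\<^bsub>R\<^esub>, fmap (Bsym R A) n 0 (dS_collapse n l) (tensor_class n a))"
      using Bsym_fmap(2)[OF c a] by (simp add: \<psi>_def)
    also have "\<dots> = ?t (n, \<one>\<^bsub>R\<^esub>, tensor_class n a)"
      using dS_balancedD(3)[OF tb c, of "\<one>\<^bsub>R\<^esub>" "tensor_class n a"] tensor_class_closed[OF a]
      by (simp add: cfo rm Bsym_fobj)
    finally show ?thesis .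
  qed
  have swap: "\<psi> (u \<otimes>\<^bsub>A\<^esub> (a \<otimes>\<^bsub>A\<^esub> b) \<otimes>\<^bsub>A\<^esub> v) = \<psi> (u \<otimes>\<^bsub>A\<^esub> (b \<otimes>\<^bsub>A\<^esub> a) \<otimes>\<^bsub>A\<^esub> v)"
    if h: "u \<in> carrier A" "a \<in> carrier A" "b \<in> carrier A" "v \<in> carrier A" for u a b v
  proof -
    \<comment> \<open>\<open>u \<otimes> a \<otimes> b \<otimes> v\<close>, to be collapsed along two orders of \<open>[3]\<close>.\<close>
    define w where "w = (\<lambda>i\<in>{..3::nat}. [u, a, b, v] ! i)"
    have s: "{..3::nat} = {0, 1, 2, 3}" by auto
    have w: "w 0 = u" "w 1 = a" "w 2 = b" "w 3 = v" by (simp_all add: w_def)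
    have wg: "w \<in> tensor_power_gens A 3"
      using h by (auto simp: tensor_power_gens_def w_def s)
    have "\<psi> (list_prod A w [0, 1, 2, 3]) = \<psi> (list_prod A w [0, 2, 1, 3])"
      using \<psi>_prod[OF wg, of "[0, 1, 2, 3]"] \<psi>_prod[OF wg, of "[0, 2, 1, 3]"] by (auto simp: s)
    moreover have "list_prod A w [0, 1, 2, 3] = u \<otimes>\<^bsub>A\<^esub> (a \<otimes>\<^bsub>A\<^esub> b) \<otimes>\<^bsub>A\<^esub> v"
      and "list_prod A w [0, 2, 1, 3] = u \<otimes>\<^bsub>A\<^esub> (b \<otimes>\<^bsub>A\<^esub> a) \<otimes>\<^bsub>A\<^esub> v"
      using h by (simp_all only: list_prod_simps w) (simp_all add: m_assoc)
    ultimately show ?thesis by simp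
  qed
  obtain \<Psi> where \<Psi>: "\<Psi> \<in> module_hom R ?Q ?T" and \<Psi>c: "\<And>a. a \<in> carrier A \<Longrightarrow> \<Psi> (?I +>\<^bsub>A\<^esub> a) = \<psi> a"
    using quot_module_lift[OF module_A I Tm \<psi> vanishes_on_commutator_ideal[OF Tm \<psi> swap]] by blast

  have \<Psi>\<Phi>: "\<Psi> (\<Phi> c) = c" if c: "c \<in> carrier ?T" for c
  proof -
    have i: "(\<lambda>c. c) \<in> module_hom R ?T ?T" by (rule module_homI) auto
    show ?thesis
    proof (rule tensor_dS_hom_eq[OF R_cring cf Bsym_covariant Tm module_hom_comp[OF \<Phi> \<Psi>] i _ c])
      fix t assume t: "t \<in> tensor_gens (const_functor R) (Bsym R A)"
      obtain n r y where nry: "t = (n, r, y)" by (cases t)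
      have r: "r \<in> carrier R" and y: "y \<in> carrier (tensor_power R A n)" using t by (simp_all add: nry gens)
      have th: "(\<lambda>y. ?t (n, r, y)) \<in> module_hom R (tensor_power R A n) ?T"
        using dS_balancedD(2)[OF tb, of r n] r by (simp add: cfo rm Bsym_fobj)
      have "\<Psi> (r \<odot>\<^bsub>?Q\<^esub> \<pi> n y) = ?t (n, r, y)"
      proof (rule tensor_power_hom_eq[OF Tm module_hom_comp[OF module_hom_comp[OF \<pi> smult_hom[OF Qm r]] \<Psi>] th _ y])
        fix a assume a: "a \<in> tensor_power_gens A n"
        have l: "distinct [0..<Suc n]" "set [0..<Suc n] = {..n}" by auto
        note p = pc[OF a l(2)]
        have "\<Psi> (r \<odot>\<^bsub>?Q\<^esub> \<pi> n (tensor_class n a)) = r \<odot>\<^bsub>?T\<^esub> \<Psi> (?I +>\<^bsub>A\<^esub> list_prod A a [0..<Suc n])"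
          unfolding \<pi>c[OF a] by (rule module_homD(3)[OF \<Psi> r coset_in_quot[OF module_A I p]])
        also have "\<dots> = r \<odot>\<^bsub>?T\<^esub> ?t (n, \<one>\<^bsub>R\<^esub>, tensor_class n a)"
          unfolding \<Psi>c[OF p] \<psi>_prod[OF a l] ..
        also have "\<dots> = ?t (n, r, tensor_class n a)"
          using module_homD(3)[OF dS_balancedD(1)[OF tb, of "tensor_class n a" n] r, of "\<one>\<^bsub>R\<^esub>"] r tensor_class_closed[OF a]
          by (simp add: cfo rm Bsym_fobj)
        finally show "\<Psi> (r \<odot>\<^bsub>?Q\<^esub> \<pi> n (tensor_class n a)) = ?t (n, r, tensor_class n a)" .
      qed
      then show "\<Psi> (\<Phi> (?t t)) = ?t t" using \<Phi>t[OF t] by (simp add: nry)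
    qed
  qed
  have \<Phi>\<Psi>: "\<Phi> (\<Psi> X) = X" if X: "X \<in> carrier ?Q" for X
  proof -
    obtain a where a: "a \<in> carrier A" "X = ?I +>\<^bsub>A\<^esub> a" by (rule quot_carrierE[OF module_A I X])
    have g: "(\<lambda>i\<in>{..0}. a) \<in> tensor_power_gens A 0" using a(1) by (auto simp: tensor_power_gens_def)
    have "\<Phi> (\<Psi> X) = \<one>\<^bsub>R\<^esub> \<odot>\<^bsub>?Q\<^esub> \<pi> 0 (tensor_class 0 (\<lambda>i\<in>{..0}. a))"
      using \<Phi>t[of "(0, \<one>\<^bsub>R\<^esub>, tensor_class 0 (\<lambda>i\<in>{..0}. a))"] tensor_class_closed[OF g]
      by (simp add: a \<Psi>c \<psi>_def gens)
    also have "\<dots> = X"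
      using \<pi>c[OF g] coset_in_quot[OF module_A I a(1)] a by simp
    finally show ?thesis .
  qed
  show ?thesis by (rule module_isomorphicI[OF \<Phi> \<Psi> \<Psi>\<Phi> \<Phi>\<Psi>])
qed

end

theorem theorem86:
  fixes R :: "('k, 'r) ring_scheme"
    and A :: "('k, 'a, 's) module_scheme"
    and P :: "nat \<Rightarrow> ('k, 'm) dS_functor"
    and d :: "nat \<Rightarrow> nat \<Rightarrow> 'm \<Rightarrow> 'm"
    and \<epsilon> :: "nat \<Rightarrow> 'm \<Rightarrow> 'k"
  assumes "unital_algebra R A"
    and "projective_resolution R (const_functor R) P d \<epsilon>"
  shows "module_isomorphic R (HS R A P d 0)
           (quot_module A (genideal A (commutator_submodule R A)))"
proof -
  interpret unital_algebra R A by fact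
  show ?thesis
    unfolding HS_def
    by (rule module_isomorphic_trans[OF Tor_dS_0[OF R_cring const_contravariant[OF R_cring]
            Bsym_covariant assms(2)] const_tensor_Bsym])
qed

end
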